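(* Let $1<p<\infty$ and $\frac1p+\frac1{p'}=1$. Let $S\in L^1(\mathbb R)$ with $\operatorname{supp}S\subseteq[\frac14,\frac34]$ and $\sum_{n\in\mathbb Z}|(S^\#)^\wedge(n)|^p<\infty$. For $\phi\in\ell_{p'}(\mathbb Z)$ define $W_{\phi,\hat S}(\xi)=\sum_{n\in\mathbb Z}\phi(n)\hat S(\xi-n)$. Then $W_{\phi,\hat S}\in M_q(\mathbb R)$ for $$q\in\Bigl[\tfrac{2p}{3p-2},\tfrac{2p}{2-p}\Bigr]\ \text{ if } 1<p<2,\qquad q\in\Bigl[\tfrac{2p}{p+2},\tfrac{2p}{p-2}\Bigr]\ \text{ if } 2<p<\infty,$$ and for all $1\le q<\infty$ if $p=2$. Moreover, $$\|W_{\phi,\hat S}\|_{M_q(\mathbb R)}\le C\,\tau_p\,\|\phi\|_{p'},\qquad \tau_p=\Bigl(\sum_{n\in\mathbb Z}|(S^\#)^\wedge(n)|^p\Bigr)^{1/p},$$ where $C$ is a constant which depends only on $p$.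
   Context: For $1\le q<\infty$, $M_q(\mathbb R)$ denotes the space of Fourier multipliers for $L^q(\mathbb R)$, i.e. functions $m\in L^\infty(\mathbb R)$ such that $f\mapsto(m\hat f)^\vee$ extends to a bounded operator on $L^q(\mathbb R)$, with $\|m\|_{M_q(\mathbb R)}$ the operator norm. Fourier transform: $\hat f(\xi)=\int_{\mathbb R}f(x)e^{-2\pi i\xi x}\,dx$. $S^\#$ is the 1-periodic extension of $S$ from $[0,1)$, and $(S^\#)^\wedge(n)=\int_0^1 S^\#(x)e^{-2\pi inx}\,dx$ its Fourier coefficients. $\|\phi\|_{p'}$ is the $\ell_{p'}(\mathbb Z)$ norm. *)

theory Defs
  imports "HOL-Analysis.Analysis"
begin

text \<open>Elements of Lebesgue spaces are represented by functions; everything below that refers to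
  such elements is insensitive to changes on null sets.\<close>

definition Lspace :: "real \<Rightarrow> (real \<Rightarrow> complex) set" where
  "Lspace q = {f. f \<in> borel_measurable lebesgue \<and> integrable lebesgue (\<lambda>x. norm (f x) powr q)}"

definition Lnorm :: "real \<Rightarrow> (real \<Rightarrow> complex) \<Rightarrow> real" where
  "Lnorm q f = (LINT x|lebesgue. norm (f x) powr q) powr (1 / q)"

definition Linfty :: "(real \<Rightarrow> complex) set" where
  "Linfty = {m. m \<in> borel_measurable lebesgue \<and> (\<exists>B. AE x in lebesgue. norm (m x) \<le> B)}"

text \<open>The complement of the largest open set on which the function vanishes almost everywhere.\<close>

definition ess_support :: "(real \<Rightarrow> complex) \<Rightarrow> real set" where
  "ess_support f = - \<Union>{U. open U \<and> (AE x in lebesgue. x \<in> U \<longrightarrow> f x = 0)}"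

lemma ess_support_subset_iff:
  assumes "closed A"
  shows "ess_support f \<subseteq> A \<longleftrightarrow> (AE x in lebesgue. x \<notin> A \<longrightarrow> f x = 0)"
proof
  assume sub: "ess_support f \<subseteq> A"
  let ?F = "{U. open U \<and> (AE x in lebesgue. x \<in> U \<longrightarrow> f x = 0)}"
  obtain G where G: "G \<subseteq> ?F" "countable G" "\<Union>G = \<Union>?F"
    using Lindelof[of ?F] by blast
  have "AE x in lebesgue. \<forall>U\<in>G. x \<in> U \<longrightarrow> f x = 0"
    using G by (subst AE_ball_countable) auto
  then show "AE x in lebesgue. x \<notin> A \<longrightarrow> f x = 0"
  proof (rule AE_mp, intro AE_I2 impI)
    fix x assume *: "\<forall>U\<in>G. x \<in> U \<longrightarrow> f x = 0" and "x \<notin> A"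
    then have "x \<in> \<Union>?F" using sub unfolding ess_support_def by blast
    then show "f x = 0" using * G(3) by blast
  qed
next
  assume "AE x in lebesgue. x \<notin> A \<longrightarrow> f x = 0"
  then have "- A \<in> {U. open U \<and> (AE x in lebesgue. x \<in> U \<longrightarrow> f x = 0)}"
    using assms by (simp add: open_Compl)
  then show "ess_support f \<subseteq> A" unfolding ess_support_def by blast
qed

definition lspace :: "real \<Rightarrow> (int \<Rightarrow> complex) set" where
  "lspace r = {a. (\<lambda>n. norm (a n) powr r) summable_on UNIV}"

definition lnorm :: "real \<Rightarrow> (int \<Rightarrow> complex) \<Rightarrow> real" where
  "lnorm r a = (\<Sum>\<^sub>\<infinity>n. norm (a n) powr r) powr (1 / r)"

definition fourier :: "(real \<Rightarrow> complex) \<Rightarrow> real \<Rightarrow> complex" where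
  "fourier f \<xi> = (LINT x|lebesgue. f x * cis (- 2 * pi * \<xi> * x))"

definition inv_fourier :: "(real \<Rightarrow> complex) \<Rightarrow> real \<Rightarrow> complex" where
  "inv_fourier g x = (LINT \<xi>|lebesgue. g \<xi> * cis (2 * pi * \<xi> * x))"

definition per_ext :: "(real \<Rightarrow> complex) \<Rightarrow> real \<Rightarrow> complex" where
  "per_ext S x = S (frac x)"

definition fourier_coeff :: "(real \<Rightarrow> complex) \<Rightarrow> int \<Rightarrow> complex" where
  "fourier_coeff g n = (LINT x:{0..1}|lebesgue. g x * cis (- 2 * pi * of_int n * x))"

definition schwartz :: "(real \<Rightarrow> complex) set" where
  "schwartz = {f. \<exists>D :: nat \<Rightarrow> real \<Rightarrow> complex. D 0 = f \<and>
     (\<forall>k x. (D k has_vector_derivative D (Suc k) x) (at x)) \<and>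
     (\<forall>j k. bounded (range (\<lambda>x. x ^ j *\<^sub>R D k x)))}"

text \<open>Linearity is required up to null sets. Together with the bound it implies that \<open>T\<close> sends
  functions that agree almost everywhere to functions that agree almost everywhere.\<close>

definition bounded_operator_L :: "real \<Rightarrow> ((real \<Rightarrow> complex) \<Rightarrow> real \<Rightarrow> complex) \<Rightarrow> bool" where
  "bounded_operator_L q T \<longleftrightarrow>
     (\<forall>f\<in>Lspace q. T f \<in> Lspace q) \<and>
     (\<forall>f\<in>Lspace q. \<forall>g\<in>Lspace q. AE x in lebesgue. T (\<lambda>y. f y + g y) x = T f x + T g x) \<and>
     (\<forall>f\<in>Lspace q. \<forall>c. AE x in lebesgue. T (\<lambda>y. c * f y) x = c * T f x) \<and>
     (\<exists>K. \<forall>f\<in>Lspace q. Lnorm q (T f) \<le> K * Lnorm q f)"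

definition onorm_L :: "real \<Rightarrow> ((real \<Rightarrow> complex) \<Rightarrow> real \<Rightarrow> complex) \<Rightarrow> real" where
  "onorm_L q T = (SUP f\<in>Lspace q. Lnorm q (T f) / Lnorm q f)"

text \<open>The operator \<open>f \<mapsto> (m f\<^sup>\<and>)\<^sup>\<or>\<close> is initially given on Schwartz functions, where
  for bounded \<open>m\<close> both integrals converge absolutely.\<close>

definition multiplier_extension ::
    "real \<Rightarrow> (real \<Rightarrow> complex) \<Rightarrow> ((real \<Rightarrow> complex) \<Rightarrow> real \<Rightarrow> complex) \<Rightarrow> bool" where
  "multiplier_extension q m T \<longleftrightarrow> bounded_operator_L q T \<and>
     (\<forall>f\<in>schwartz. AE x in lebesgue. T f x = inv_fourier (\<lambda>\<xi>. m \<xi> * fourier f \<xi>) x)"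

definition multipliers :: "real \<Rightarrow> (real \<Rightarrow> complex) set" where
  "multipliers q = {m \<in> Linfty. \<exists>T. multiplier_extension q m T}"

text \<open>Since Schwartz functions are dense in \<open>L\<^sup>q\<close> for finite \<open>q\<close>, the extension is unique
  up to null sets, so the norm does not depend on the choice of \<open>T\<close>.\<close>

definition multiplier_norm :: "real \<Rightarrow> (real \<Rightarrow> complex) \<Rightarrow> real" where
  "multiplier_norm q m = onorm_L q (SOME T. multiplier_extension q m T)"

definition W_fun :: "(int \<Rightarrow> complex) \<Rightarrow> (real \<Rightarrow> complex) \<Rightarrow> real \<Rightarrow> complex" where
  "W_fun \<phi> \<Lambda> \<xi> = (\<Sum>\<^sub>\<infinity>n. \<phi> n * \<Lambda> (\<xi> - of_int n))"

end

theory Submission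
  imports Defs "HOL-Complex_Analysis.Complex_Analysis" "HOL-Probability.Probability"
    "HOL-Real_Asymp.Real_Asymp"
begin

text \<open>For finitely supported \<open>\<phi>\<close> the multiplier is the Fourier transform of the kernel \<open>S\<Phi>\<close>, where
  \<open>\<Phi>\<close> is the trigonometric polynomial with coefficients \<open>\<phi>\<close>. Test convolution with this kernel
  against functions \<open>f\<close> and \<open>g\<close> carried by short intervals, and replace \<open>S\<close> by a trigonometric
  polynomial with coefficients \<open>a\<close>. The resulting form in \<open>(a, \<phi>, f, g)\<close> is bounded on
  \<open>\<ell>\<^sub>1 \<times> \<ell>\<^sub>\<infinity> \<times> L\<^sup>2 \<times> L\<^sup>2\<close> by Bessel's inequality, and on \<open>\<ell>\<^sub>2 \<times> \<ell>\<^sub>2 \<times> L\<^sup>r \<times> L\<^sup>r\<^sup>'\<close> for every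
  \<open>1 \<le> r \<le> \<infinity>\<close> because a product of two \<open>L\<^sup>2\<close> functions on the circle is integrable. Complex
  interpolation between the two gives the stated range of \<open>q\<close> for \<open>p \<le> 2\<close>; the form is symmetric in
  \<open>a\<close> and \<open>\<phi>\<close>, so \<open>p > 2\<close> follows by exchanging \<open>p\<close> and \<open>p'\<close>. Fejer means of \<open>S\<close> return to
  the original kernel, and since the kernel is supported in \<open>[1/4, 3/4]\<close> the local estimates add up
  to a global one with bounded overlap.\<close>

subsection \<open>Waves, Bessel's inequality and the trilinear form\<close>

text \<open>Periodic polynomials are not integrable on the line, so neither endpoint estimate
  applies to global \<open>f\<close> and \<open>g\<close>. Short pieces remove this obstacle:
  \<open>f\<close> on a length of 1/8 and \<open>g\<close> on the interval that the kernel can reach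
  lie in one unit interval, as Bessel's inequality asks, and their differences stay inside one
  period, as the product of two square integrable polynomials asks.

  In terms of 1/q the range is |1/q - 1/2| <= min(1/p, 1/p'), and the interpolation parameter is
  \<theta> = 2 - 2/p. The endpoint q = 1 occurs only for p = 2; its dual exponent is infinite, and
  the square integrable estimate serves it directly.

  Since \<open>S\<close> is merely integrable, the Fejer means act on the continuous correlation of
  \<open>f\<close> and \<open>g\<close> and reach \<open>S\<close> by duality.

  For infinite \<open>\<phi>\<close> one map on all of the space is wanted, linear up to null sets.
  It is the almost everywhere limit along one exhaustion of the integers, chosen from the tails of
  \<open>\<phi>\<close> alone and hence common to all \<open>f\<close>. The constant is 6 for every
  p: it bounds the number of pieces whose images meet at a point.\<close>

lemma strip_maximum_modulus:
  fixes F :: "complex \<Rightarrow> complex"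
  assumes hol: "F holomorphic_on UNIV"
    and bdd: "\<And>z. 0 \<le> Re z \<Longrightarrow> Re z \<le> 1 \<Longrightarrow> norm (F z) \<le> B"
    and left: "\<And>z. Re z = 0 \<Longrightarrow> norm (F z) \<le> C"
    and right: "\<And>z. Re z = 1 \<Longrightarrow> norm (F z) \<le> C"
    and z: "0 \<le> Re z" "Re z \<le> 1"
  shows "norm (F z) \<le> C"
proof -
  have B0: "0 \<le> B" using order_trans[OF norm_ge_zero bdd[of 0]] by simp
  have C0: "0 \<le> C" using order_trans[OF norm_ge_zero left[of 0]] by simp
  have *: "norm (F z) * exp (e * ((Re z)\<^sup>2 - (Im z)\<^sup>2 - 1)) \<le> C + e" if e: "e > 0" for e :: real
  proof -
    \<comment> \<open>On the strip (Re w)^2 <= 1, so the Gaussian factor has modulus at most 1 there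
      and decays like exp(-e (Im w)^2). Hence the a priori bound \<open>B\<close> is felt only on
      the horizontal sides of a tall rectangle, where it is beaten down below e; afterwards e tends
      to 0.\<close>
    define G where "G = (\<lambda>w. F w * exp (of_real e * (w\<^sup>2 - 1)))"
    have nG: "norm (G w) = norm (F w) * exp (e * ((Re w)\<^sup>2 - (Im w)\<^sup>2 - 1))" for w
      by (simp add: G_def norm_mult norm_exp_eq_Re power2_eq_square)
    have "((\<lambda>R. B * exp (- e * R\<^sup>2)) \<longlongrightarrow> 0) at_top" using e by real_asymp
    then have "\<forall>\<^sub>F R in at_top. B * exp (- e * R\<^sup>2) < e"
      by (rule order_tendstoD(2)) (use e in simp)
    then have "\<forall>\<^sub>F R in at_top. B * exp (- e * R\<^sup>2) < e \<and> R > \<bar>Im z\<bar>"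
      using eventually_gt_at_top eventually_conj by blast
    then obtain R where R: "B * exp (- e * R\<^sup>2) < e" "R > \<bar>Im z\<bar>"
      using eventually_happens'[OF trivial_limit_at_top_linorder] by blast
    let ?S = "cbox (Complex 0 (- R)) (Complex 1 R)"
    have "norm (G z) \<le> C + e"
    proof (rule maximum_modulus_frontier[of G ?S])
      show "G holomorphic_on interior ?S" unfolding G_def
        by (intro holomorphic_intros holomorphic_on_subset[OF hol]) auto
      have "G holomorphic_on closure ?S" unfolding G_def
        by (intro holomorphic_intros holomorphic_on_subset[OF hol]) auto
      then show "continuous_on (closure ?S) G" by (rule holomorphic_on_imp_continuous_on)
      show "z \<in> ?S" using z R by (auto simp: in_cbox_complex_iff)
      fix w assume "w \<in> frontier ?S"
      then have w: "w \<in> ?S" "w \<notin> box (Complex 0 (- R)) (Complex 1 R)"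
        by (auto simp: frontier_def)
      then have wr: "0 \<le> Re w" "Re w \<le> 1" "\<bar>Im w\<bar> \<le> R" by (auto simp: in_cbox_complex_iff)
      have sq: "(Re w)\<^sup>2 \<le> 1" using wr by (simp add: abs_square_le_1)
      have neg: "(Re w)\<^sup>2 - (Im w)\<^sup>2 - 1 \<le> 0" using sq zero_le_power2[of "Im w"] by linarith
      consider "Re w = 0" | "Re w = 1" | "\<bar>Im w\<bar> = R" using w wr
        by (auto simp: in_box_complex_iff)
      then show "norm (G w) \<le> C + e"
      proof cases
        case 3
        then have "(Im w)\<^sup>2 = R\<^sup>2" by (metis power2_abs)
        then have "exp (e * ((Re w)\<^sup>2 - (Im w)\<^sup>2 - 1)) \<le> exp (- e * R\<^sup>2)"
          using sq e by (simp add: algebra_simps)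
        then have "norm (G w) \<le> B * exp (- e * R\<^sup>2)"
          unfolding nG using bdd[OF wr(1,2)] B0 by (intro mult_mono) auto
        then show ?thesis using R C0 by simp
      next
        case 1
        have "exp (e * ((Re w)\<^sup>2 - (Im w)\<^sup>2 - 1)) \<le> 1" using e mult_nonneg_nonpos[OF _ neg, of e] by simp
        then have "norm (G w) \<le> C * 1" unfolding nG using left[OF 1] C0 by (intro mult_mono) auto
        then show ?thesis using e by simp
      next
        case 2
        have "exp (e * ((Re w)\<^sup>2 - (Im w)\<^sup>2 - 1)) \<le> 1" using e mult_nonneg_nonpos[OF _ neg, of e] by simp
        then have "norm (G w) \<le> C * 1" unfolding nG using right[OF 2] C0 by (intro mult_mono) auto
        then show ?thesis using e by simp
      qed
    qed (auto intro: bounded_cbox)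
    then show ?thesis by (simp add: nG)
  qed
  have "((\<lambda>e. norm (F z) * exp (e * ((Re z)\<^sup>2 - (Im z)\<^sup>2 - 1))) \<longlongrightarrow> norm (F z) * exp (0 * ((Re z)\<^sup>2 - (Im z)\<^sup>2 - 1))) (at_right 0)"
    by (intro tendsto_intros)
  moreover have "((\<lambda>e. C + e) \<longlongrightarrow> C + 0) (at_right 0)" by (intro tendsto_intros)
  ultimately have "norm (F z) * exp (0 * ((Re z)\<^sup>2 - (Im z)\<^sup>2 - 1)) \<le> C + 0"
    by (intro tendsto_le[OF trivial_limit_at_right_real]) (auto intro: eventually_mono[OF eventually_at_right_less] *)
  then show ?thesis by simp
qed

section \<open>Characters and trigonometric polynomials on unit intervals\<close>

definition wave :: "real \<Rightarrow> real \<Rightarrow> complex" where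
  "wave t x = cis (2 * pi * t * x)"

lemma norm_wave [simp]: "norm (wave t x) = 1"
  by (simp add: wave_def)

lemma wave_add_left: "wave (s + t) x = wave s x * wave t x"
  by (simp add: wave_def cis_mult algebra_simps)

lemma borel_measurable_cnj [measurable (raw)]:
  "g \<in> borel_measurable M \<Longrightarrow> (\<lambda>x. cnj (g x)) \<in> borel_measurable M"
  by (rule borel_measurable_continuous_on[where f=cnj]) (auto intro!: continuous_intros)

lemma wave_diff_left: "wave (s - t) x = wave s x * wave (- t) x"
  by (simp add: wave_def cis_mult algebra_simps)

lemma wave_add_right: "wave t (x + y) = wave t x * wave t y"
  by (simp add: wave_def cis_mult algebra_simps)

lemma wave_diff_right: "wave t (x - y) = wave t x * wave (- t) y"
  by (simp add: wave_def cis_mult algebra_simps)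

lemma cnj_wave: "cnj (wave t x) = wave (- t) x"
  by (simp add: wave_def cis_cnj)

lemma wave_0 [simp]: "wave 0 x = 1" "wave t 0 = 1"
  by (simp_all add: wave_def)

lemma continuous_on_wave [continuous_intros]:
  "continuous_on A g \<Longrightarrow> continuous_on A (\<lambda>x. wave t (g x))"
  unfolding wave_def by (intro continuous_intros)

lemma borel_measurable_wave [measurable (raw)]:
  "g \<in> borel_measurable M \<Longrightarrow> (\<lambda>x. wave t (g x)) \<in> borel_measurable M"
  by (rule borel_measurable_continuous_on[where f="wave t"]) (auto intro!: continuous_intros)

lemma integrable_mult_wave:
  assumes "integrable lborel f"
  shows "integrable lborel (\<lambda>x. f x * wave t x)"
  by (rule Bochner_Integration.integrable_bound[OF assms]) (use assms in \<open>auto simp: norm_mult\<close>)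

lemma has_vector_derivative_wave:
  "(wave t has_vector_derivative (2 * pi * t * \<i>) * wave t x) (at x)"
proof -
  have "((\<lambda>z. exp ((2 * pi * t * \<i>) * z)) has_field_derivative (2 * pi * t * \<i>) * exp ((2 * pi * t * \<i>) * of_real x)) (at (of_real x))"
    by (auto intro!: derivative_eq_intros)
  from has_vector_derivative_real_field[OF this] show ?thesis
    by (simp add: wave_def[abs_def] cis_conv_exp mult_ac)
qed

lemma integral_wave_period:
  "(LINT x:{s..s+1}|lborel. wave (of_int m) x) = (if m = 0 then 1 else 0)"
proof (cases "m = 0")
  case True
  then show ?thesis by (simp add: set_lebesgue_integral_def scaleR_conv_of_real)
next
  case False
  let ?P = "\<lambda>x. wave (of_int m) x / (2 * pi * of_int m * \<i>)"
  have "(LINT x:{s..s+1}|lborel. wave (of_int m) x) = ?P (s + 1) - ?P s"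
    unfolding set_lebesgue_integral_def
  proof (rule integral_FTC_atLeastAtMost)
    fix x :: real
    have "(?P has_vector_derivative (2 * pi * of_int m * \<i>) * wave (of_int m) x / (2 * pi * of_int m * \<i>)) (at x)"
      using has_vector_derivative_wave[of "of_int m" x] by (intro has_vector_derivative_divide) simp
    then have "(?P has_vector_derivative wave (of_int m) x) (at x)" using False by simp
    then show "(?P has_vector_derivative wave (of_int m) x) (at x within {s..s + 1})"
      by (rule has_vector_derivative_at_within)
  qed (auto intro!: continuous_intros)
  also have "wave (of_int m) (s + 1) = wave (of_int m) s"
    unfolding wave_add_right by (simp add: wave_def cis_multiple_2pi)
  finally show ?thesis using False by simp
qed

lemma sum_mult_sum_mult:
  fixes f :: "'a \<Rightarrow> 'c::comm_semiring_0"
  shows "sum f A * sum g B * c = (\<Sum>i\<in>A. \<Sum>j\<in>B. f i * g j * c)"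
  by (subst sum_product) (simp add: sum_distrib_right)

lemma integral_wave_period':
  fixes t :: int
  shows "(LINT x|lborel. indicator {s..s+1} x * wave (of_int t) x) = (if t = 0 then 1 else 0)"
  using integral_wave_period[of s t]
  by (simp add: set_lebesgue_integral_def scaleR_conv_of_real of_real_indicator)

lemma integrable_indicator_wave:
  "integrable lborel (\<lambda>x. complex_of_real (indicator {a..b::real} x) * wave t x)"
  by (intro integrable_mult_wave integrable_of_real integrable_real_indicator) (auto simp: emeasure_lborel_Icc_eq)

definition trig_poly :: "int set \<Rightarrow> (int \<Rightarrow> complex) \<Rightarrow> real \<Rightarrow> complex" where
  "trig_poly A a x = (\<Sum>k\<in>A. a k * wave (of_int k) x)"

lemma borel_measurable_trig_poly [measurable (raw)]:
  "g \<in> borel_measurable M \<Longrightarrow> (\<lambda>x. trig_poly A a (g x)) \<in> borel_measurable M"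
  unfolding trig_poly_def by measurable

lemma continuous_on_trig_poly [continuous_intros]:
  "continuous_on X g \<Longrightarrow> continuous_on X (\<lambda>x. trig_poly A a (g x))"
  unfolding trig_poly_def by (intro continuous_intros)

lemma norm_trig_poly_le: "norm (trig_poly A a x) \<le> (\<Sum>k\<in>A. norm (a k))"
  unfolding trig_poly_def by (rule order_trans[OF norm_sum]) (simp add: norm_mult)

lemma parseval_trig_poly:
  assumes A: "finite A"
  shows "(LINT x|lborel. indicator {s..s+1} x * (norm (trig_poly A a x))\<^sup>2) = (\<Sum>k\<in>A. (norm (a k))\<^sup>2)"
proof -
  have "complex_of_real (indicator {s..s+1} x * (norm (trig_poly A a x))\<^sup>2) =
      (\<Sum>k\<in>A. \<Sum>l\<in>A. a k * cnj (a l) * (indicator {s..s+1} x * wave (of_int (k - l)) x))" for x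
  proof -
    have "complex_of_real (indicator {s..s+1} x * (norm (trig_poly A a x))\<^sup>2) =
        (trig_poly A a x * cnj (trig_poly A a x)) * indicator {s..s+1} x"
      unfolding of_real_mult complex_norm_square by (simp add: of_real_indicator)
    also have "\<dots> = (\<Sum>k\<in>A. \<Sum>l\<in>A. a k * cnj (a l) * (indicator {s..s+1} x * wave (of_int (k - l)) x))"
      unfolding trig_poly_def cnj_sum sum_mult_sum_mult
      by (intro sum.cong refl) (simp add: cnj_wave wave_diff_left mult_ac)
    finally show ?thesis .
  qed
  moreover have i: "integrable lborel (\<lambda>x. a k * cnj (a l) * (indicator {s..s+1} x * wave (of_int (k - l)) x))" for k l
    using integrable_indicator_wave[of s "s + 1"] by (intro integrable_mult_right) (simp add: of_real_indicator)
  ultimately have "complex_of_real (LINT x|lborel. indicator {s..s+1} x * (norm (trig_poly A a x))\<^sup>2) =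
      (LINT x|lborel. (\<Sum>k\<in>A. \<Sum>l\<in>A. a k * cnj (a l) * (indicator {s..s+1} x * wave (of_int (k - l)) x)))"
    by (subst integral_complex_of_real[symmetric]) (simp only:)
  also have "\<dots> = (\<Sum>k\<in>A. \<Sum>l\<in>A. LINT x|lborel. a k * cnj (a l) * (indicator {s..s+1} x * wave (of_int (k - l)) x))"
    using i by (simp add: Bochner_Integration.integral_sum del: of_int_diff integral_mult_right_zero)
  also have "\<dots> = (\<Sum>k\<in>A. \<Sum>l\<in>A. a k * cnj (a l) * (if k - l = 0 then 1 else 0))"
    by (simp only: Bochner_Integration.integral_mult_right_zero integral_wave_period')
  also have "\<dots> = (\<Sum>k\<in>A. \<Sum>l\<in>A. if k = l then a k * cnj (a k) else 0)"
    by (intro sum.cong refl) auto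
  also have "\<dots> = of_real (\<Sum>k\<in>A. (norm (a k))\<^sup>2)"
    using A by (simp add: of_real_sum complex_norm_square del: of_real_power)
  finally show ?thesis by (simp only: of_real_eq_iff)
qed

lemma norm_diff_square:
  "(norm (z - w))\<^sup>2 = (norm z)\<^sup>2 - 2 * Re (z * cnj w) + (norm w)\<^sup>2" for z w :: complex
  unfolding cmod_power2 by (simp add: power2_eq_square algebra_simps)

text \<open>Expand the integral of |f - P|^2 over one period, where P has the coefficients of f: the
  cross term contributes minus twice the sum of squares and, by \<open>parseval_trig_poly\<close>, P
  contributes it once.\<close>

lemma bessel:
  assumes F: "finite F" and f: "integrable lborel f" and f2: "integrable lborel (\<lambda>x. (norm (f x))\<^sup>2)"
    and supp: "\<And>x. x \<notin> {s..s+1} \<Longrightarrow> f x = 0"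
  shows "(\<Sum>m\<in>F. (norm (LINT x|lborel. f x * wave (- of_int m) x))\<^sup>2) \<le> (LINT x|lborel. (norm (f x))\<^sup>2)"
proof -
  define c where "c m = (LINT x|lborel. f x * wave (- of_int m) x)" for m :: int
  let ?P = "trig_poly F c"
  let ?I = "indicator {s..s+1} :: real \<Rightarrow> real"
  have iP: "integrable lborel (\<lambda>x. f x * cnj (?P x))"
    by (rule Bochner_Integration.integrable_bound[OF integrable_mult_left[OF integrable_norm[OF f], of "\<Sum>k\<in>F. norm (c k)"]])
      (use f norm_trig_poly_le[of F c] in
        \<open>auto intro!: borel_measurable_times borel_measurable_cnj mult_left_mono simp: norm_mult sum_nonneg\<close>)
  have iPP: "integrable lborel (\<lambda>x. ?I x * (norm (?P x))\<^sup>2)"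
    by (rule borel_integrable_compact[of "{s..s+1}" "\<lambda>x. (norm (?P x))\<^sup>2", simplified])
      (auto intro!: continuous_intros)
  have "(LINT x|lborel. f x * cnj (?P x)) = (LINT x|lborel. (\<Sum>m\<in>F. cnj (c m) * (f x * wave (- of_int m) x)))"
    by (simp add: trig_poly_def sum_distrib_left cnj_wave mult_ac)
  also have "\<dots> = (\<Sum>m\<in>F. cnj (c m) * c m)"
    by (subst Bochner_Integration.integral_sum)
      (auto simp: c_def intro!: integrable_mult_right integrable_mult_wave f)
  also have "\<dots> = of_real (\<Sum>m\<in>F. (norm (c m))\<^sup>2)"
    by (simp only: of_real_sum complex_norm_square mult.commute)
  finally have eq: "Re (LINT x|lborel. f x * cnj (?P x)) = (\<Sum>m\<in>F. (norm (c m))\<^sup>2)"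
    by (metis Re_complex_of_real)
  define h where "h x = Re (f x * cnj (?P x))" for x
  have ih: "integrable lborel h" and eh: "(LINT x|lborel. h x) = (\<Sum>m\<in>F. (norm (c m))\<^sup>2)"
    unfolding h_def using integrable_Re[OF iP] integral_Re[OF iP] eq by simp_all
  have "0 \<le> (LINT x|lborel. (norm (f x))\<^sup>2 - 2 * h x + ?I x * (norm (?P x))\<^sup>2)"
  proof (rule integral_nonneg_AE, rule AE_I2)
    fix x
    show "0 \<le> (norm (f x))\<^sup>2 - 2 * h x + ?I x * (norm (?P x))\<^sup>2"
    proof (cases "x \<in> {s..s+1}")
      case True
      have "(norm (f x))\<^sup>2 - 2 * h x + ?I x * (norm (?P x))\<^sup>2 = (norm (f x - ?P x))\<^sup>2"
        using True by (simp add: norm_diff_square h_def)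
      then show ?thesis by simp
    next
      case False
      then show ?thesis using supp[of x] by (simp add: h_def)
    qed
  qed
  also have "\<dots> = (LINT x|lborel. (norm (f x))\<^sup>2) - 2 * (\<Sum>m\<in>F. (norm (c m))\<^sup>2) + (\<Sum>m\<in>F. (norm (c m))\<^sup>2)"
    using ih iPP f2 by (simp add: parseval_trig_poly[OF F] eh)
  finally show ?thesis by (simp add: c_def)
qed

section \<open>The trilinear kernel form and its two endpoint bounds\<close>

definition Lam :: "int set \<Rightarrow> int set \<Rightarrow> (int \<Rightarrow> complex) \<Rightarrow> (int \<Rightarrow> complex) \<Rightarrow> (real \<Rightarrow> complex) \<Rightarrow> (real \<Rightarrow> complex) \<Rightarrow> complex"
  where "Lam A F a \<phi> f g = (\<Sum>k\<in>A. \<Sum>n\<in>F. a k * \<phi> n *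
    ((LINT x|lborel. g x * wave (of_int (k + n)) x) * (LINT u|lborel. f u * wave (- of_int (k + n)) u)))"

lemma Lam_commute: "Lam A F a \<phi> f g = Lam F A \<phi> a f g"
  unfolding Lam_def by (subst sum.swap) (simp add: mult_ac add_ac)

text \<open>For each fixed \<open>k\<close> the sum over \<open>n\<close> is a sum of products of
  Fourier coefficients of \<open>g\<close> and \<open>f\<close>, at most 1 by 2xy <= x^2 + y^2 and
  Bessel's inequality for both. The remaining sum over \<open>k\<close> only sees |a k|.\<close>

lemma Lam_bound_l1:
  assumes fin: "finite A" "finite F" and \<phi>: "\<And>n. n \<in> F \<Longrightarrow> norm (\<phi> n) \<le> 1"
    and f: "integrable lborel f" "integrable lborel (\<lambda>x. (norm (f x))\<^sup>2)" "(LINT x|lborel. (norm (f x))\<^sup>2) \<le> 1"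
    and g: "integrable lborel g" "integrable lborel (\<lambda>x. (norm (g x))\<^sup>2)" "(LINT x|lborel. (norm (g x))\<^sup>2) \<le> 1"
    and supp: "\<And>x. x \<notin> {s..s+1} \<Longrightarrow> f x = 0" "\<And>x. x \<notin> {s..s+1} \<Longrightarrow> g x = 0"
  shows "norm (Lam A F a \<phi> f g) \<le> (\<Sum>k\<in>A. norm (a k))"
proof -
  define G where "G m = (LINT x|lborel. g x * wave (of_int m) x)" for m :: int
  define H where "H m = (LINT x|lborel. f x * wave (- of_int m) x)" for m :: int
  have 1: "(\<Sum>n\<in>F. norm (G (k + n)) * norm (H (k + n))) \<le> 1" for k
  proof -
    have "(\<Sum>n\<in>F. (norm (H (k + n)))\<^sup>2) = (\<Sum>m\<in>(+) k ` F. (norm (H m))\<^sup>2)"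
      by (subst sum.reindex) auto
    also have "\<dots> \<le> 1" unfolding H_def
      using bessel[OF finite_imageI[OF fin(2)] f(1,2) supp(1)] f(3) by (rule order_trans)
    finally have H: "(\<Sum>n\<in>F. (norm (H (k + n)))\<^sup>2) \<le> 1" .
    \<comment> \<open>The coefficients of \<open>g\<close> carry the opposite sign in the exponent,
      so Bessel's inequality is applied on the reflected frequencies -(k + n).\<close>
    have "(\<Sum>n\<in>F. (norm (G (k + n)))\<^sup>2) = (\<Sum>m\<in>(\<lambda>n. - (k + n)) ` F. (norm (LINT x|lborel. g x * wave (- of_int m) x))\<^sup>2)"
      by (subst sum.reindex) (auto simp: inj_on_def G_def add.commute)
    also have "\<dots> \<le> 1"
      using bessel[OF finite_imageI[OF fin(2)] g(1,2) supp(2)] g(3) by (rule order_trans)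
    finally have G: "(\<Sum>n\<in>F. (norm (G (k + n)))\<^sup>2) \<le> 1" .
    have "(\<Sum>n\<in>F. 2 * (norm (G (k + n)) * norm (H (k + n)))) \<le> (\<Sum>n\<in>F. (norm (G (k + n)))\<^sup>2 + (norm (H (k + n)))\<^sup>2)"
      by (intro sum_mono) (metis mult.assoc sum_squares_bound)
    with G H show ?thesis by (simp add: sum.distrib flip: sum_distrib_left)
  qed
  have "norm (Lam A F a \<phi> f g) \<le> (\<Sum>k\<in>A. \<Sum>n\<in>F. norm (a k * \<phi> n * (G (k + n) * H (k + n))))"
    unfolding Lam_def G_def H_def by (rule order_trans[OF norm_sum] sum_mono norm_sum)+
  also have "\<dots> \<le> (\<Sum>k\<in>A. \<Sum>n\<in>F. norm (a k) * (norm (G (k + n)) * norm (H (k + n))))"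
  proof (intro sum_mono)
    fix k n assume "n \<in> F"
    then show "norm (a k * \<phi> n * (G (k + n) * H (k + n))) \<le> norm (a k) * (norm (G (k + n)) * norm (H (k + n)))"
      using mult_right_mono[OF \<phi>, of n "norm (a k) * (norm (G (k + n)) * norm (H (k + n)))"]
      by (simp add: norm_mult mult_ac)
  qed
  also have "\<dots> \<le> (\<Sum>k\<in>A. norm (a k) * 1)"
    unfolding sum_distrib_left[symmetric] by (intro sum_mono mult_left_mono 1) auto
  finally show ?thesis by simp
qed

text \<open>\<open>Lam\<close> is defined on the Fourier side, where Bessel's inequality and
  holomorphic dependence on the data are visible. This is its kernel form, pairing \<open>g\<close>
  with the convolution of \<open>f\<close> by the product of the two polynomials; size estimates are
  made there.\<close>

lemma Lam_eq_iterated_integral: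
  assumes fin: "finite A" "finite F" and f: "integrable lborel f" and g: "integrable lborel g"
  shows "Lam A F a \<phi> f g = (LINT x|lborel. LINT u|lborel. trig_poly A a (x - u) * trig_poly F \<phi> (x - u) * (f u * g x))"
    and "integrable lborel (\<lambda>u. trig_poly A a (x - u) * trig_poly F \<phi> (x - u) * (f u * g x))"
    and "integrable lborel (\<lambda>x. LINT u|lborel. trig_poly A a (x - u) * trig_poly F \<phi> (x - u) * (f u * g x))"
proof -
  let ?T = "\<lambda>k n x u. a k * \<phi> n * (g x * wave (of_int (k + n)) x) * (f u * wave (- of_int (k + n)) u)"
  have eq: "trig_poly A a (x - u) * trig_poly F \<phi> (x - u) * (f u * g x) = (\<Sum>k\<in>A. \<Sum>n\<in>F. ?T k n x u)" for x u
    unfolding trig_poly_def sum_mult_sum_mult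
    by (intro sum.cong refl) (simp add: wave_diff_right wave_add_left wave_diff_left mult_ac)
  have iu: "integrable lborel (\<lambda>u. ?T k n x u)" for k n x
    by (intro integrable_mult_right integrable_mult_wave f)
  then show "integrable lborel (\<lambda>u. trig_poly A a (x - u) * trig_poly F \<phi> (x - u) * (f u * g x))"
    unfolding eq by (intro Bochner_Integration.integrable_sum)
  have inner: "(LINT u|lborel. trig_poly A a (x - u) * trig_poly F \<phi> (x - u) * (f u * g x)) =
      (\<Sum>k\<in>A. \<Sum>n\<in>F. a k * \<phi> n * (LINT u|lborel. f u * wave (- of_int (k + n)) u) * (g x * wave (of_int (k + n)) x))" for x
  proof -
    have "(LINT u|lborel. trig_poly A a (x - u) * trig_poly F \<phi> (x - u) * (f u * g x)) = (\<Sum>k\<in>A. \<Sum>n\<in>F. LINT u|lborel. ?T k n x u)"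
      unfolding eq using iu by (simp add: Bochner_Integration.integral_sum del: integral_mult_right_zero of_int_add)
    then show ?thesis unfolding Bochner_Integration.integral_mult_right_zero by (simp only: mult_ac)
  qed
  have ix: "integrable lborel (\<lambda>x. c * (g x * wave (of_int (k + n)) x))" for k n c
    by (intro integrable_mult_right integrable_mult_wave g)
  then show "integrable lborel (\<lambda>x. LINT u|lborel. trig_poly A a (x - u) * trig_poly F \<phi> (x - u) * (f u * g x))"
    unfolding inner by (intro Bochner_Integration.integrable_sum)
  have "(LINT x|lborel. LINT u|lborel. trig_poly A a (x - u) * trig_poly F \<phi> (x - u) * (f u * g x)) =
     (\<Sum>k\<in>A. \<Sum>n\<in>F. LINT x|lborel. a k * \<phi> n * (LINT u|lborel. f u * wave (- of_int (k + n)) u) * (g x * wave (of_int (k + n)) x))"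
    unfolding inner using ix by (simp add: Bochner_Integration.integral_sum del: integral_mult_right_zero of_int_add)
  also have "\<dots> = Lam A F a \<phi> f g"
    unfolding Lam_def Bochner_Integration.integral_mult_right_zero by (intro sum.cong refl) (simp only: mult_ac)
  finally show "Lam A F a \<phi> f g = (LINT x|lborel. LINT u|lborel. trig_poly A a (x - u) * trig_poly F \<phi> (x - u) * (f u * g x))" ..
qed

text \<open>A Schur type test: the kernel cut down to one period has integral at most 1 in either
  variable, by Parseval for both polynomials. The majorants \<open>U\<close> and \<open>V\<close>
  are left abstract so that Young's inequality with weight \<open>\<rho>\<close> and the endpoint
  with \<open>V\<close> equal to 0 are both instances.\<close>

lemma Lam_bound_l2:
  fixes f g :: "real \<Rightarrow> complex" and U V :: "real \<Rightarrow> real"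
  assumes fin: "finite A" "finite F"
    and a: "(\<Sum>k\<in>A. (norm (a k))\<^sup>2) \<le> 1" and \<phi>: "(\<Sum>n\<in>F. (norm (\<phi> n))\<^sup>2) \<le> 1"
    and f: "integrable lborel f" and g: "integrable lborel g"
    and U: "integrable lborel U" "\<And>x. 0 \<le> U x" "(LINT x|lborel. U x) \<le> 1"
    and V: "integrable lborel V" "\<And>x. 0 \<le> V x" "(LINT x|lborel. V x) \<le> 1"
    and \<rho>: "0 \<le> \<rho>" "\<rho> \<le> 1"
    and le: "\<And>u x. norm (f u) * norm (g x) \<le> \<rho> * U u + (1 - \<rho>) * V x"
    and supp: "\<And>u x. f u \<noteq> 0 \<Longrightarrow> g x \<noteq> 0 \<Longrightarrow> x - u \<in> {0..1}"
  shows "norm (Lam A F a \<phi> f g) \<le> 1"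
proof -
  \<comment> \<open>Cutting to \<open>{0..1}\<close> loses nothing, since \<open>supp\<close>
    confines x - u to that interval wherever the integrand is nonzero, and it turns a periodic
    kernel into an integrable one.\<close>
  define M where "M y = indicator {0..1::real} y * norm (trig_poly A a y * trig_poly F \<phi> y)" for y
  have M0: "0 \<le> M y" for y by (simp add: M_def)
  have Mm [measurable]: "M \<in> borel_measurable borel" unfolding M_def by measurable
  have [measurable]: "U \<in> borel_measurable borel" "V \<in> borel_measurable borel"
    "f \<in> borel_measurable borel" "g \<in> borel_measurable borel"
    using U(1) V(1) f g by (auto dest: borel_measurable_integrable)
  have iA: "integrable lborel (\<lambda>x. indicator {0..1::real} x * (norm (trig_poly B b x))\<^sup>2)" for B b
    by (rule borel_integrable_compact[of "{0..1}" "\<lambda>x. (norm (trig_poly B b x))\<^sup>2", simplified])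
      (auto intro!: continuous_intros)
  have iM: "integrable lborel M" unfolding M_def
    by (rule borel_integrable_compact[of "{0..1}" "\<lambda>x. norm (trig_poly A a x * trig_poly F \<phi> x)", simplified])
      (auto intro!: continuous_intros)
  have "(LINT y|lborel. 2 * M y) \<le> (LINT y|lborel. indicator {0..1} y * (norm (trig_poly A a y))\<^sup>2 + indicator {0..1} y * (norm (trig_poly F \<phi> y))\<^sup>2)"
  proof (rule integral_mono)
    fix y
    show "2 * M y \<le> indicator {0..1} y * (norm (trig_poly A a y))\<^sup>2 + indicator {0..1} y * (norm (trig_poly F \<phi> y))\<^sup>2"
      using sum_squares_bound[of "norm (trig_poly A a y)" "norm (trig_poly F \<phi> y)"]
      by (simp add: M_def indicator_def norm_mult mult.assoc)
  qed (intro integrable_mult_right iM Bochner_Integration.integrable_add iA)+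
  also have "\<dots> \<le> 2" using iA a \<phi> parseval_trig_poly[OF fin(1), of 0 a] parseval_trig_poly[OF fin(2), of 0 \<phi>] by simp
  finally have "(LINT y|lborel. M y) \<le> 1" by simp
  then have nM: "(\<integral>\<^sup>+y. ennreal (M y) \<partial>lborel) \<le> 1"
    using iM M0 by (simp add: nn_integral_eq_integral)
  have nMx: "(\<integral>\<^sup>+u. ennreal (M (x - u)) \<partial>lborel) \<le> 1" for x
    using nM nn_integral_real_affine[of "\<lambda>y. ennreal (M y)" "-1" x] by simp
  have nMu: "(\<integral>\<^sup>+x. ennreal (M (x - u)) \<partial>lborel) \<le> 1" for u
    using nM nn_integral_real_affine[of "\<lambda>y. ennreal (M y)" 1 "-u"] by (simp add: add.commute)
  have nU: "(\<integral>\<^sup>+u. ennreal (U u) \<partial>lborel) \<le> 1" and nV: "(\<integral>\<^sup>+u. ennreal (V u) \<partial>lborel) \<le> 1"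
    using U V by (simp_all add: nn_integral_eq_integral)
  have pw: "norm (trig_poly A a (x - u) * trig_poly F \<phi> (x - u) * (f u * g x)) \<le> \<rho> * (U u * M (x - u)) + (1 - \<rho>) * (V x * M (x - u))" for x u
  proof (cases "f u = 0 \<or> g x = 0")
    case True
    then show ?thesis using \<rho> U(2)[of u] V(2)[of x] M0[of "x - u"] by auto
  next
    case False
    then have "x - u \<in> {0..1}" using supp by auto
    then have "norm (trig_poly A a (x - u) * trig_poly F \<phi> (x - u) * (f u * g x)) = M (x - u) * (norm (f u) * norm (g x))"
      by (simp add: M_def norm_mult)
    also have "\<dots> \<le> M (x - u) * (\<rho> * U u + (1 - \<rho>) * V x)"
      by (intro mult_left_mono le M0)
    finally show ?thesis by (simp add: algebra_simps)
  qed
  have "ennreal (norm (Lam A F a \<phi> f g)) \<le> (\<integral>\<^sup>+x. norm (LINT u|lborel. trig_poly A a (x - u) * trig_poly F \<phi> (x - u) * (f u * g x)) \<partial>lborel)"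
    unfolding Lam_eq_iterated_integral(1)[OF fin f g]
    by (rule integral_norm_bound_ennreal[OF Lam_eq_iterated_integral(3)[OF fin f g]])
  also have "\<dots> \<le> (\<integral>\<^sup>+x. (\<integral>\<^sup>+u. norm (trig_poly A a (x - u) * trig_poly F \<phi> (x - u) * (f u * g x)) \<partial>lborel) \<partial>lborel)"
    by (intro nn_integral_mono integral_norm_bound_ennreal Lam_eq_iterated_integral(2)[OF fin f g])
  also have "\<dots> \<le> (\<integral>\<^sup>+x. (\<integral>\<^sup>+u. ennreal \<rho> * (ennreal (U u) * ennreal (M (x - u))) + ennreal (1 - \<rho>) * (ennreal (V x) * ennreal (M (x - u))) \<partial>lborel) \<partial>lborel)"
    using U(2) V(2) M0 \<rho> pw
    by (intro nn_integral_mono) (simp add: ennreal_mult[symmetric] ennreal_plus[symmetric] del: ennreal_plus)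
  also have "\<dots> = ennreal \<rho> * (\<integral>\<^sup>+x. (\<integral>\<^sup>+u. ennreal (U u) * ennreal (M (x - u)) \<partial>lborel) \<partial>lborel)
      + ennreal (1 - \<rho>) * (\<integral>\<^sup>+x. ennreal (V x) * (\<integral>\<^sup>+u. ennreal (M (x - u)) \<partial>lborel) \<partial>lborel)"
    by (simp add: nn_integral_add nn_integral_cmult)
  also have "(\<integral>\<^sup>+x. (\<integral>\<^sup>+u. ennreal (U u) * ennreal (M (x - u)) \<partial>lborel) \<partial>lborel) =
      (\<integral>\<^sup>+u. (\<integral>\<^sup>+x. ennreal (U u) * ennreal (M (x - u)) \<partial>lborel) \<partial>lborel)"
    by (rule lborel_pair.Fubini') measurable
  also have "\<dots> = (\<integral>\<^sup>+u. ennreal (U u) * (\<integral>\<^sup>+x. ennreal (M (x - u)) \<partial>lborel) \<partial>lborel)"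
    by (simp add: nn_integral_cmult)
  also have "\<dots> \<le> (\<integral>\<^sup>+u. ennreal (U u) * 1 \<partial>lborel)"
    by (intro nn_integral_mono mult_left_mono nMu) auto
  also have "\<dots> \<le> 1" using nU by simp
  also have "(\<integral>\<^sup>+x. ennreal (V x) * (\<integral>\<^sup>+u. ennreal (M (x - u)) \<partial>lborel) \<partial>lborel) \<le> (\<integral>\<^sup>+x. ennreal (V x) * 1 \<partial>lborel)"
    by (intro nn_integral_mono mult_left_mono nMx) auto
  also have "\<dots> \<le> 1" using nV by simp
  also have "ennreal \<rho> * 1 + ennreal (1 - \<rho>) * 1 = 1"
    using \<rho> by (simp add: ennreal_plus[symmetric] del: ennreal_plus)
  finally show ?thesis
    by (simp add: mult_left_mono add_mono)
qed

subsection \<open>Interpolation\<close>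

lemma integrable_bounded_support:
  fixes h :: "real \<Rightarrow> 'b :: {banach, second_countable_topology}"
  assumes "h \<in> borel_measurable borel" "\<And>x. norm (h x) \<le> B" "\<And>x. x \<notin> {a..b} \<Longrightarrow> h x = 0"
  shows "integrable lborel h"
proof (rule Bochner_Integration.integrable_bound[where f="\<lambda>x. B * indicator {a..b} x"])
  have "0 \<le> B" using order_trans[OF norm_ge_zero assms(2)] by simp
  then show "AE x in lborel. norm (h x) \<le> norm (B * indicator {a..b} x)"
    using assms(2,3) by (auto simp: indicator_def)
qed (use assms(1) in \<open>auto intro!: integrable_mult_right integrable_real_indicator simp: emeasure_lborel_Icc_eq\<close>)

text \<open>The analytic family |v|^(c + d z) sgn v of complex interpolation. Its modulus depends on
  Re z only, and it returns \<open>v\<close> at a real point where the exponent is 1.\<close>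

definition cpow :: "real \<Rightarrow> real \<Rightarrow> complex \<Rightarrow> complex \<Rightarrow> complex" where
  "cpow c d v z = (if v = 0 then 0 else sgn v * exp ((of_real c + of_real d * z) * of_real (ln (norm v))))"

lemma norm_cpow: "norm (cpow c d v z) = norm v powr (c + d * Re z)"
  by (simp add: cpow_def norm_mult norm_sgn norm_exp_eq_Re powr_def mult.commute)

lemma cpow_0 [simp]: "cpow c d 0 z = 0"
  by (simp add: cpow_def)

lemma cpow_of_real:
  assumes "c + d * t = 1"
  shows "cpow c d v (of_real t) = v"
proof -
  have "complex_of_real c + of_real d * of_real t = 1"
    using assms by (metis of_real_1 of_real_add of_real_mult)
  then show ?thesis
    by (simp add: cpow_def sgn_eq exp_of_real)
qed

text \<open>Holomorphy together with some bound on the strip is what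
  \<open>strip_maximum_modulus\<close> asks for. The pair is stable under sums and products, so it
  passes through the whole form; the size of the bound is irrelevant.\<close>

definition strip_bounded :: "(complex \<Rightarrow> complex) \<Rightarrow> bool" where
  "strip_bounded h \<longleftrightarrow> h holomorphic_on UNIV \<and> (\<exists>B. \<forall>z. 0 \<le> Re z \<longrightarrow> Re z \<le> 1 \<longrightarrow> norm (h z) \<le> B)"

lemma strip_bounded_const: "strip_bounded (\<lambda>z. c)"
  by (auto simp: strip_bounded_def)

lemma strip_bounded_mult:
  assumes "strip_bounded f" "strip_bounded g"
  shows "strip_bounded (\<lambda>z. f z * g z)"
proof -
  obtain B C where B: "\<And>z. 0 \<le> Re z \<Longrightarrow> Re z \<le> 1 \<Longrightarrow> norm (f z) \<le> B"
    and C: "\<And>z. 0 \<le> Re z \<Longrightarrow> Re z \<le> 1 \<Longrightarrow> norm (g z) \<le> C"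
    using assms by (auto simp: strip_bounded_def)
  have "0 \<le> B" using order_trans[OF norm_ge_zero B[of 0]] by simp
  then have "norm (f z * g z) \<le> B * C" if "0 \<le> Re z" "Re z \<le> 1" for z
    using B[OF that] C[OF that] by (simp add: norm_mult mult_mono)
  moreover have "(\<lambda>z. f z * g z) holomorphic_on UNIV"
    using assms by (intro holomorphic_on_mult) (auto simp: strip_bounded_def)
  ultimately show ?thesis unfolding strip_bounded_def by blast
qed

lemma strip_bounded_sum:
  assumes "\<And>i. i \<in> A \<Longrightarrow> strip_bounded (f i)"
  shows "strip_bounded (\<lambda>z. \<Sum>i\<in>A. f i z)"
proof -
  obtain B where B: "\<And>i z. i \<in> A \<Longrightarrow> 0 \<le> Re z \<Longrightarrow> Re z \<le> 1 \<Longrightarrow> norm (f i z) \<le> B i"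
    using assms unfolding strip_bounded_def by metis
  have "norm (\<Sum>i\<in>A. f i z) \<le> (\<Sum>i\<in>A. B i)" if "0 \<le> Re z" "Re z \<le> 1" for z
    by (rule order_trans[OF norm_sum sum_mono]) (use B that in auto)
  moreover have "(\<lambda>z. \<Sum>i\<in>A. f i z) holomorphic_on UNIV"
    using assms by (intro holomorphic_on_sum) (auto simp: strip_bounded_def)
  ultimately show ?thesis unfolding strip_bounded_def by blast
qed

lemma strip_bounded_cpow: "strip_bounded (cpow c d v)"
proof (cases "v = 0")
  case True
  then show ?thesis by (simp add: strip_bounded_const cpow_def[abs_def])
next
  case False
  have "norm (cpow c d v z) \<le> exp ((\<bar>c\<bar> + \<bar>d\<bar>) * \<bar>ln (norm v)\<bar>)" if z: "0 \<le> Re z" "Re z \<le> 1" for z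
  proof -
    have "\<bar>c + d * Re z\<bar> \<le> \<bar>c\<bar> + \<bar>d\<bar> * 1"
      using z by (intro order_trans[OF abs_triangle_ineq] add_mono) (auto simp: abs_mult intro!: mult_left_le)
    then have "\<bar>(c + d * Re z) * ln (norm v)\<bar> \<le> (\<bar>c\<bar> + \<bar>d\<bar>) * \<bar>ln (norm v)\<bar>"
      by (simp add: abs_mult mult_right_mono)
    then show ?thesis using False by (auto simp: norm_cpow powr_def intro: order_trans[OF abs_ge_self])
  qed
  moreover have "cpow c d v holomorphic_on UNIV"
    using False by (auto simp: cpow_def[abs_def] intro!: holomorphic_intros)
  ultimately show ?thesis by (auto simp: strip_bounded_def)
qed

lemma borel_measurable_finite_range:
  fixes f :: "real \<Rightarrow> complex"
  assumes [measurable]: "f \<in> borel_measurable borel" and fin: "finite (range f)"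
  shows "(\<lambda>x. h (f x)) \<in> borel_measurable borel"
proof -
  have "f -` {y} \<in> sets borel" for y
    using measurable_sets_borel[OF assms(1), of "{y}"] by simp
  then have "simple_function borel f"
    using fin by (auto simp: simple_function_def)
  then have "simple_function borel (h \<circ> f)" by (rule simple_function_compose)
  then show ?thesis by (auto simp: comp_def dest: borel_measurable_simple_function)
qed

lemma integrable_finite_range:
  fixes f :: "real \<Rightarrow> complex" and h :: "complex \<Rightarrow> 'b :: {banach, second_countable_topology}"
  assumes "(\<lambda>x. h (f x)) \<in> borel_measurable borel" and fin: "finite (range f)"
    and supp: "\<And>x. x \<notin> {s..t} \<Longrightarrow> f x = 0" and h: "h 0 = 0"
  shows "integrable lborel (\<lambda>x. h (f x))"
proof (rule integrable_bounded_support[where a=s and b=t])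
  show "norm (h (f x)) \<le> (\<Sum>v\<in>range f. norm (h v))" for x
    by (rule member_le_sum[of "f x" "range f" "\<lambda>v. norm (h v)"]) (use fin in simp_all)
qed (use assms in auto)

text \<open>With finitely many values the integral is a finite combination of functions
  \<open>cpow c d v\<close> whose coefficients are integrals over level sets. Holomorphy thus comes
  without differentiation under the integral sign; this is why interpolation starts from simple
  functions.\<close>

lemma strip_bounded_integral:
  fixes f w :: "real \<Rightarrow> complex"
  assumes f [measurable]: "f \<in> borel_measurable borel" and fin: "finite (range f)"
    and supp: "\<And>x. x \<notin> {s..t} \<Longrightarrow> f x = 0"
  shows "strip_bounded (\<lambda>z. LINT x|lborel. cpow c d (f x) z * wave r x)"
proof -
  have eq: "cpow c d (f x) z * wave r x = (\<Sum>v\<in>range f. cpow c d v z * ((if f x = v \<and> v \<noteq> 0 then 1 else 0) * wave r x))" for x z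
  proof -
    have "(\<Sum>v\<in>range f. cpow c d v z * ((if f x = v \<and> v \<noteq> 0 then 1 else 0) * wave r x)) = (\<Sum>v\<in>range f. if f x = v then cpow c d v z * wave r x else 0)"
      by (intro sum.cong) auto
    then show ?thesis using fin by simp
  qed
  have i: "integrable lborel (\<lambda>x. (if f x = v \<and> v \<noteq> 0 then 1 else 0 :: complex) * wave r x)" for v
    using integrable_finite_range[where f=f and h="\<lambda>u. if u = v \<and> v \<noteq> 0 then 1 else 0 :: complex" and s=s and t=t, OF borel_measurable_finite_range[OF f fin] fin supp]
    by (intro integrable_mult_wave) auto
  have "(LINT x|lborel. cpow c d (f x) z * wave r x) = (\<Sum>v\<in>range f. cpow c d v z * (LINT x|lborel. (if f x = v \<and> v \<noteq> 0 then 1 else 0) * wave r x))" for z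
    unfolding eq using i by (simp add: Bochner_Integration.integral_sum integrable_mult_right)
  moreover have "strip_bounded (\<lambda>z. \<Sum>v\<in>range f. cpow c d v z * (LINT x|lborel. (if f x = v \<and> v \<noteq> 0 then 1 else 0) * wave r x))"
    by (rule strip_bounded_sum, rule strip_bounded_mult, rule strip_bounded_cpow, rule strip_bounded_const)
  ultimately show ?thesis by (simp only:)
qed

text \<open>With \<open>a\<^sub>z = |a|\<^bsup>p(1-z/2)\<^esup> sgn a\<close> and so on, the endpoints \<open>Re z = 0\<close> and \<open>Re z = 1\<close> are
  \<open>Lam_bound_l1\<close> and \<open>Lam_bound_l2\<close>, and \<open>z = \<theta>\<close> gives back the original data.\<close>

lemma Lam_bound_simple_normalized:
  fixes p p' q q' \<theta> \<rho> :: real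
  assumes \<theta>: "0 < \<theta>" "\<theta> \<le> 1" and \<rho>: "0 \<le> \<rho>" "\<rho> \<le> 1"
    and pq: "0 < p" "0 < p'" "0 < q" "0 < q'"
    and p: "p * (1 - \<theta> / 2) = 1" and p': "p' * (\<theta> / 2) = 1"
    and q: "q * ((1 - \<theta>) / 2 + \<theta> * \<rho>) = 1" and q': "q' * ((1 - \<theta>) / 2 + \<theta> * (1 - \<rho>)) = 1"
    and fin: "finite A" "finite F"
    and f: "f \<in> borel_measurable borel" "finite (range f)" "\<And>x. x \<notin> {s..s+1} \<Longrightarrow> f x = 0"
    and g: "g \<in> borel_measurable borel" "finite (range g)" "\<And>x. x \<notin> {s..s+1} \<Longrightarrow> g x = 0"
    and supp: "\<And>u x. f u \<noteq> 0 \<Longrightarrow> g x \<noteq> 0 \<Longrightarrow> x - u \<in> {0..1}"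
    and a: "(\<Sum>k\<in>A. norm (a k) powr p) \<le> 1" and \<phi>: "(\<Sum>n\<in>F. norm (\<phi> n) powr p') \<le> 1"
    and nf: "(LINT x|lborel. norm (f x) powr q) \<le> 1" and ng: "(LINT x|lborel. norm (g x) powr q') \<le> 1"
  shows "norm (Lam A F a \<phi> f g) \<le> 1"
proof -
  let ?a = "\<lambda>z k. cpow p (- p / 2) (a k) z" and ?\<phi> = "\<lambda>z n. cpow 0 (p' / 2) (\<phi> n) z"
    and ?f = "\<lambda>z u. cpow (q / 2) (q * (\<rho> - 1/2)) (f u) z" and ?g = "\<lambda>z x. cpow (q' / 2) (q' * (1/2 - \<rho>)) (g x) z"
  define G where "G z = Lam A F (?a z) (?\<phi> z) (?f z) (?g z)" for z
  have G\<theta>: "G (of_real \<theta>) = Lam A F a \<phi> f g"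
  proof -
    have "p + - p / 2 * \<theta> = p * (1 - \<theta> / 2)" "0 + p' / 2 * \<theta> = p' * (\<theta> / 2)"
      "q / 2 + q * (\<rho> - 1/2) * \<theta> = q * ((1 - \<theta>) / 2 + \<theta> * \<rho>)"
      "q' / 2 + q' * (1/2 - \<rho>) * \<theta> = q' * ((1 - \<theta>) / 2 + \<theta> * (1 - \<rho>))"
      by (simp_all add: algebra_simps add_divide_distrib diff_divide_distrib)
    then have "p + - p / 2 * \<theta> = 1" "0 + p' / 2 * \<theta> = 1" "q / 2 + q * (\<rho> - 1/2) * \<theta> = 1" "q' / 2 + q' * (1/2 - \<rho>) * \<theta> = 1"
      using p p' q q' by (simp_all only:)
    then show ?thesis by (simp add: G_def cpow_of_real)
  qed
  have "strip_bounded G"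
    unfolding G_def Lam_def
  proof (intro strip_bounded_sum)
    fix k n
    have 1: "strip_bounded (\<lambda>z. LINT x|lborel. cpow (q' / 2) (q' * (1/2 - \<rho>)) (g x) z * wave (of_int (k + n)) x)"
      by (rule strip_bounded_integral[where s=s and t="s+1"]) (rule g, rule g, rule g, assumption)
    have 2: "strip_bounded (\<lambda>z. LINT x|lborel. cpow (q / 2) (q * (\<rho> - 1/2)) (f x) z * wave (- of_int (k + n)) x)"
      by (rule strip_bounded_integral[where s=s and t="s+1"]) (rule f, rule f, rule f, assumption)
    have 3: "strip_bounded (\<lambda>z. ?a z k * ?\<phi> z n)"
      by (rule strip_bounded_mult) (rule strip_bounded_cpow)+
    show "strip_bounded (\<lambda>z. ?a z k * ?\<phi> z n * ((LINT x|lborel. ?g z x * wave (of_int (k + n)) x) * (LINT u|lborel. ?f z u * wave (- of_int (k + n)) u)))"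
      by (rule strip_bounded_mult[OF 3 strip_bounded_mult[OF 1 2]])
  qed
  then obtain B where hol: "G holomorphic_on UNIV" and B: "\<And>z. 0 \<le> Re z \<Longrightarrow> Re z \<le> 1 \<Longrightarrow> norm (G z) \<le> B"
    unfolding strip_bounded_def by blast
  have mf: "(\<lambda>u. ?f z u) \<in> borel_measurable borel" "(\<lambda>u. ?g z u) \<in> borel_measurable borel" for z
    by (rule borel_measurable_finite_range[OF f(1,2)], rule borel_measurable_finite_range[OF g(1,2)])
  have if': "integrable lborel (?f z)" "integrable lborel (?g z)" for z
    by (rule integrable_finite_range[where f=f and h="\<lambda>v. cpow (q / 2) (q * (\<rho> - 1/2)) v z", OF mf(1) f(2,3) cpow_0], assumption,
        rule integrable_finite_range[where f=g and h="\<lambda>v. cpow (q' / 2) (q' * (1/2 - \<rho>)) v z", OF mf(2) g(2,3) cpow_0], assumption)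
  have mq: "(\<lambda>x. norm (f x) powr q) \<in> borel_measurable borel" "(\<lambda>x. norm (g x) powr q') \<in> borel_measurable borel"
    using f(1) g(1) by auto
  have iq: "integrable lborel (\<lambda>x. norm (f x) powr q)" "integrable lborel (\<lambda>x. norm (g x) powr q')"
    by (rule integrable_finite_range[where f=f and h="\<lambda>v. norm v powr q", OF mq(1) f(2,3)], simp, simp,
        rule integrable_finite_range[where f=g and h="\<lambda>v. norm v powr q'", OF mq(2) g(2,3)], simp, simp)
  have sq: "(x powr (e / 2))\<^sup>2 = x powr e" if "0 \<le> x" for x e :: real
    by (simp add: power2_eq_square flip: powr_add)
  have "norm (G (of_real \<theta>)) \<le> 1"
  proof (rule strip_maximum_modulus[OF hol B])
    \<comment> \<open>On this line the exponents are p for \<open>a\<close>, 0 for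
      \<open>\<phi>\<close>, q/2 for \<open>f\<close> and q'/2 for \<open>g\<close>: the sequence
      from \<open>\<phi>\<close> is bounded by 1 and the squares of the two functions are the given
      integrands.\<close>
    fix z assume z: "Re z = 0"
    have "norm (G z) \<le> (\<Sum>k\<in>A. norm (?a z k))"
      unfolding G_def
      by (rule Lam_bound_l1[where s=s]) (use fin if' iq assms(23-) z in \<open>simp_all add: sq norm_cpow f g\<close>)
    also have "\<dots> \<le> 1" using a z by (simp add: norm_cpow)
    finally show "norm (G z) \<le> 1" .
  next
    fix z assume z: "Re z = 1"
    have "p + - p / 2 = p / 2" "q / 2 + q * (\<rho> - 1/2) = q * \<rho>" "q' / 2 + q' * (1/2 - \<rho>) = q' * (1 - \<rho>)"
      by (simp_all add: field_simps)
    note ex = this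
    show "norm (G z) \<le> 1" unfolding G_def
    proof (rule Lam_bound_l2[where \<rho>=\<rho> and U="\<lambda>x. norm (f x) powr q" and V="\<lambda>x. norm (g x) powr q'"])
      show "(\<Sum>k\<in>A. (norm (?a z k))\<^sup>2) \<le> 1" "(\<Sum>n\<in>F. (norm (?\<phi> z n))\<^sup>2) \<le> 1"
        using a \<phi> z ex by (simp_all add: norm_cpow sq)
      fix u x
      \<comment> \<open>Here the moduli are |f|^(q \<rho>) and |g|^(q' (1 - \<rho>)), so the bound
        is the weighted inequality of arithmetic and geometric means for |f|^q and |g|^q'.\<close>
      show "norm (?f z u) * norm (?g z x) \<le> \<rho> * norm (f u) powr q + (1 - \<rho>) * norm (g x) powr q'"
      proof (cases "f u = 0 \<or> g x = 0")
        case True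
        then show ?thesis using \<rho> by auto
      next
        case False
        have "norm (?f z u) * norm (?g z x) = (norm (f u) powr q) powr \<rho> * (norm (g x) powr q') powr (1 - \<rho>)"
          using z ex by (simp add: norm_cpow powr_powr)
        then show ?thesis using Youngs_inequality_0[of \<rho> "1 - \<rho>" "norm (f u) powr q" "norm (g x) powr q'"] \<rho> False by simp
      qed
      show "?f z u \<noteq> 0 \<Longrightarrow> ?g z x \<noteq> 0 \<Longrightarrow> x - u \<in> {0..1}"
        using supp[of u x] by (auto simp: cpow_def split: if_splits)
    qed (use fin if' iq nf ng \<rho> in auto)
  qed (use \<theta> in auto)
  then show ?thesis by (simp add: G\<theta>)
qed

lemma Lam_scale:
  "Lam A F (\<lambda>k. c1 * a k) (\<lambda>n. c2 * \<phi> n) (\<lambda>u. c3 * f u) (\<lambda>x. c4 * g x) = c1 * c2 * c3 * c4 * Lam A F a \<phi> f g"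
  unfolding Lam_def by (simp add: mult.assoc sum_distrib_left) (simp add: mult_ac)

lemma powr_norm_divide:
  assumes "c > 0"
  shows "norm (of_real (1 / c) * z) powr e = norm (z :: complex) powr e / c powr e"
  using assms by (simp add: norm_mult norm_divide powr_divide)

text \<open>Homogeneity: divide each of the four arguments by its bound. Taking the bounds strictly
  positive, and not equal to the norms, makes the division legitimate even for zero data.\<close>

lemma Lam_bound_simple:
  fixes p p' q q' \<theta> \<rho> :: real
  assumes \<theta>: "0 < \<theta>" "\<theta> \<le> 1" and \<rho>: "0 \<le> \<rho>" "\<rho> \<le> 1"
    and pq: "0 < p" "0 < p'" "0 < q" "0 < q'"
    and p: "p * (1 - \<theta> / 2) = 1" and p': "p' * (\<theta> / 2) = 1"
    and q: "q * ((1 - \<theta>) / 2 + \<theta> * \<rho>) = 1" and q': "q' * ((1 - \<theta>) / 2 + \<theta> * (1 - \<rho>)) = 1"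
    and fin: "finite A" "finite F"
    and f: "f \<in> borel_measurable borel" "finite (range f)" "\<And>x. x \<notin> {s..s+1} \<Longrightarrow> f x = 0"
    and g: "g \<in> borel_measurable borel" "finite (range g)" "\<And>x. x \<notin> {s..s+1} \<Longrightarrow> g x = 0"
    and supp: "\<And>u x. f u \<noteq> 0 \<Longrightarrow> g x \<noteq> 0 \<Longrightarrow> x - u \<in> {0..1}"
    and pos: "0 < \<alpha>" "0 < \<beta>" "0 < \<gamma>" "0 < \<delta>"
    and a: "(\<Sum>k\<in>A. norm (a k) powr p) \<le> \<alpha> powr p" and \<phi>: "(\<Sum>n\<in>F. norm (\<phi> n) powr p') \<le> \<beta> powr p'"
    and nf: "(LINT x|lborel. norm (f x) powr q) \<le> \<gamma> powr q" and ng: "(LINT x|lborel. norm (g x) powr q') \<le> \<delta> powr q'"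
  shows "norm (Lam A F a \<phi> f g) \<le> \<alpha> * \<beta> * \<gamma> * \<delta>"
proof -
  have "norm (Lam A F (\<lambda>k. of_real (1 / \<alpha>) * a k) (\<lambda>n. of_real (1 / \<beta>) * \<phi> n) (\<lambda>u. of_real (1 / \<gamma>) * f u) (\<lambda>x. of_real (1 / \<delta>) * g x)) \<le> 1"
  proof (rule Lam_bound_simple_normalized[OF \<theta> \<rho> pq p p' q q' fin, where s=s])
    show "finite (range (\<lambda>u. of_real (1 / \<gamma>) * f u))" "finite (range (\<lambda>u. of_real (1 / \<delta>) * g u))"
      using finite_imageI[OF f(2), of "\<lambda>v. of_real (1 / \<gamma>) * v"] finite_imageI[OF g(2), of "\<lambda>v. of_real (1 / \<delta>) * v"]
      by (simp_all add: image_image)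
    show "(\<Sum>k\<in>A. norm (of_real (1 / \<alpha>) * a k) powr p) \<le> 1" "(\<Sum>n\<in>F. norm (of_real (1 / \<beta>) * \<phi> n) powr p') \<le> 1"
      using a \<phi> pos by (simp_all add: powr_norm_divide flip: sum_divide_distrib del: of_real_divide)
    show "(LINT x|lborel. norm (of_real (1 / \<gamma>) * f x) powr q) \<le> 1" "(LINT x|lborel. norm (of_real (1 / \<delta>) * g x) powr q') \<le> 1"
      using nf ng pos by (simp_all add: powr_norm_divide del: of_real_divide)
    show "\<And>u x. of_real (1 / \<gamma>) * f u \<noteq> 0 \<Longrightarrow> of_real (1 / \<delta>) * g x \<noteq> 0 \<Longrightarrow> x - u \<in> {0..1}"
      using supp by auto
  qed (use f g in \<open>auto intro!: borel_measurable_times\<close>)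
  then show ?thesis unfolding Lam_scale using pos by (simp add: norm_mult norm_divide field_simps)
qed

text \<open>Simple approximants with |fs| <= 2|f| vanish where \<open>f\<close> vanishes, so all
  support conditions survive, and bounded supports give dominated convergence of the form and of the
  integrals. The approximants meet the norm bounds only eventually and up to \<epsilon>, hence the
  detour through \<gamma> + \<epsilon> and \<delta> + \<epsilon>.\<close>

lemma Lam_bound_theta:
  fixes p p' q q' \<theta> \<rho> :: real
  assumes \<theta>: "0 < \<theta>" "\<theta> \<le> 1" and \<rho>: "0 \<le> \<rho>" "\<rho> \<le> 1"
    and pq: "0 < p" "0 < p'" "0 < q" "0 < q'"
    and p: "p * (1 - \<theta> / 2) = 1" and p': "p' * (\<theta> / 2) = 1"
    and q: "q * ((1 - \<theta>) / 2 + \<theta> * \<rho>) = 1" and q': "q' * ((1 - \<theta>) / 2 + \<theta> * (1 - \<rho>)) = 1"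
    and fin: "finite A" "finite F"
    and f: "f \<in> borel_measurable borel" "\<And>x. norm (f x) \<le> B" "\<And>x. x \<notin> {s..s+1} \<Longrightarrow> f x = 0"
    and g: "g \<in> borel_measurable borel" "\<And>x. norm (g x) \<le> B" "\<And>x. x \<notin> {s..s+1} \<Longrightarrow> g x = 0"
    and supp: "\<And>u x. f u \<noteq> 0 \<Longrightarrow> g x \<noteq> 0 \<Longrightarrow> x - u \<in> {0..1}"
    and pos: "0 < \<alpha>" "0 < \<beta>" "0 < \<gamma>" "0 < \<delta>"
    and a: "(\<Sum>k\<in>A. norm (a k) powr p) \<le> \<alpha> powr p" and \<phi>: "(\<Sum>n\<in>F. norm (\<phi> n) powr p') \<le> \<beta> powr p'"
    and nf: "(LINT x|lborel. norm (f x) powr q) \<le> \<gamma> powr q" and ng: "(LINT x|lborel. norm (g x) powr q') \<le> \<delta> powr q'"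
  shows "norm (Lam A F a \<phi> f g) \<le> \<alpha> * \<beta> * \<gamma> * \<delta>"
proof -
  obtain fs where fs: "\<And>i. simple_function borel (fs i)" "\<And>x. (\<lambda>i. fs i x) \<longlonglongrightarrow> f x" "\<And>i x. norm (fs i x) \<le> 2 * norm (f x)"
    using borel_measurable_implies_sequence_metric[OF f(1), of 0] by auto
  obtain gs where gs: "\<And>i. simple_function borel (gs i)" "\<And>x. (\<lambda>i. gs i x) \<longlonglongrightarrow> g x" "\<And>i x. norm (gs i x) \<le> 2 * norm (g x)"
    using borel_measurable_implies_sequence_metric[OF g(1), of 0] by auto
  have m [measurable]: "fs i \<in> borel_measurable borel" "gs i \<in> borel_measurable borel" for i
    using fs(1) gs(1) by (auto dest: borel_measurable_simple_function)
  have fz: "fs i x = 0" if "f x = 0" for i x using fs(3)[of i x] that by simp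
  have gz: "gs i x = 0" if "g x = 0" for i x using gs(3)[of i x] that by simp
  have B0: "0 \<le> B" using order_trans[OF norm_ge_zero f(2)] .
  have bnd: "norm (fs i x) \<le> 2 * B" "norm (gs i x) \<le> 2 * B" for i x
    using fs(3)[of i x] f(2)[of x] gs(3)[of i x] g(2)[of x] by linarith+
  have conv: "(\<lambda>i. LINT x|lborel. hs i x * wave r x) \<longlonglongrightarrow> (LINT x|lborel. k x * wave r x)"
    if hs: "\<And>i. hs i \<in> borel_measurable borel" "k \<in> borel_measurable borel"
      "\<And>x. (\<lambda>i. hs i x) \<longlonglongrightarrow> k x" "\<And>i x. norm (hs i x) \<le> 2 * B" "\<And>i x. x \<notin> {s..s+1} \<Longrightarrow> hs i x = 0"
    for hs :: "nat \<Rightarrow> real \<Rightarrow> complex" and k r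
  proof (rule integral_dominated_convergence[where w="\<lambda>x. 2 * B * indicator {s..s+1} x"])
    show "AE x in lborel. (\<lambda>i. hs i x * wave r x) \<longlonglongrightarrow> k x * wave r x"
      using hs(3) by (intro AE_I2 tendsto_mult tendsto_const)
    show "AE x in lborel. norm (hs i x * wave r x) \<le> 2 * B * indicator {s..s+1} x" for i
      using hs(4,5) by (auto simp: norm_mult indicator_def)
    show "(\<lambda>x. k x * wave r x) \<in> borel_measurable lborel" "(\<lambda>x. hs i x * wave r x) \<in> borel_measurable lborel" for i
      using hs(1,2) by simp_all
  qed (intro integrable_mult_right integrable_real_indicator, auto simp: emeasure_lborel_Icc_eq)
  have fz': "fs i x = 0" "gs i x = 0" if "x \<notin> {s..s+1}" for i x
    using fz gz f(3) g(3) that by auto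
  have supp': "0 \<le> x - u \<and> x - u \<le> 1" if "fs i u \<noteq> 0" "gs i x \<noteq> 0" for i u x
    using supp[of u x] fz[of u i] gz[of x i] that by auto
  have Lconv: "(\<lambda>i. Lam A F a \<phi> (fs i) (gs i)) \<longlonglongrightarrow> Lam A F a \<phi> f g"
    unfolding Lam_def
    using conv[OF m(1) f(1) fs(2) bnd(1) fz'(1)] conv[OF m(2) g(1) gs(2) bnd(2) fz'(2)]
    by (intro tendsto_sum tendsto_mult[OF tendsto_const] tendsto_mult) auto
  have nconv: "(\<lambda>i. LINT x|lborel. norm (hs i x) powr e) \<longlonglongrightarrow> (LINT x|lborel. norm (k x) powr e)"
    if e: "0 < e" and hs: "\<And>i. hs i \<in> borel_measurable borel" "k \<in> borel_measurable borel"
      "\<And>x. (\<lambda>i. hs i x) \<longlonglongrightarrow> k x" "\<And>i x. norm (hs i x) \<le> 2 * B" "\<And>i x. x \<notin> {s..s+1} \<Longrightarrow> hs i x = 0"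
    for hs :: "nat \<Rightarrow> real \<Rightarrow> complex" and k e
  proof (rule integral_dominated_convergence[where w="\<lambda>x. (2 * B) powr e * indicator {s..s+1} x"])
    show "AE x in lborel. (\<lambda>i. norm (hs i x) powr e) \<longlonglongrightarrow> norm (k x) powr e"
      using hs(3) e by (auto intro!: tendsto_powr' tendsto_norm)
    show "AE x in lborel. norm (norm (hs i x) powr e) \<le> (2 * B) powr e * indicator {s..s+1} x" for i
      using hs(4,5) e by (auto simp: indicator_def intro!: powr_mono2)
    show "(\<lambda>x. norm (k x) powr e) \<in> borel_measurable lborel" "(\<lambda>x. norm (hs i x) powr e) \<in> borel_measurable lborel" for i
      using hs(1,2) by simp_all
  qed (intro integrable_mult_right integrable_real_indicator, auto simp: emeasure_lborel_Icc_eq)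
  have *: "norm (Lam A F a \<phi> f g) \<le> \<alpha> * \<beta> * (\<gamma> + \<epsilon>) * (\<delta> + \<epsilon>)" if \<epsilon>: "0 < \<epsilon>" for \<epsilon>
  proof (rule tendsto_upperbound[OF tendsto_norm[OF Lconv]])
    have "(LINT x|lborel. norm (f x) powr q) < (\<gamma> + \<epsilon>) powr q" "(LINT x|lborel. norm (g x) powr q') < (\<delta> + \<epsilon>) powr q'"
      using \<epsilon> nf ng pos pq powr_less_mono2[of q \<gamma> "\<gamma> + \<epsilon>"] powr_less_mono2[of q' \<delta> "\<delta> + \<epsilon>"] by linarith+
    then have "\<forall>\<^sub>F i in sequentially. (LINT x|lborel. norm (fs i x) powr q) < (\<gamma> + \<epsilon>) powr q"
      "\<forall>\<^sub>F i in sequentially. (LINT x|lborel. norm (gs i x) powr q') < (\<delta> + \<epsilon>) powr q'"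
      using nconv[OF pq(3) m(1) f(1) fs(2) bnd(1) fz'(1), THEN order_tendstoD(2)]
        nconv[OF pq(4) m(2) g(1) gs(2) bnd(2) fz'(2), THEN order_tendstoD(2)] by blast+
    then show "\<forall>\<^sub>F i in sequentially. norm (Lam A F a \<phi> (fs i) (gs i)) \<le> \<alpha> * \<beta> * (\<gamma> + \<epsilon>) * (\<delta> + \<epsilon>)"
    proof eventually_elim
      case (elim i)
      show ?case
        using fs(1)[of i] gs(1)[of i] \<epsilon> pos fz' elim
        by (intro Lam_bound_simple[OF \<theta> \<rho> pq p p' q q' fin m(1) _ _ m(2) _ _ _ pos(1,2) _ _ a \<phi>, where s=s])
          (auto simp: simple_function_def dest: supp'[of i])
    qed
  qed simp
  have "((\<lambda>\<epsilon>. \<alpha> * \<beta> * (\<gamma> + \<epsilon>) * (\<delta> + \<epsilon>)) \<longlongrightarrow> \<alpha> * \<beta> * (\<gamma> + 0) * (\<delta> + 0)) (at_right 0)"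
    by (intro tendsto_intros)
  then have "norm (Lam A F a \<phi> f g) \<le> \<alpha> * \<beta> * (\<gamma> + 0) * (\<delta> + 0)"
    by (rule tendsto_lowerbound) (auto intro: eventually_mono[OF eventually_at_right_less] *)
  then show ?thesis by simp
qed

section \<open>The range of exponents\<close>

definition admissible :: "real \<Rightarrow> real \<Rightarrow> bool" where
  "admissible p q \<longleftrightarrow> p < 2 \<and> q \<in> {2 * p / (3 * p - 2)..2 * p / (2 - p)} \<or>
    2 < p \<and> q \<in> {2 * p / (p + 2)..2 * p / (p - 2)} \<or> p = 2 \<and> 1 \<le> q"

lemma admissible_ge_1:
  assumes "1 < p" "admissible p q"
  shows "1 \<le> q" "p \<noteq> 2 \<Longrightarrow> 1 < q"
proof -
  have "1 < 2 * p / (3 * p - 2)" if "p < 2" using assms that by (simp add: field_simps)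
  moreover have "1 < 2 * p / (p + 2)" if "2 < p" using assms that by (simp add: field_simps)
  ultimately show "1 \<le> q" "p \<noteq> 2 \<Longrightarrow> 1 < q"
    using assms(2) unfolding admissible_def atLeastAtMost_iff by argo+
qed

lemma admissible_2: "1 < p \<Longrightarrow> admissible p 2"
  by (cases p "2 :: real" rule: linorder_cases) (auto simp: admissible_def pos_le_divide_eq pos_divide_le_eq)

lemma conjugate_exponent:
  fixes p p' :: real
  assumes "1 < p" "1 / p + 1 / p' = 1"
  shows "1 < p'"
proof -
  have "1 / p < 1" "0 < 1 / p" using assms(1) by simp_all
  then have "1 / p' < 1" "0 < 1 / p'" using assms(2) by linarith+
  then show ?thesis by (simp add: divide_less_eq split: if_splits)
qed

text \<open>The condition says |1/q - 1/2| <= min(1/p, 1/p') together with q >= 1, which is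
  symmetric in p and p'. With p' = p/(p - 1) the endpoint formulas for exponents below 2 turn into
  those for exponents above 2, and conversely.\<close>

lemma admissible_commute:
  assumes "1 < p" "1 / p + 1 / p' = 1" "admissible p q"
  shows "admissible p' q"
proof -
  have p': "p' = p / (p - 1)"
    using assms(1,2) conjugate_exponent[OF assms(1,2)] by (simp add: field_simps)
  have eq: "2 * p' / (c * p' + d) = 2 * p / (c * p + d * (p - 1))" for c d
  proof -
    have "c * p' + d = (c * p + d * (p - 1)) / (p - 1)" using assms(1) by (simp add: p' add_divide_distrib)
    then show ?thesis using assms(1) by (simp add: p')
  qed
  have "p' < 2 \<longleftrightarrow> 2 < p" "2 < p' \<longleftrightarrow> p < 2" "p' = 2 \<longleftrightarrow> p = 2"
    using assms(1) by (auto simp: p' field_simps)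
  then show ?thesis
    using assms(3) eq[of 3 "-2"] eq[of "-1" 2] eq[of 1 2] eq[of 1 "-2"]
    by (auto simp: admissible_def algebra_simps)
qed

lemma Lam_bound_le_2:
  fixes p p' q q' :: real
  assumes p: "1 < p" "p \<le> 2" and p': "1 / p + 1 / p' = 1" and adm: "admissible p q"
    and q: "1 < q" "1 / q + 1 / q' = 1"
    and fin: "finite A" "finite F"
    and f: "f \<in> borel_measurable borel" "\<And>x. norm (f x) \<le> B" "\<And>x. x \<notin> {s..s+1} \<Longrightarrow> f x = 0"
    and g: "g \<in> borel_measurable borel" "\<And>x. norm (g x) \<le> B" "\<And>x. x \<notin> {s..s+1} \<Longrightarrow> g x = 0"
    and supp: "\<And>u x. f u \<noteq> 0 \<Longrightarrow> g x \<noteq> 0 \<Longrightarrow> x - u \<in> {0..1}"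
    and pos: "0 < \<alpha>" "0 < \<beta>" "0 < \<gamma>" "0 < \<delta>"
    and a: "(\<Sum>k\<in>A. norm (a k) powr p) \<le> \<alpha> powr p" and \<phi>: "(\<Sum>n\<in>F. norm (\<phi> n) powr p') \<le> \<beta> powr p'"
    and nf: "(LINT x|lborel. norm (f x) powr q) \<le> \<gamma> powr q" and ng: "(LINT x|lborel. norm (g x) powr q') \<le> \<delta> powr q'"
  shows "norm (Lam A F a \<phi> f g) \<le> \<alpha> * \<beta> * \<gamma> * \<delta>"
proof -
  \<comment> \<open>This solves 1/p = (1 - \<theta>) + \<theta>/2, the interpolation between
    exponents 1 and 2 for \<open>a\<close>; conjugacy then gives 1/p' = \<theta>/2 for
    \<open>\<phi>\<close>.\<close>
  define \<theta> where "\<theta> = 2 - 2 / p"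
  \<comment> \<open>Solved from 1/q = (1 - \<theta>)/2 + \<theta> \<rho>, where \<rho> is the
    reciprocal of the exponent at the second endpoint. Admissibility of \<open>q\<close> amounts to
    \<rho> lying in [0, 1].\<close>
  define \<rho> where "\<rho> = (1 / q - (1 - \<theta>) / 2) / \<theta>"
  have p'1: "1 < p'" and q'1: "1 < q'" using conjugate_exponent p p' q by auto
  have \<theta>: "0 < \<theta>" "\<theta> \<le> 1" using p by (auto simp: \<theta>_def field_simps)
  have ip: "1 / p = 1 - \<theta> / 2" "1 / p' = \<theta> / 2" using p' by (auto simp: \<theta>_def field_simps)
  have iq: "1 / q = (1 - \<theta>) / 2 + \<theta> * \<rho>" using \<theta> by (simp add: \<rho>_def)
  have iq': "1 / q' = (1 - \<theta>) / 2 + \<theta> * (1 - \<rho>)" using iq q by (simp add: add_divide_distrib diff_divide_distrib algebra_simps)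
  have "(1 - \<theta>) / 2 \<le> 1 / q \<and> 1 / q \<le> (1 + \<theta>) / 2"
  proof (cases "p = 2")
    case True
    then show ?thesis using q by (simp add: \<theta>_def)
  next
    case False
    then have "2 * p / (3 * p - 2) \<le> q" "q \<le> 2 * p / (2 - p)" "p < 2" using adm p by (auto simp: admissible_def)
    moreover have "(1 - \<theta>) / 2 = (2 - p) / (2 * p)" "(1 + \<theta>) / 2 = (3 * p - 2) / (2 * p)" using p by (auto simp: \<theta>_def field_simps)
    moreover from calculation have "1 / q \<le> 1 / (2 * p / (3 * p - 2))" "1 / (2 * p / (2 - p)) \<le> 1 / q"
      using p q by (intro divide_left_mono; simp)+
    then have "1 / q \<le> (3 * p - 2) / (2 * p)" "(2 - p) / (2 * p) \<le> 1 / q" by simp_all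
    ultimately show ?thesis by (simp only:)
  qed
  then have \<rho>: "0 \<le> \<rho>" "\<rho> \<le> 1" using \<theta> by (auto simp: \<rho>_def field_simps)
  have mul: "p * (1 - \<theta> / 2) = 1" "p' * (\<theta> / 2) = 1"
    unfolding ip(1)[symmetric] using p p'1 by (simp, simp flip: ip(2))
  have mul': "q * ((1 - \<theta>) / 2 + \<theta> * \<rho>) = 1" "q' * ((1 - \<theta>) / 2 + \<theta> * (1 - \<rho>)) = 1"
    unfolding iq[symmetric] iq'[symmetric] using q'1 q by simp_all
  have pos': "0 < p" "0 < p'" "0 < q" "0 < q'" using p p'1 q'1 q by simp_all
  show ?thesis
    by (rule Lam_bound_theta[OF \<theta> \<rho> pos' mul mul' fin f g supp pos a \<phi> nf ng]) auto
qed

lemma Lam_bound: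
  fixes p p' q q' :: real
  assumes p: "1 < p" and p': "1 / p + 1 / p' = 1" and adm: "admissible p q"
    and q: "1 < q" "1 / q + 1 / q' = 1"
    and fin: "finite A" "finite F"
    and f: "f \<in> borel_measurable borel" "\<And>x. norm (f x) \<le> B" "\<And>x. x \<notin> {s..s+1} \<Longrightarrow> f x = 0"
    and g: "g \<in> borel_measurable borel" "\<And>x. norm (g x) \<le> B" "\<And>x. x \<notin> {s..s+1} \<Longrightarrow> g x = 0"
    and supp: "\<And>u x. f u \<noteq> 0 \<Longrightarrow> g x \<noteq> 0 \<Longrightarrow> x - u \<in> {0..1}"
    and pos: "0 < \<alpha>" "0 < \<beta>" "0 < \<gamma>" "0 < \<delta>"
    and a: "(\<Sum>k\<in>A. norm (a k) powr p) \<le> \<alpha> powr p" and \<phi>: "(\<Sum>n\<in>F. norm (\<phi> n) powr p') \<le> \<beta> powr p'"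
    and nf: "(LINT x|lborel. norm (f x) powr q) \<le> \<gamma> powr q" and ng: "(LINT x|lborel. norm (g x) powr q') \<le> \<delta> powr q'"
  shows "norm (Lam A F a \<phi> f g) \<le> \<alpha> * \<beta> * \<gamma> * \<delta>"
proof (cases "p \<le> 2")
  case True
  show ?thesis by (rule Lam_bound_le_2[OF p True p' adm q fin f g supp pos a \<phi> nf ng])
next
  case False
  have "1 / p < 1 / 2" using False by (simp add: divide_less_eq)
  then have "1 / 2 < 1 / p'" using p' by linarith
  then have "p' \<le> 2" using conjugate_exponent[OF p p'] by (simp add: field_simps)
  moreover have "1 / p' + 1 / p = 1" using p' by simp
  ultimately have "norm (Lam F A \<phi> a f g) \<le> \<beta> * \<alpha> * \<gamma> * \<delta>"
    using conjugate_exponent[OF p p']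
    by (intro Lam_bound_le_2[OF _ _ _ admissible_commute[OF p p' adm] q fin(2,1) f g supp pos(2,1,3,4) \<phi> a nf ng])
  then show ?thesis by (simp add: Lam_commute[of A] mult_ac)
qed

text \<open>The case q = 1, where \<open>g\<close> is measured by its supremum and a finite dual
  exponent is missing. \<open>Lam_bound_l2\<close> with \<rho> = 1 and \<open>V\<close> equal to 0
  gives it without interpolation.\<close>

lemma Lam_bound_1:
  assumes fin: "finite A" "finite F"
    and f: "integrable lborel f" and g: "integrable lborel g" "\<And>x. norm (g x) \<le> 1"
    and supp: "\<And>u x. f u \<noteq> 0 \<Longrightarrow> g x \<noteq> 0 \<Longrightarrow> x - u \<in> {0..1}"
    and pos: "0 < \<alpha>" "0 < \<beta>" "0 < \<gamma>"
    and a: "(\<Sum>k\<in>A. norm (a k) powr 2) \<le> \<alpha> powr 2" and \<phi>: "(\<Sum>n\<in>F. norm (\<phi> n) powr 2) \<le> \<beta> powr 2"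
    and nf: "(LINT x|lborel. norm (f x)) \<le> \<gamma>"
  shows "norm (Lam A F a \<phi> f g) \<le> \<alpha> * \<beta> * \<gamma>"
proof -
  have "norm (Lam A F (\<lambda>k. of_real (1 / \<alpha>) * a k) (\<lambda>n. of_real (1 / \<beta>) * \<phi> n) (\<lambda>u. of_real (1 / \<gamma>) * f u) (\<lambda>x. 1 * g x)) \<le> 1"
  proof (rule Lam_bound_l2[where \<rho>=1 and U="\<lambda>u. norm (f u) / \<gamma>" and V="\<lambda>_. 0"])
    show "(\<Sum>k\<in>A. (norm (of_real (1 / \<alpha>) * a k))\<^sup>2) \<le> 1" "(\<Sum>k\<in>F. (norm (of_real (1 / \<beta>) * \<phi> k))\<^sup>2) \<le> 1"
      using a \<phi> pos by (simp_all add: norm_mult norm_divide power_divide flip: sum_divide_distrib)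
    show "norm (of_real (1 / \<gamma>) * f u) * norm (1 * g x) \<le> 1 * (norm (f u) / \<gamma>) + (1 - 1) * 0" for u x
      using pos g(2)[of x] by (simp add: norm_mult norm_divide mult_left_le divide_right_mono)
  qed (use fin f g supp pos nf in auto)
  then show ?thesis unfolding Lam_scale using pos by (simp add: norm_mult norm_divide field_simps)
qed

subsection \<open>Smooth functions of compact support\<close>

text \<open>The polynomial factor makes the class rich enough for Weierstrass approximation, and the
  power in the denominator makes it closed under differentiation, so that all derivatives are
  explicit.\<close>

definition bump :: "real \<Rightarrow> complex poly \<Rightarrow> nat \<Rightarrow> real \<Rightarrow> complex" where
  "bump R p m x = (if \<bar>x\<bar> < R then poly p (of_real x) / (of_real (R\<^sup>2) - (of_real x)\<^sup>2) ^ m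
     * exp (- 1 / (of_real (R\<^sup>2) - (of_real x)\<^sup>2)) else 0)"

text \<open>A single term of the exponential series bounds exp(1/t) from below by (1/t)^n / n!; take
  reciprocals.\<close>

lemma exp_minus_inverse_le:
  fixes t :: real
  assumes "0 < t"
  shows "exp (- 1 / t) \<le> fact n * t ^ n"
proof -
  have "(1 / t) ^ n / fact n \<le> (\<Sum>k\<le>n. (1 / t) ^ k / fact k)"
    by (rule member_le_sum) (use assms in auto)
  also have "\<dots> \<le> exp (1 / t)"
    using sum_le_suminf[OF summable_exp[of "1 / t"], of "{..n}"] assms
    by (simp add: exp_def divide_inverse mult.commute)
  finally have "(1 / t) ^ n / fact n \<le> exp (1 / t)" .
  then have "inverse (exp (1 / t)) \<le> inverse ((1 / t) ^ n / fact n)"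
    using assms by (intro le_imp_inverse_le) auto
  then show ?thesis by (simp add: exp_minus field_simps)
qed

lemma norm_bump:
  assumes "\<bar>x\<bar> < R"
  shows "0 < R\<^sup>2 - x\<^sup>2"
    "norm (bump R p m x) = norm (poly p (of_real x)) / (R\<^sup>2 - x\<^sup>2) ^ m * exp (- 1 / (R\<^sup>2 - x\<^sup>2))"
proof -
  show pos: "0 < R\<^sup>2 - x\<^sup>2" using power_strict_mono[OF assms, of 2] by simp
  have "complex_of_real (R\<^sup>2) - (of_real x)\<^sup>2 = of_real (R\<^sup>2 - x\<^sup>2)" by simp
  then show "norm (bump R p m x) = norm (poly p (of_real x)) / (R\<^sup>2 - x\<^sup>2) ^ m * exp (- 1 / (R\<^sup>2 - x\<^sup>2))"
    using assms pos unfolding bump_def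
    by (simp add: norm_mult norm_divide norm_power norm_exp_eq_Re abs_of_pos del: of_real_diff of_real_power)
qed

text \<open>The choice n = m + 2 in \<open>exp_minus_inverse_le\<close> cancels the denominator and
  leaves two factors R^2 - x^2. This double zero at the edge is what makes the derivative vanish
  there.\<close>

lemma norm_bump_le:
  assumes "0 < R"
  obtains K where "0 \<le> K" "\<And>x. \<bar>x\<bar> < R \<Longrightarrow> norm (bump R p m x) \<le> K * (R\<^sup>2 - x\<^sup>2)\<^sup>2"
proof -
  have "compact ((\<lambda>x. poly p (complex_of_real x)) ` {- R..R})"
    by (intro compact_continuous_image continuous_intros compact_Icc)
  then obtain B where B: "\<And>x. x \<in> {- R..R} \<Longrightarrow> norm (poly p (of_real x)) \<le> B"
    by (meson bounded_iff compact_imp_bounded imageI)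
  have B0: "0 \<le> B" using order_trans[OF norm_ge_zero B[of 0]] assms by simp
  have "norm (bump R p m x) \<le> B * fact (m + 2) * (R\<^sup>2 - x\<^sup>2)\<^sup>2" if "\<bar>x\<bar> < R" for x
  proof -
    define t where "t = R\<^sup>2 - x\<^sup>2"
    have t: "0 < t" using norm_bump(1)[OF that] by (simp add: t_def)
    have "norm (bump R p m x) = norm (poly p (of_real x)) / t ^ m * exp (- 1 / t)"
      using norm_bump(2)[OF that] by (simp add: t_def)
    also have "\<dots> \<le> B / t ^ m * (fact (m + 2) * t ^ (m + 2))"
      using t B0 that by (intro mult_mono divide_right_mono B exp_minus_inverse_le) auto
    also have "\<dots> = B * fact (m + 2) * t\<^sup>2" using t by (simp add: power_add power2_eq_square)
    finally show ?thesis by (simp add: t_def)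
  qed
  then show thesis using B0 by (intro that[of "B * fact (m + 2)"]) auto
qed

text \<open>With w = R^2 - x^2, the quotient and chain rules give the derivative the numerator (p' w
  + 2 m x p) w - 2 x p over the common denominator w^(m + 2).\<close>

definition bump_step :: "real \<Rightarrow> complex poly \<Rightarrow> nat \<Rightarrow> complex poly" where
  "bump_step R p m = (pderiv p * [:of_real (R\<^sup>2), 0, -1:] + smult (2 * of_nat m) (pCons 0 p)) * [:of_real (R\<^sup>2), 0, -1:]
     - smult 2 (pCons 0 p)"

lemma has_vector_derivative_bump:
  assumes R: "0 < R"
  shows "(bump R p m has_vector_derivative bump R (bump_step R p m) (m + 2) x) (at x)"
proof (cases "\<bar>x\<bar> < R")
  case True
  define w where "w = (\<lambda>z::complex. of_real (R\<^sup>2) - z\<^sup>2)"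
  let ?z = "complex_of_real x"
  have wx: "w ?z \<noteq> 0"
    using norm_bump(1)[OF True] by (simp add: w_def flip: of_real_power of_real_diff)
  have dw: "(w has_field_derivative - 2 * ?z) (at ?z)"
    unfolding w_def by (auto intro!: derivative_eq_intros)
  let ?E = "exp (- 1 / w ?z)"
  have dE: "((\<lambda>z. exp (- 1 / w z)) has_field_derivative ?E * (- 2 * ?z / (w ?z)\<^sup>2)) (at ?z)"
    by (rule DERIV_chain2[OF DERIV_exp, THEN DERIV_cong], (rule derivative_intros dw wx)+)
      (simp_all add: power2_eq_square)
  have dm: "((\<lambda>z. w z ^ m) has_field_derivative of_nat m * (w ?z ^ (m - 1) * (- 2 * ?z))) (at ?z)"
    using DERIV_power[OF dw, of m] by (simp add: mult_ac)
  have "((\<lambda>z. poly p z / w z ^ m * exp (- 1 / w z)) has_field_derivative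
      poly (bump_step R p m) ?z / w ?z ^ (m + 2) * ?E) (at ?z)"
  proof (rule DERIV_cong[OF DERIV_mult[OF DERIV_divide[OF poly_DERIV dm] dE]])
    show "w ?z ^ m \<noteq> 0" using wx by simp
    have step: "poly (bump_step R p m) ?z = (poly (pderiv p) ?z * w ?z + 2 * of_nat m * ?z * poly p ?z) * w ?z - 2 * ?z * poly p ?z"
      by (simp add: bump_step_def w_def power2_eq_square algebra_simps)
    have *: "of_nat m * (w ?z ^ (m - 1) * (- 2 * ?z)) = of_nat m * w ?z ^ m * (- 2 * ?z) / w ?z"
      using wx by (cases m) auto
    show "(poly (pderiv p) ?z * w ?z ^ m - poly p ?z * (of_nat m * (w ?z ^ (m - 1) * (- 2 * ?z)))) /
        (w ?z ^ m * w ?z ^ m) * ?E + ?E * (- 2 * ?z / (w ?z)\<^sup>2) * (poly p ?z / w ?z ^ m) =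
      poly (bump_step R p m) ?z / w ?z ^ (m + 2) * ?E"
      unfolding step * using wx by (simp add: divide_simps power2_eq_square) (simp add: algebra_simps)
  qed
  from has_vector_derivative_real_field[OF this]
  have "((\<lambda>x. poly p (of_real x) / w (of_real x) ^ m * exp (- 1 / w (of_real x))) has_vector_derivative
      bump R (bump_step R p m) (m + 2) x) (at x)"
    using True by (simp add: bump_def w_def)
  then show ?thesis
    by (rule has_vector_derivative_transform_within_open[where S="{-R<..<R}"])
      (use True in \<open>auto simp: bump_def w_def\<close>)
next
  case False
  obtain K where K: "0 \<le> K" "\<And>x. \<bar>x\<bar> < R \<Longrightarrow> norm (bump R p m x) \<le> K * (R\<^sup>2 - x\<^sup>2)\<^sup>2"
    using norm_bump_le[OF R] by blast
  have le: "norm (bump R p m y) \<le> K * (2 * \<bar>x\<bar>)\<^sup>2 * (norm (y - x))\<^sup>2" for y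
  proof (cases "\<bar>y\<bar> < R")
    case True
    \<comment> \<open>Here |y| < R <= |x|, so R^2 - y^2 is at most 2|x| |x - y|. Its square is of
      second order in y - x, and the difference quotient tends to 0.\<close>
    have "R\<^sup>2 - y\<^sup>2 \<le> x\<^sup>2 - y\<^sup>2" using False R by (simp add: abs_le_square_iff[symmetric])
    also have "\<dots> \<le> \<bar>x + y\<bar> * \<bar>x - y\<bar>" by (metis abs_ge_self abs_mult power2_eq_square square_diff_square_factored)
    also have "\<dots> \<le> (2 * \<bar>x\<bar>) * \<bar>x - y\<bar>" using True False by (intro mult_right_mono) auto
    finally have "(R\<^sup>2 - y\<^sup>2)\<^sup>2 \<le> ((2 * \<bar>x\<bar>) * \<bar>x - y\<bar>)\<^sup>2"
      using norm_bump(1)[OF True] by (intro power_mono) auto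
    then have "K * (R\<^sup>2 - y\<^sup>2)\<^sup>2 \<le> K * ((2 * \<bar>x\<bar>) * \<bar>x - y\<bar>)\<^sup>2" using K(1) by (rule mult_left_mono)
    then show ?thesis using K(2)[OF True] by (simp add: power_mult_distrib abs_minus_commute mult.assoc)
  next
    case False
    then show ?thesis using K(1) by (simp add: bump_def)
  qed
  have "(bump R p m has_derivative (\<lambda>h. 0)) (at x)"
  proof (rule has_derivativeI_sandwich[of 1 _ _ _ _ "\<lambda>y. K * (2 * \<bar>x\<bar>)\<^sup>2 * norm (y - x)"])
    have "((\<lambda>y. K * (2 * \<bar>x\<bar>)\<^sup>2 * norm (y - x)) \<longlongrightarrow> K * (2 * \<bar>x\<bar>)\<^sup>2 * norm (x - x)) (at x)"
      by (intro tendsto_intros)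
    then show "((\<lambda>y. K * (2 * \<bar>x\<bar>)\<^sup>2 * norm (y - x)) \<longlongrightarrow> 0) (at x)" by simp
    fix y assume "y \<noteq> x"
    then show "norm (bump R p m y - bump R p m x - 0) / norm (y - x) \<le> K * (2 * \<bar>x\<bar>)\<^sup>2 * norm (y - x)"
      using le[of y] False by (simp add: bump_def[of R p m x] divide_le_eq power2_eq_square mult.assoc)
  qed auto
  then show ?thesis using False by (simp add: has_vector_derivative_def bump_def[of _ _ _ x])
qed

lemma continuous_on_bump: "0 < R \<Longrightarrow> continuous_on A (bump R p m)"
  by (meson continuous_at_imp_continuous_on has_vector_derivative_bump has_vector_derivative_continuous)

text \<open>Iterating \<open>bump_step\<close> supplies the sequence of derivatives that
  \<open>schwartz\<close> asks for, with denominator power 2k at order k; compact support bounds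
  every weighted derivative.\<close>

lemma bump_schwartz:
  assumes R: "0 < R"
  shows "bump R p 0 \<in> schwartz"
proof -
  define P where "P = rec_nat p (\<lambda>k q. bump_step R q (2 * k))"
  have P: "P 0 = p" "P (Suc k) = bump_step R (P k) (2 * k)" for k by (simp_all add: P_def)
  have "bounded (range (\<lambda>x. x ^ j *\<^sub>R bump R (P k) (2 * k) x))" for j k
  proof -
    have "compact ((\<lambda>x. x ^ j *\<^sub>R bump R (P k) (2 * k) x) ` {-R..R})"
      by (intro compact_continuous_image continuous_intros continuous_on_bump R compact_Icc)
    then have "bounded (insert 0 ((\<lambda>x. x ^ j *\<^sub>R bump R (P k) (2 * k) x) ` {-R..R}))"
      by (simp add: compact_imp_bounded)
    moreover have "range (\<lambda>x. x ^ j *\<^sub>R bump R (P k) (2 * k) x) \<subseteq> insert 0 ((\<lambda>x. x ^ j *\<^sub>R bump R (P k) (2 * k) x) ` {-R..R})"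
    proof
      fix y assume "y \<in> range (\<lambda>x. x ^ j *\<^sub>R bump R (P k) (2 * k) x)"
      then obtain x where x: "y = x ^ j *\<^sub>R bump R (P k) (2 * k) x" by blast
      show "y \<in> insert 0 ((\<lambda>x. x ^ j *\<^sub>R bump R (P k) (2 * k) x) ` {-R..R})"
      proof (cases "\<bar>x\<bar> < R")
        case True
        then have "x \<in> {-R..R}" by auto
        then show ?thesis using x by blast
      next
        case False
        then show ?thesis using x by (simp add: bump_def)
      qed
    qed
    ultimately show ?thesis by (rule bounded_subset)
  qed
  moreover have "(bump R (P k) (2 * k) has_vector_derivative bump R (P (Suc k)) (2 * Suc k) x) (at x)" for k x
    using has_vector_derivative_bump[OF R, of "P k" "2 * k" x] by (simp add: P)
  ultimately show ?thesis
    unfolding schwartz_def by (intro CollectI exI[of _ "\<lambda>k. bump R (P k) (2 * k)"]) (simp add: P)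
qed

text \<open>Divide \<open>h\<close> by the exponential factor, which is harmless because
  \<open>h\<close> vanishes before the edge (r < R), and approximate the quotient by a polynomial on
  [-R, R]. Multiplying back by a factor at most 1 does not increase the error.\<close>

lemma bump_dense_uniform:
  assumes h: "continuous_on UNIV h" and supp: "\<And>x. r \<le> \<bar>x\<bar> \<Longrightarrow> h x = 0" and r: "0 < r" "r < R" and e: "0 < e"
  obtains p where "\<And>x. norm (h x - bump R p 0 x) \<le> e"
proof -
  define E where "E x = exp (1 / (R\<^sup>2 - x\<^sup>2))" for x :: real
  define k where "k x = (if \<bar>x\<bar> \<le> r then h x * of_real (E x) else 0)" for x
  have pos: "0 < R\<^sup>2 - x\<^sup>2" if "\<bar>x\<bar> < R" for x using norm_bump(1)[OF that] .
  have "continuous_on ({-r..r} \<union> ({-R..-r} \<union> {r..R})) (\<lambda>x. if x \<in> {-r..r} then h x * of_real (E x) else 0)"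
  proof (rule continuous_on_cases)
    show "continuous_on {-r..r} (\<lambda>x. h x * complex_of_real (E x))"
      unfolding E_def using r pos
      by (intro continuous_intros continuous_on_subset[OF h]) (force simp: abs_le_iff)+
    show "\<forall>x. x \<in> {-r..r} \<and> x \<notin> {-r..r} \<or> x \<in> {-R..-r} \<union> {r..R} \<and> x \<in> {-r..r} \<longrightarrow> h x * of_real (E x) = 0"
      using supp r by (auto simp: abs_if)
  qed auto
  moreover have "{-r..r} \<union> ({-R..-r} \<union> {r..R}) = {-R..R}" using r by auto
  moreover have "(\<lambda>x. if x \<in> {-r..r} then h x * of_real (E x) else 0) = k" by (auto simp: k_def abs_le_iff)
  ultimately have k: "continuous_on {-R..R} k" by (simp only:)
  obtain u where u: "real_polynomial_function u" "\<And>x. x \<in> {-R..R} \<Longrightarrow> \<bar>Re (k x) - u x\<bar> < e / 2"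
    by (rule Stone_Weierstrass_real_polynomial_function[of "{-R..R}" "\<lambda>x. Re (k x)" "e / 2"])
      (use k e in \<open>auto intro!: continuous_intros\<close>)
  obtain v where v: "real_polynomial_function v" "\<And>x. x \<in> {-R..R} \<Longrightarrow> \<bar>Im (k x) - v x\<bar> < e / 2"
    by (rule Stone_Weierstrass_real_polynomial_function[of "{-R..R}" "\<lambda>x. Im (k x)" "e / 2"])
      (use k e in \<open>auto intro!: continuous_intros\<close>)
  obtain a n where a: "u = (\<lambda>x. \<Sum>i\<le>n. a i * x ^ i)" using u(1) unfolding real_polynomial_function_iff_sum by blast
  obtain b m where b: "v = (\<lambda>x. \<Sum>i\<le>m. b i * x ^ i)" using v(1) unfolding real_polynomial_function_iff_sum by blast
  define p where "p = (\<Sum>i\<le>n. monom (of_real (a i)) i) + smult \<i> (\<Sum>i\<le>m. monom (complex_of_real (b i)) i)"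
  have p: "poly p (of_real x) = Complex (u x) (v x)" for x
    by (simp add: p_def a b poly_sum poly_monom complex_eq_iff)
  have "norm (h x - bump R p 0 x) \<le> e" for x
  proof (cases "\<bar>x\<bar> < R")
    case True
    have "norm (k x - poly p (of_real x)) \<le> \<bar>Re (k x - poly p (of_real x))\<bar> + \<bar>Im (k x - poly p (of_real x))\<bar>"
      by (rule cmod_le)
    also have "\<dots> \<le> e" using u(2)[of x] v(2)[of x] True by (simp add: p abs_less_iff)
    finally have kp: "norm (k x - poly p (of_real x)) \<le> e" .
    have hx: "h x = k x * of_real (exp (- 1 / (R\<^sup>2 - x\<^sup>2)))"
      using supp[of x] by (simp add: k_def E_def flip: exp_add of_real_mult)
    have bx: "bump R p 0 x = poly p (of_real x) * of_real (exp (- 1 / (R\<^sup>2 - x\<^sup>2)))"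
      using True by (simp add: bump_def flip: exp_of_real)
    have "norm (h x - bump R p 0 x) = norm (k x - poly p (of_real x)) * exp (- 1 / (R\<^sup>2 - x\<^sup>2))"
      unfolding hx bx left_diff_distrib[symmetric] by (simp add: norm_mult)
    also have "\<dots> \<le> e * 1" using kp pos[OF True] e by (intro mult_mono) auto
    finally show ?thesis by simp
  next
    case False
    then show ?thesis using supp[of x] r e by (simp add: bump_def)
  qed
  then show thesis by (rule that)
qed

subsection \<open>Density of Schwartz functions\<close>

text \<open>A crude substitute for Minkowski's inequality. The factor 2^q is harmless because it
  only ever multiplies errors that are made arbitrarily small.\<close>

lemma powr_add_le:
  fixes a b q :: real
  assumes "0 \<le> a" "0 \<le> b" "0 \<le> q"
  shows "(a + b) powr q \<le> 2 powr q * (a powr q + b powr q)"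
proof -
  have "(a + b) powr q \<le> (2 * max a b) powr q" using assms by (intro powr_mono2) auto
  also have "\<dots> = 2 powr q * (max a b) powr q" using assms by (simp add: powr_mult)
  also have "\<dots> \<le> 2 powr q * (a powr q + b powr q)"
    by (intro mult_left_mono) (auto simp: max_def)
  finally show ?thesis .
qed

lemma norm_add_powr_le:
  fixes a b :: complex
  assumes "0 \<le> q"
  shows "norm (a + b) powr q \<le> 2 powr q * (norm a powr q + norm b powr q)"
  using order_trans[OF powr_mono2[OF assms norm_ge_zero norm_triangle_ineq] powr_add_le[OF norm_ge_zero norm_ge_zero assms]] .

lemma Lq_add:
  assumes q: "0 \<le> q" and m: "f \<in> borel_measurable M" "g \<in> borel_measurable M"
    and i: "integrable M (\<lambda>x. norm (f x :: complex) powr q)" "integrable M (\<lambda>x. norm (g x :: complex) powr q)"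
  shows "integrable M (\<lambda>x. norm (f x + g x) powr q)"
    "(LINT x|M. norm (f x + g x) powr q) \<le> 2 powr q * ((LINT x|M. norm (f x) powr q) + (LINT x|M. norm (g x) powr q))"
proof -
  have i': "integrable M (\<lambda>x. 2 powr q * (norm (f x) powr q + norm (g x) powr q))"
    using i by simp
  show 1: "integrable M (\<lambda>x. norm (f x + g x) powr q)"
    by (rule Bochner_Integration.integrable_bound[OF i'])
      (use m norm_add_powr_le[OF q] in auto)
  have "(LINT x|M. norm (f x + g x) powr q) \<le> (LINT x|M. 2 powr q * (norm (f x) powr q + norm (g x) powr q))"
    by (rule integral_mono[OF 1 i' norm_add_powr_le[OF q]])
  then show "(LINT x|M. norm (f x + g x) powr q) \<le> 2 powr q * ((LINT x|M. norm (f x) powr q) + (LINT x|M. norm (g x) powr q))"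
    using i by simp
qed

text \<open>Lebesgue measurability gives continuous functions converging off a null set, with no
  control of size or support. A retraction onto the disc of radius \<open>B\<close> and a continuous
  cutoff restore both without disturbing the limit, as both fix the values of
  \<open>f\<close>.\<close>

lemma continuous_ae_approx:
  fixes f :: "real \<Rightarrow> complex"
  assumes f: "f \<in> borel_measurable borel" and B: "\<And>x. norm (f x) \<le> B" and supp: "\<And>x. r < \<bar>x\<bar> \<Longrightarrow> f x = 0"
  obtains g where "\<And>n. continuous_on UNIV (g n)" "\<And>n x. norm (g n x) \<le> B" "\<And>n x. r + 1 \<le> \<bar>x\<bar> \<Longrightarrow> g n x = 0"
    "AE x in lborel. (\<lambda>n. g n x) \<longlonglongrightarrow> f x"
proof -
  have B0: "0 \<le> B" using order_trans[OF norm_ge_zero B[of 0]] .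
  have "f \<in> borel_measurable lebesgue" using f by (intro measurable_completion) simp
  then have "f measurable_on UNIV" by (rule lebesgue_measurable_imp_measurable_on) simp
  then obtain N h where N: "negligible N" and h: "\<And>n. continuous_on UNIV (h n)"
    and lim: "\<And>x. x \<notin> N \<Longrightarrow> (\<lambda>n. h n x) \<longlonglongrightarrow> f x"
    unfolding measurable_on_def by auto
  \<comment> \<open>Radial retraction onto the disc of radius \<open>B\<close>. The extra 1 keeps
    the denominator positive when \<open>B = 0\<close>, in which case \<open>t\<close> is
    identically 0.\<close>
  define t where "t z = z * of_real (B / max (B + (if B = 0 then 1 else 0)) (norm z))" for z :: complex
  define \<kappa> where "\<kappa> x = max 0 (min 1 (r + 1 - \<bar>x\<bar>))" for x :: real
  have ct: "continuous_on UNIV t" unfolding t_def using B0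
    by (intro continuous_intros) (auto simp: max_def)
  have nt: "norm (t z) \<le> B" for z
  proof -
    have "norm z \<le> max (B + (if B = 0 then 1 else 0)) (norm z)" by simp
    moreover have "0 < max (B + (if B = 0 then 1 else 0)) (norm z)" using B0 by auto
    ultimately have "norm z / max (B + (if B = 0 then 1 else 0)) (norm z) \<le> 1" by simp
    then have "norm z / max (B + (if B = 0 then 1 else 0)) (norm z) * B \<le> 1 * B" using B0 by (rule mult_right_mono)
    then show ?thesis using B0 by (cases "B = 0") (simp_all add: t_def norm_mult norm_divide)
  qed
  have tf: "t (f x) = f x" for x
    using B[of x] B0 by (cases "B = 0") (auto simp: t_def)
  have \<kappa>: "0 \<le> \<kappa> x" "\<kappa> x \<le> 1" for x by (auto simp: \<kappa>_def)
  have \<kappa>f: "of_real (\<kappa> x) * f x = f x" for x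
    using supp[of x] by (cases "r < \<bar>x\<bar>") (auto simp: \<kappa>_def)
  show thesis
  proof (rule that[of "\<lambda>n x. of_real (\<kappa> x) * t (h n x)"])
    show "continuous_on UNIV (\<lambda>x. of_real (\<kappa> x) * t (h n x))" for n
      unfolding \<kappa>_def by (intro continuous_intros continuous_on_compose2[OF ct h]) auto
    show "norm (of_real (\<kappa> x) * t (h n x)) \<le> B" for n x
      using mult_mono[OF \<kappa>(2)[of x] nt[of "h n x"]] \<kappa>(1)[of x] by (simp add: norm_mult)
    show "r + 1 \<le> \<bar>x\<bar> \<Longrightarrow> of_real (\<kappa> x) * t (h n x) = 0" for n x by (simp add: \<kappa>_def)
    have "(\<lambda>n. of_real (\<kappa> x) * t (h n x)) \<longlonglongrightarrow> f x" if "x \<notin> N" for x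
    proof -
      have "(\<lambda>n. of_real (\<kappa> x) * t (h n x)) \<longlonglongrightarrow> of_real (\<kappa> x) * t (f x)"
        using ct lim[OF that] by (intro tendsto_mult tendsto_const continuous_on_tendsto_compose[OF ct]) auto
      then show ?thesis by (simp add: tf \<kappa>f)
    qed
    moreover have "AE x in lebesgue. x \<notin> N"
      using N by (simp add: negligible_iff_null_sets AE_not_in)
    ultimately have "AE x in lebesgue. (\<lambda>n. of_real (\<kappa> x) * t (h n x)) \<longlonglongrightarrow> f x"
      by (auto elim: eventually_mono)
    then show "AE x in lborel. (\<lambda>n. of_real (\<kappa> x) * t (h n x)) \<longlonglongrightarrow> f x"
      by (simp add: AE_completion_iff)
  qed
qed

lemma integrable_indicator_const: "integrable lborel (\<lambda>x::real. c * indicator {a..b} x :: real)"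
  by (intro integrable_mult_right integrable_real_indicator) (auto simp: emeasure_lborel_Icc_eq)

lemma bump_bounded:
  assumes "0 < R"
  obtains C where "0 \<le> C" "\<And>x. norm (bump R p m x) \<le> C"
proof -
  obtain K where K: "0 \<le> K" "\<And>x. \<bar>x\<bar> < R \<Longrightarrow> norm (bump R p m x) \<le> K * (R\<^sup>2 - x\<^sup>2)\<^sup>2"
    using norm_bump_le[OF assms] by blast
  have "norm (bump R p m x) \<le> K * (R\<^sup>2)\<^sup>2" for x
  proof (cases "\<bar>x\<bar> < R")
    case True
    then have "K * (R\<^sup>2 - x\<^sup>2)\<^sup>2 \<le> K * (R\<^sup>2)\<^sup>2"
      using norm_bump(1)[OF True] K(1) by (intro mult_left_mono power_mono) auto
    then show ?thesis using K(2)[OF True] by simp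
  qed (use K(1) in \<open>simp add: bump_def\<close>)
  then show thesis using that K(1) by (metis mult_nonneg_nonneg zero_le_power2)
qed

lemma borel_measurable_bump [measurable]: "0 < R \<Longrightarrow> bump R p m \<in> borel_measurable borel"
  by (intro borel_measurable_continuous_onI continuous_on_bump)

text \<open>Two approximations are composed: almost everywhere by continuous functions vanishing for
  |x| >= r + 1, then uniformly by bumps of radius r + 2, the extra unit being the margin that
  \<open>bump_dense_uniform\<close> requires. All errors live on one interval and are at most 2B +
  1, so dominated convergence applies.\<close>

lemma schwartz_dense_bounded:
  fixes f :: "real \<Rightarrow> complex"
  assumes q: "0 < q" and f: "f \<in> borel_measurable borel" and B: "\<And>x. norm (f x) \<le> B"
    and supp: "\<And>x. r < \<bar>x\<bar> \<Longrightarrow> f x = 0" and r: "0 < r" and e: "0 < e"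
  obtains p where "(LINT x|lborel. norm (f x - bump (r + 2) p 0 x) powr q) < e"
proof -
  obtain g where g: "\<And>n. continuous_on UNIV (g n)" "\<And>n x. norm (g n x) \<le> B" "\<And>n x. r + 1 \<le> \<bar>x\<bar> \<Longrightarrow> g n x = 0"
    "AE x in lborel. (\<lambda>n. g n x) \<longlonglongrightarrow> f x"
    using continuous_ae_approx[OF f B supp] by blast
  have B0: "0 \<le> B" using order_trans[OF norm_ge_zero B[of 0]] .
  have "\<exists>p. \<forall>x. norm (g n x - bump (r + 2) p 0 x) \<le> 1 / Suc n" for n
    by (rule bump_dense_uniform[of "g n" "r + 1" "r + 2" "1 / Suc n"]) (use g(1,3) r in auto)
  then obtain p where p: "\<And>n x. norm (g n x - bump (r + 2) (p n) 0 x) \<le> 1 / Suc n" by metis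
  have "(\<lambda>n. LINT x|lborel. norm (f x - bump (r + 2) (p n) 0 x) powr q) \<longlonglongrightarrow> (LINT x|(lborel :: real measure). 0 :: real)"
  proof (rule integral_dominated_convergence[where w="\<lambda>x. (2 * B + 1) powr q * indicator {-(r + 2)..r + 2} x"])
    show "(\<lambda>x. norm (f x - bump (r + 2) (p n) 0 x) powr q) \<in> borel_measurable lborel" for n
      using f borel_measurable_continuous_onI[OF continuous_on_bump[of "r + 2" UNIV "p n" 0]] r by simp
    show "AE x in lborel. norm (norm (f x - bump (r + 2) (p n) 0 x) powr q) \<le> (2 * B + 1) powr q * indicator {-(r + 2)..r + 2} x" for n
    proof (rule AE_I2)
      fix x
      show "norm (norm (f x - bump (r + 2) (p n) 0 x) powr q) \<le> (2 * B + 1) powr q * indicator {-(r + 2)..r + 2} x"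
      proof (cases "\<bar>x\<bar> < r + 2")
        case True
        have "norm (f x - bump (r + 2) (p n) 0 x) \<le> norm (f x) + norm (g n x) + norm (g n x - bump (r + 2) (p n) 0 x)"
          using norm_triangle_ineq4[of "f x" "g n x"] norm_triangle_ineq[of "f x - g n x" "g n x - bump (r + 2) (p n) 0 x"] by simp
        also have "\<dots> \<le> B + B + 1"
          using p[of n x] by (intro add_mono B g(2)) (auto elim: order_trans)
        finally have "norm (f x - bump (r + 2) (p n) 0 x) powr q \<le> (2 * B + 1) powr q"
          using q by (intro powr_mono2) auto
        then show ?thesis using True by (auto simp: indicator_def)
      next
        case False
        then show ?thesis using supp[of x] r by (simp add: bump_def)
      qed
    qed
    show "AE x in lborel. (\<lambda>n. norm (f x - bump (r + 2) (p n) 0 x) powr q) \<longlonglongrightarrow> 0"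
      using g(4)
    proof eventually_elim
      case (elim x)
      have "(\<lambda>n. g n x - bump (r + 2) (p n) 0 x) \<longlonglongrightarrow> 0"
        by (rule Lim_null_comparison[OF _ LIMSEQ_inverse_real_of_nat]) (use p in \<open>simp add: inverse_eq_divide\<close>)
      then have "(\<lambda>n. norm ((f x - g n x) + (g n x - bump (r + 2) (p n) 0 x)) powr q) \<longlonglongrightarrow> norm ((f x - f x) + 0) powr q"
        using q by (intro tendsto_powr' tendsto_norm tendsto_intros elim) auto
      then show ?case using q by simp
    qed
  qed (rule integrable_indicator_const | simp)+
  then have "\<forall>\<^sub>F n in sequentially. (LINT x|lborel. norm (f x - bump (r + 2) (p n) 0 x) powr q) < e"
    by (rule order_tendstoD(2)) (use e in simp)
  then show thesis using that by (auto simp: eventually_sequentially)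
qed

definition truncate :: "nat \<Rightarrow> (real \<Rightarrow> complex) \<Rightarrow> real \<Rightarrow> complex" where
  "truncate j f x = (if norm (f x) \<le> j \<and> \<bar>x\<bar> \<le> j then f x else 0)"

lemma truncate_measurable [measurable]:
  assumes [measurable]: "f \<in> borel_measurable borel"
  shows "truncate j f \<in> borel_measurable borel"
  unfolding truncate_def by measurable

lemma truncate_bounds:
  "norm (truncate j f x) \<le> j" "norm (truncate j f x) \<le> norm (f x)" "j < \<bar>x\<bar> \<Longrightarrow> truncate j f x = 0"
  by (auto simp: truncate_def)

lemma truncate_tendsto: "(\<lambda>j. truncate j f x) \<longlonglongrightarrow> f x"
proof (rule tendsto_eventually)
  have "\<forall>\<^sub>F j in sequentially. max (norm (f x)) \<bar>x\<bar> \<le> real j"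
    by real_asymp
  then show "\<forall>\<^sub>F j in sequentially. truncate j f x = f x"
    by eventually_elim (auto simp: truncate_def)
qed

lemma schwartz_dense:
  fixes f :: "real \<Rightarrow> complex"
  assumes q: "0 < q" and f [measurable]: "f \<in> borel_measurable borel" and i: "integrable lborel (\<lambda>x. norm (f x) powr q)"
    and e: "0 < e"
  obtains R p where "0 < R" "integrable lborel (\<lambda>x. norm (bump R p 0 x) powr q)"
    "(LINT x|lborel. norm (f x - bump R p 0 x) powr q) < e"
proof -
  \<comment> \<open>Truncation and bump approximation share the error, after the factor 2^q of
    \<open>Lq_add\<close>.\<close>
  define e' where "e' = e / (2 powr q * 2)"
  have e': "0 < e'" using e by (simp add: e'_def)
  have dom: "norm (norm (f x - truncate j f x) powr q) \<le> norm (f x) powr q" for j x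
    using q by (auto simp: truncate_def)
  have itr: "integrable lborel (\<lambda>x. norm (f x - truncate j f x) powr q)" for j
    by (rule Bochner_Integration.integrable_bound[OF i]) (use dom in auto)
  have "(\<lambda>j. LINT x|lborel. norm (f x - truncate j f x) powr q) \<longlonglongrightarrow> (LINT x|(lborel :: real measure). 0 :: real)"
  proof (rule integral_dominated_convergence[OF _ _ i])
    have "(\<lambda>j. norm (f x - truncate j f x) powr q) \<longlonglongrightarrow> norm (f x - f x) powr q" for x
      using q by (intro tendsto_powr' tendsto_norm tendsto_diff tendsto_const truncate_tendsto) auto
    then show "AE x in lborel. (\<lambda>j. norm (f x - truncate j f x) powr q) \<longlonglongrightarrow> 0" by simp
  qed (use dom in auto)
  then have "\<forall>\<^sub>F j in sequentially. (LINT x|lborel. norm (f x - truncate j f x) powr q) < e'"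
    by (rule order_tendstoD(2)) (use e' in simp)
  then have "\<forall>\<^sub>F j in sequentially. (LINT x|lborel. norm (f x - truncate j f x) powr q) < e' \<and> 0 < j"
    using eventually_gt_at_top[of 0] eventually_conj by blast
  then obtain j where j: "(LINT x|lborel. norm (f x - truncate j f x) powr q) < e'" "0 < j"
    by (auto simp: eventually_sequentially)
  obtain p where p: "(LINT x|lborel. norm (truncate j f x - bump (real j + 2) p 0 x) powr q) < e'"
    using schwartz_dense_bounded[OF q truncate_measurable[OF f], of j j j e'] truncate_bounds j e' by auto
  let ?b = "bump (real j + 2) p 0"
  have cb: "continuous_on UNIV ?b" by (rule continuous_on_bump) simp
  then have [measurable]: "?b \<in> borel_measurable borel" by (rule borel_measurable_continuous_onI)
  obtain C where C0: "0 \<le> C" and nb: "\<And>x. norm (?b x) \<le> C"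
    using bump_bounded[of "real j + 2" p 0] by auto
  have bs: "\<bar>x\<bar> \<ge> real j + 2 \<Longrightarrow> ?b x = 0" for x by (simp add: bump_def)
  have ib: "integrable lborel (\<lambda>x. norm (?b x) powr q)"
    by (rule integrable_bounded_support[where B="C powr q" and a="-(real j + 2)" and b="real j + 2"])
      (use nb bs q in \<open>auto intro!: powr_mono2\<close>)
  have nd: "norm (truncate j f x - ?b x) \<le> real j + C" for x
    using norm_triangle_ineq4[of "truncate j f x" "?b x"] nb[of x] truncate_bounds(1)[of j f x] by linarith
  have it2: "integrable lborel (\<lambda>x. norm (truncate j f x - ?b x) powr q)"
    by (rule integrable_bounded_support[where B="(real j + C) powr q" and a="-(real j + 2)" and b="real j + 2"])
      (use bs q truncate_bounds(3)[of j _ f] nd in \<open>auto intro!: powr_mono2\<close>)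
  have "(LINT x|lborel. norm ((f x - truncate j f x) + (truncate j f x - ?b x)) powr q) \<le> 2 powr q * ((LINT x|lborel. norm (f x - truncate j f x) powr q) + (LINT x|lborel. norm (truncate j f x - ?b x) powr q))"
    by (rule Lq_add(2)[OF _ _ _ itr it2]) (use q in auto)
  also have "\<dots> < 2 powr q * (e' + e')" using j p by (intro mult_strict_left_mono) auto
  also have "\<dots> = e" by (simp add: e'_def)
  finally show thesis using ib by (intro that[of "real j + 2" p]) auto
qed

text \<open>Replacing \<open>f\<close> by a bump that is close in mean changes the correlation by at
  most \<open>B\<close> times the distance, uniformly in y, because \<open>g\<close> is bounded. The
  correlation with a bump is continuous by dominated convergence, and continuity passes to the
  uniform limit.\<close>

lemma continuous_correlation:
  fixes f g :: "real \<Rightarrow> complex"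
  assumes f: "f \<in> borel_measurable borel" "\<And>x. norm (f x) \<le> B" "\<And>x. x \<notin> {s..t} \<Longrightarrow> f x = 0"
    and g: "g \<in> borel_measurable borel" "\<And>x. norm (g x) \<le> B" "\<And>x. x \<notin> {s'..t'} \<Longrightarrow> g x = 0"
  shows "isCont (\<lambda>y. LINT x|lborel. f (x - y) * g x) y0"
proof -
  note [measurable] = f(1) g(1)
  have B0: "0 \<le> B" using order_trans[OF norm_ge_zero f(2)] .
  have ig: "integrable lborel g" by (rule integrable_bounded_support[OF g])
  have if1: "integrable lborel (\<lambda>x. norm (f x) powr 1)"
    by (rule integrable_bounded_support[where B=B and a=s and b=t]) (use f in auto)
  have dom: "integrable lborel (\<lambda>x. k (x - y) * g x)" if k: "k \<in> borel_measurable borel" "\<And>x. norm (k x) \<le> C" for k y and C :: real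
  proof (rule Bochner_Integration.integrable_bound[OF integrable_mult_right[OF integrable_norm[OF ig], of C]])
    show "AE x in lborel. norm (k (x - y) * g x) \<le> norm (C * norm (g x))"
      using k(2) by (intro AE_I2) (auto simp: norm_mult abs_mult intro!: mult_right_mono order_trans[OF k(2) abs_ge_self])
  qed (use k in auto)
  show ?thesis
    unfolding continuous_at_eps_delta
  proof (intro allI impI)
    fix e :: real assume e: "0 < e"
    \<comment> \<open>Two errors of at most B e' and one of e/3 are added; B + 1 in the denominator
      covers \<open>B = 0\<close>.\<close>
    define e' where "e' = e / (3 * (B + 1))"
    have e': "0 < e'" "B * e' < e / 3" using e B0 by (auto simp: e'_def field_simps)
    obtain R p where R: "0 < R" and ib: "integrable lborel (\<lambda>x. norm (bump R p 0 x) powr 1)"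
      and less: "(LINT x|lborel. norm (f x - bump R p 0 x) powr 1) < e'"
      using schwartz_dense[of 1 f e'] f(1) if1 e' by auto
    let ?b = "bump R p 0"
    define H where "H h y = (LINT x|lborel. h (x - y) * g x)" for h y
    have bm [measurable]: "?b \<in> borel_measurable borel" using R by simp
    obtain C where C: "0 \<le> C" "\<And>x. norm (?b x) \<le> C" using bump_bounded[OF R] by blast
    have diff: "integrable lborel (\<lambda>x. norm (f x - ?b x))"
      using Lq_add(1)[of 1 f lborel "\<lambda>x. - ?b x"] if1 ib by simp
    have 1: "norm (H f y - H ?b y) \<le> B * e'" for y
    proof -
      have "H f y - H ?b y = (LINT x|lborel. (f (x - y) - ?b (x - y)) * g x)"
        using dom[OF f(1,2)] dom[OF bm C(2)] by (simp add: H_def left_diff_distrib)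
      also have "norm \<dots> \<le> (LINT x|lborel. norm ((f (x - y) - ?b (x - y)) * g x))"
        by (rule integral_norm_bound)
      also have "\<dots> \<le> (LINT x|lborel. B * norm (f (-y + 1 * x) - ?b (-y + 1 * x)))"
      proof (rule integral_mono')
        show "integrable lborel (\<lambda>x. B * norm (f (-y + 1 * x) - ?b (-y + 1 * x)))"
          using lborel_integrable_real_affine[OF diff, of 1 "-y"] by (intro integrable_mult_right) simp
        show "norm ((f (x - y) - ?b (x - y)) * g x) \<le> B * norm (f (-y + 1 * x) - ?b (-y + 1 * x))" for x
          using g(2)[of x] by (simp add: norm_mult mult.commute mult_right_mono)
      qed (use B0 in auto)
      also have "\<dots> = B * (LINT x|lborel. norm (f x - ?b x))"
        by (subst lborel_integral_real_affine[of 1 "\<lambda>x. norm (f x - ?b x)" "-y"]) simp_all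
      also have "\<dots> \<le> B * e'" using less B0 by (intro mult_left_mono) auto
      finally show ?thesis .
    qed
    have "isCont (H ?b) y0"
      unfolding continuous_at_sequentially comp_def
    proof (intro allI impI)
      fix u :: "nat \<Rightarrow> real" assume u: "u \<longlonglongrightarrow> y0"
      show "(\<lambda>n. H ?b (u n)) \<longlonglongrightarrow> H ?b y0"
        unfolding H_def
      proof (rule integral_dominated_convergence[OF _ _ integrable_mult_right[OF integrable_norm[OF ig], of C]])
        have cb: "isCont ?b x" for x by (rule has_vector_derivative_continuous[OF has_vector_derivative_bump[OF R]])
        have "(\<lambda>n. x - u n) \<longlonglongrightarrow> x - y0" for x by (rule tendsto_diff[OF tendsto_const u])
        then have "(\<lambda>n. ?b (x - u n)) \<longlonglongrightarrow> ?b (x - y0)" for x by (rule isCont_tendsto_compose[OF cb])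
        then have "(\<lambda>n. ?b (x - u n) * g x) \<longlonglongrightarrow> ?b (x - y0) * g x" for x by (rule tendsto_mult[OF _ tendsto_const])
        then show "AE x in lborel. (\<lambda>n. ?b (x - u n) * g x) \<longlonglongrightarrow> ?b (x - y0) * g x" by simp
        show "AE x in lborel. norm (?b (x - u n) * g x) \<le> C * norm (g x)" for n
          using C by (auto simp: norm_mult intro!: mult_right_mono)
      qed simp_all
    qed
    then have *: "\<forall>e>0. \<exists>d>0. \<forall>y. dist y y0 < d \<longrightarrow> dist (H ?b y) (H ?b y0) < e"
      by (simp only: continuous_at_eps_delta)
    have "0 < e / 3" using e by simp
    then obtain d where d: "0 < d" "\<And>y. dist y y0 < d \<Longrightarrow> dist (H ?b y) (H ?b y0) < e / 3"
      using spec[OF *, of "e / 3"] by blast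
    have "dist (H f y) (H f y0) < e" if "dist y y0 < d" for y
    proof -
      have "H f y - H f y0 = (H f y - H ?b y) + (H ?b y - H ?b y0) - (H f y0 - H ?b y0)" by simp
      also have "norm \<dots> \<le> norm (H f y - H ?b y) + norm (H ?b y - H ?b y0) + norm (H f y0 - H ?b y0)"
        by (rule order_trans[OF norm_triangle_ineq4 add_right_mono[OF norm_triangle_ineq]])
      also have "\<dots> < e" using 1[of y] 1[of y0] d(2)[OF that, unfolded dist_norm] e'(2) by linarith
      finally show ?thesis unfolding dist_norm .
    qed
    then show "\<exists>d>0. \<forall>y. dist y y0 < d \<longrightarrow> dist (LINT x|lborel. f (x - y) * g x) (LINT x|lborel. f (x - y0) * g x) < e"
      unfolding H_def using d(1) by blast
  qed
qed

subsection \<open>Fejer means\<close>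

text \<open>The integrand is dominated by a multiple of the tensor product |g x| |K y|. The factor
  \<open>m\<close> will be a translate f(x - y) of a bounded function, or a character in x - y or in
  a frequency.\<close>

lemma fubini_bounded:
  fixes K g :: "real \<Rightarrow> complex" and m :: "real \<Rightarrow> real \<Rightarrow> complex"
  assumes K: "integrable lborel K" and g: "integrable lborel g"
    and m [measurable]: "(\<lambda>(x, y). m x y) \<in> borel_measurable (lborel \<Otimes>\<^sub>M lborel)" and C: "\<And>x y. norm (m x y) \<le> C"
  shows "integrable (lborel \<Otimes>\<^sub>M lborel) (\<lambda>(x, y). g x * K y * m x y)"
    and "(LINT x|lborel. LINT y|lborel. g x * K y * m x y) = (LINT y|lborel. LINT x|lborel. g x * K y * m x y)"
proof -
  have [measurable]: "K \<in> borel_measurable borel" "g \<in> borel_measurable borel"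
    using K g by (auto dest: borel_measurable_integrable)
  have 1: "integrable (lborel \<Otimes>\<^sub>M lborel) (\<lambda>(x, y). g x * K y)"
  proof (rule lborel_pair.Fubini_integrable)
    have "(\<lambda>x. LINT y|lborel. norm (case (x, y) of (x, y) \<Rightarrow> g x * K y)) = (\<lambda>x. norm (g x) * (LINT y|lborel. norm (K y)))"
      by (simp add: norm_mult)
    then show "integrable lborel (\<lambda>x. LINT y|lborel. norm (case (x, y) of (x, y) \<Rightarrow> g x * K y))"
      using g by (simp add: integrable_mult_left)
    show "AE x in lborel. integrable lborel (\<lambda>y. case (x, y) of (x, y) \<Rightarrow> g x * K y)"
      using K by (simp add: integrable_mult_right)
  qed measurable
  have C0: "0 \<le> C" using order_trans[OF norm_ge_zero C] .
  show *: "integrable (lborel \<Otimes>\<^sub>M lborel) (\<lambda>(x, y). g x * K y * m x y)"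
  proof (rule Bochner_Integration.integrable_bound[OF integrable_mult_right[OF 1, of "of_real C"]])
    show "AE z in lborel \<Otimes>\<^sub>M lborel. norm (case z of (x, y) \<Rightarrow> g x * K y * m x y) \<le> norm (of_real C * (case z of (x, y) \<Rightarrow> g x * K y))"
    proof (rule AE_I2)
      fix z :: "real \<times> real"
      have "norm (g (fst z) * K (snd z)) * norm (m (fst z) (snd z)) \<le> norm (g (fst z) * K (snd z)) * C"
        by (intro mult_left_mono C) auto
      then show "norm (case z of (x, y) \<Rightarrow> g x * K y * m x y) \<le> norm (of_real C * (case z of (x, y) \<Rightarrow> g x * K y))"
        using C0 by (simp add: case_prod_beta norm_mult mult_ac)
    qed
  qed measurable
  show "(LINT x|lborel. LINT y|lborel. g x * K y * m x y) = (LINT y|lborel. LINT x|lborel. g x * K y * m x y)"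
    by (rule lborel_pair.Fubini_integral[symmetric]) (rule *)
qed

text \<open>The Fejer kernel as a square over the frequencies 0, ..., N - 1: nonnegativity is
  immediate and its integral is read off from Parseval. For \<open>N = 0\<close> division by zero
  makes it 0.\<close>

definition fejer :: "nat \<Rightarrow> real \<Rightarrow> real" where
  "fejer N t = (norm (trig_poly (int ` {..<N}) (\<lambda>_. 1) t))\<^sup>2 / N"

lemma fejer_nonneg: "0 \<le> fejer N t"
  by (simp add: fejer_def)

lemma borel_measurable_fejer [measurable (raw)]:
  "g \<in> borel_measurable M \<Longrightarrow> (\<lambda>x. fejer N (g x)) \<in> borel_measurable M"
  unfolding fejer_def
  by (rule borel_measurable_divide[OF borel_measurable_power[OF measurable_compose[OF borel_measurable_trig_poly borel_measurable_continuous_onI[OF continuous_on_norm_id]]] borel_measurable_const])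

lemma continuous_on_fejer [continuous_intros]:
  "continuous_on X g \<Longrightarrow> continuous_on X (\<lambda>x. fejer N (g x))"
  unfolding fejer_def divide_inverse by (intro continuous_intros)

lemma wave_of_int_power: "wave (of_int (int j)) t = wave 1 t ^ j"
  by (induction j) (simp_all add: wave_add_left)

text \<open>The geometric sum: (w - 1)(1 + w + ... + w^(N-1)) = w^N - 1 has modulus at most 2 when
  |w| = 1. The kernel is therefore of order 1/N wherever the character stays away from 1.\<close>

lemma fejer_decay: "fejer N t * (norm (wave 1 t - 1))\<^sup>2 \<le> 4 / N"
proof -
  have "trig_poly (int ` {..<N}) (\<lambda>_. 1) t = (\<Sum>j<N. wave 1 t ^ j)"
    unfolding trig_poly_def by (subst sum.reindex) (auto simp: wave_of_int_power simp del: of_int_of_nat_eq)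
  then have "(wave 1 t - 1) * trig_poly (int ` {..<N}) (\<lambda>_. 1) t = wave 1 t ^ N - 1"
    using power_diff_1_eq[of "wave 1 t" N] by simp
  then have "norm (wave 1 t - 1) * norm (trig_poly (int ` {..<N}) (\<lambda>_. 1) t) = norm (wave 1 t ^ N - 1)"
    by (metis norm_mult)
  also have "\<dots> \<le> 2" using norm_triangle_ineq4[of "wave 1 t ^ N" 1] by (simp add: norm_power)
  finally have "(norm (wave 1 t - 1) * norm (trig_poly (int ` {..<N}) (\<lambda>_. 1) t))\<^sup>2 \<le> 2\<^sup>2"
    by (intro power_mono) auto
  then show ?thesis by (simp add: fejer_def power_mult_distrib mult.commute divide_right_mono)
qed

text \<open>A translation by \<open>u\<close> multiplies the coefficients by numbers of modulus 1,
  so Parseval gives N/N.\<close>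

lemma fejer_integral:
  assumes "0 < N"
  shows "(LINT y|lborel. indicator {0..1} y * fejer N (y - u)) = 1"
proof -
  have "trig_poly (int ` {..<N}) (\<lambda>_. 1) (y - u) = trig_poly (int ` {..<N}) (\<lambda>k. wave (- of_int k) u) y" for y
    by (simp add: trig_poly_def wave_diff_right mult.commute)
  then have "(LINT y|lborel. indicator {0..1} y * fejer N (y - u)) =
     (LINT y|lborel. (indicator {0..0+1} y * (norm (trig_poly (int ` {..<N}) (\<lambda>k. wave (- of_int k) u) y))\<^sup>2) / N)"
    by (simp add: fejer_def)
  also have "\<dots> = (\<Sum>k\<in>int ` {..<N}. (norm (wave (- of_int k) u))\<^sup>2) / N"
    by (subst parseval_trig_poly[symmetric, where s=0]) auto
  also have "\<dots> = 1" using assms by (simp add: card_image)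
  finally show ?thesis .
qed

lemma integrable_unit_interval:
  fixes h :: "real \<Rightarrow> real"
  shows "continuous_on {0..1} h \<Longrightarrow> integrable lborel (\<lambda>y. indicator {0..1} y * h y)"
  using borel_integrable_compact[of "{0..1::real}" h] by simp

lemma wave_1_eq_1:
  assumes "wave 1 t = 1" "\<bar>t\<bar> < 1"
  shows "t = 0"
proof -
  have "cos (2 * pi * t) = 1" using assms(1) by (simp add: wave_def complex_eq_iff)
  then obtain n :: int where "2 * pi * t = real_of_int n * 2 * pi" unfolding cos_one_2pi_int by blast
  then have t: "t = n" by simp
  then have "n = 0" using assms(2) by linarith
  then show ?thesis using t by simp
qed

text \<open>Continuity at \<open>u\<close> gives |b y - b u| <= e + C |w - 1|^2 on [0, 1], with w
  the character at y - u. Integrated against the kernel, the first term gives e and the second at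
  most 4C/N by \<open>fejer_decay\<close>. Since \<open>u\<close> is in the middle half, y - u stays
  in [-3/4, 3/4], where w = 1 only at 0.\<close>

lemma fejer_tendsto:
  fixes b :: "real \<Rightarrow> complex"
  assumes u: "1/4 \<le> u" "u \<le> 3/4" and bm [measurable]: "b \<in> borel_measurable borel" and cont: "isCont b u"
    and M: "\<And>y. norm (b y) \<le> M" and supp: "\<And>y. y \<notin> {0..1} \<Longrightarrow> b y = 0"
  shows "(\<lambda>N. LINT y|lborel. of_real (fejer N (y - u)) * b y) \<longlonglongrightarrow> b u"
proof -
  have M0: "0 \<le> M" using order_trans[OF norm_ge_zero M] .
  let ?I = "indicator {0..1} :: real \<Rightarrow> real"
  have key: "\<exists>C\<ge>0. \<forall>y\<in>{0..1}. norm (b y - b u) \<le> e + C * (norm (wave 1 (y - u) - 1))\<^sup>2" if e: "0 < e" for e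
  proof -
    have "\<exists>d>0. \<forall>y. dist y u < d \<longrightarrow> dist (b y) (b u) < e"
      using cont e unfolding continuous_at_eps_delta by blast
    then obtain d where d: "0 < d" "\<And>y. dist y u < d \<Longrightarrow> dist (b y) (b u) < e" by blast
    \<comment> \<open>The differences bounded away from 0. On this compact set |w - 1| has a
      positive minimum; the cap 1/8 on the radius keeps 3/4 in the set, so that a minimum
      exists.\<close>
    define T where "T = {-(3/4)..3/4} - {-(min d (1/8))<..<min d (1/8)}"
    have T: "compact T" unfolding T_def by (intro compact_diff) auto
    have "3/4 \<in> T" by (auto simp: T_def)
    have cT: "continuous_on T (\<lambda>t. norm (wave 1 t - 1))" by (intro continuous_intros)
    from \<open>3/4 \<in> T\<close> obtain t0 where t0: "t0 \<in> T" "\<And>t. t \<in> T \<Longrightarrow> norm (wave 1 t0 - 1) \<le> norm (wave 1 t - 1)"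
      using continuous_attains_inf[OF T _ cT] by blast
    define c where "c = norm (wave 1 t0 - 1)"
    have "t0 \<noteq> 0" "\<bar>t0\<bar> < 1" using t0(1) d(1) by (auto simp: T_def)
    then have c: "0 < c" using wave_1_eq_1[of t0] by (auto simp: c_def)
    have "norm (b y - b u) \<le> e + 2 * M / c\<^sup>2 * (norm (wave 1 (y - u) - 1))\<^sup>2" if y: "y \<in> {0..1}" for y
    proof (cases "dist y u < d")
      case True
      then have "norm (b y - b u) \<le> e" using d(2)[of y] by (simp add: dist_norm)
      moreover have "0 \<le> 2 * M / c\<^sup>2 * (norm (wave 1 (y - u) - 1))\<^sup>2" using M0 by simp
      ultimately show ?thesis by linarith
    next
      case False
      then have "y - u \<in> T" using u y by (auto simp: T_def dist_real_def abs_if split: if_splits)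
      then have "c\<^sup>2 \<le> (norm (wave 1 (y - u) - 1))\<^sup>2" using t0(2) c by (intro power_mono) (auto simp: c_def)
      then have "2 * M / c\<^sup>2 * c\<^sup>2 \<le> 2 * M / c\<^sup>2 * (norm (wave 1 (y - u) - 1))\<^sup>2"
        using M0 by (intro mult_left_mono) auto
      moreover have "norm (b y - b u) \<le> 2 * M"
        using norm_triangle_ineq4[of "b y" "b u"] M[of y] M[of u] by linarith
      ultimately show ?thesis using c e by simp
    qed
    then show ?thesis using M0 by (intro exI[of _ "2 * M / c\<^sup>2"]) auto
  qed
  have ifj: "integrable lborel (\<lambda>y. ?I y * fejer N (y - u))" for N
    by (intro integrable_unit_interval continuous_intros)
  have ifw: "integrable lborel (\<lambda>y. ?I y * (fejer N (y - u) * (norm (wave 1 (y - u) - 1))\<^sup>2))" for N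
    by (intro integrable_unit_interval continuous_intros)
  have ifb: "integrable lborel (\<lambda>y. complex_of_real (?I y * fejer N (y - u)) * (b y - z))" if "norm z \<le> M" for N z
  proof (rule Bochner_Integration.integrable_bound[OF integrable_mult_right[OF ifj, of "2 * M"]])
    show "AE y in lborel. norm (complex_of_real (?I y * fejer N (y - u)) * (b y - z)) \<le> norm (2 * M * (?I y * fejer N (y - u)))"
    proof (rule AE_I2)
      fix y
      have "norm (b y - z) \<le> 2 * M" using norm_triangle_ineq4[of "b y" z] M[of y] that by linarith
      then have "(?I y * fejer N (y - u)) * norm (b y - z) \<le> (?I y * fejer N (y - u)) * (2 * M)"
        by (intro mult_left_mono) (auto simp: fejer_nonneg)
      then show "norm (complex_of_real (?I y * fejer N (y - u)) * (b y - z)) \<le> norm (2 * M * (?I y * fejer N (y - u)))"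
        using M0 fejer_nonneg[of N "y - u"] by (simp add: norm_mult mult_ac)
    qed
  qed measurable
  have le: "norm ((LINT y|lborel. of_real (fejer N (y - u)) * b y) - b u) \<le> e + C * (4 / N)"
    if N: "0 < N" and C: "0 \<le> C" "\<And>y. y \<in> {0..1} \<Longrightarrow> norm (b y - b u) \<le> e + C * (norm (wave 1 (y - u) - 1))\<^sup>2" and e: "0 < e"
    for N C e
  proof -
    have eq1: "(LINT y|lborel. of_real (fejer N (y - u)) * b y) = (LINT y|lborel. complex_of_real (?I y * fejer N (y - u)) * (b y - 0))"
    proof (rule Bochner_Integration.integral_cong[OF refl])
      fix y
      show "of_real (fejer N (y - u)) * b y = complex_of_real (?I y * fejer N (y - u)) * (b y - 0)"
        using supp[of y] by (cases "y \<in> {0..1}") simp_all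
    qed
    have eq2: "(LINT y|lborel. complex_of_real (?I y * fejer N (y - u)) * b u) = b u"
      by (simp only: Bochner_Integration.integral_mult_left_zero integral_complex_of_real fejer_integral[OF N] of_real_1 mult_1_left)
    have ifb0: "integrable lborel (\<lambda>y. complex_of_real (?I y * fejer N (y - u)) * (b y - 0))"
      by (rule ifb) (use M0 in simp)
    have i3: "integrable lborel (\<lambda>y. complex_of_real (?I y * fejer N (y - u)) * b u)"
      by (intro integrable_mult_left integrable_of_real ifj)
    have "(LINT y|lborel. of_real (fejer N (y - u)) * b y) - b u = (LINT y|lborel. complex_of_real (?I y * fejer N (y - u)) * (b y - 0) - complex_of_real (?I y * fejer N (y - u)) * b u)"
      unfolding eq1 Bochner_Integration.integral_diff[OF ifb0 i3] eq2 ..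
    also have "\<dots> = (LINT y|lborel. complex_of_real (?I y * fejer N (y - u)) * (b y - b u))"
      by (simp only: right_diff_distrib diff_zero mult_zero_right)
    finally have e1: "(LINT y|lborel. of_real (fejer N (y - u)) * b y) - b u = (LINT y|lborel. complex_of_real (?I y * fejer N (y - u)) * (b y - b u))" .
    have e2: "norm (LINT y|lborel. complex_of_real (?I y * fejer N (y - u)) * (b y - b u)) \<le> (LINT y|lborel. e * (?I y * fejer N (y - u)) + C * (?I y * (fejer N (y - u) * (norm (wave 1 (y - u) - 1))\<^sup>2)))"
    proof (rule order_trans[OF integral_norm_bound integral_mono])
      show "integrable lborel (\<lambda>y. norm (complex_of_real (?I y * fejer N (y - u)) * (b y - b u)))"
        by (intro integrable_norm ifb M)
      show "integrable lborel (\<lambda>y. e * (?I y * fejer N (y - u)) + C * (?I y * (fejer N (y - u) * (norm (wave 1 (y - u) - 1))\<^sup>2)))"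
        by (intro Bochner_Integration.integrable_add integrable_mult_right ifj ifw)
      fix y
      show "norm (complex_of_real (?I y * fejer N (y - u)) * (b y - b u)) \<le> e * (?I y * fejer N (y - u)) + C * (?I y * (fejer N (y - u) * (norm (wave 1 (y - u) - 1))\<^sup>2))"
      proof (cases "y \<in> {0..1}")
        case True
        have "norm (complex_of_real (?I y * fejer N (y - u)) * (b y - b u)) = \<bar>?I y * fejer N (y - u)\<bar> * norm (b y - b u)"
          by (simp only: norm_mult norm_of_real)
        also have "\<dots> = fejer N (y - u) * norm (b y - b u)"
          using True fejer_nonneg[of N "y - u"] by simp
        also have "\<dots> \<le> fejer N (y - u) * (e + C * (norm (wave 1 (y - u) - 1))\<^sup>2)"
          by (intro mult_left_mono C True fejer_nonneg)
        also have "\<dots> = e * (1 * fejer N (y - u)) + C * (1 * (fejer N (y - u) * (norm (wave 1 (y - u) - 1))\<^sup>2))"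
          by algebra
        finally have *: "norm (complex_of_real (?I y * fejer N (y - u)) * (b y - b u)) \<le> \<dots>" .
        have I1: "?I y = 1" using True by simp
        show ?thesis using * unfolding I1 .
      qed auto
    qed
    have e3: "(LINT y|lborel. e * (?I y * fejer N (y - u)) + C * (?I y * (fejer N (y - u) * (norm (wave 1 (y - u) - 1))\<^sup>2))) = e + C * (LINT y|lborel. ?I y * (fejer N (y - u) * (norm (wave 1 (y - u) - 1))\<^sup>2))"
    proof -
      have "(LINT y|lborel. e * (?I y * fejer N (y - u)) + C * (?I y * (fejer N (y - u) * (norm (wave 1 (y - u) - 1))\<^sup>2))) =
        (LINT y|lborel. e * (?I y * fejer N (y - u))) + (LINT y|lborel. C * (?I y * (fejer N (y - u) * (norm (wave 1 (y - u) - 1))\<^sup>2)))"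
        by (rule Bochner_Integration.integral_add) (rule integrable_mult_right[OF ifj], rule integrable_mult_right[OF ifw])
      moreover have "(LINT y|lborel. e * (?I y * fejer N (y - u))) = e * 1"
        by (subst Bochner_Integration.integral_mult_right_zero) (simp only: fejer_integral[OF N, of u])
      moreover have "(LINT y|lborel. C * (?I y * (fejer N (y - u) * (norm (wave 1 (y - u) - 1))\<^sup>2))) =
        C * (LINT y|lborel. ?I y * (fejer N (y - u) * (norm (wave 1 (y - u) - 1))\<^sup>2))"
        by (rule Bochner_Integration.integral_mult_right_zero)
      ultimately show ?thesis by linarith
    qed
    have fin: "norm ((LINT y|lborel. of_real (fejer N (y - u)) * b y) - b u) \<le> e + C * (LINT y|lborel. ?I y * (fejer N (y - u) * (norm (wave 1 (y - u) - 1))\<^sup>2))"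
      using e2 unfolding e1 e3 .
    have "(LINT y|lborel. ?I y * (fejer N (y - u) * (norm (wave 1 (y - u) - 1))\<^sup>2)) \<le> (LINT y|lborel. (4 / N) * indicator {0..1::real} y)"
    proof (rule integral_mono[OF ifw integrable_indicator_const])
      fix y
      show "?I y * (fejer N (y - u) * (norm (wave 1 (y - u) - 1))\<^sup>2) \<le> (4 / N) * ?I y"
        using fejer_decay[of N "y - u"] by (cases "y \<in> {0..1}") simp_all
    qed
    moreover have "(LINT y|lborel. (4 / N) * indicator {0..1::real} y) = 4 / N" by simp
    ultimately have "(LINT y|lborel. ?I y * (fejer N (y - u) * (norm (wave 1 (y - u) - 1))\<^sup>2)) \<le> 4 / N" by (simp only:)
    then have "C * (LINT y|lborel. ?I y * (fejer N (y - u) * (norm (wave 1 (y - u) - 1))\<^sup>2)) \<le> C * (4 / N)"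
      by (rule mult_left_mono[OF _ C(1)])
    with fin show ?thesis by linarith
  qed
  show ?thesis
  proof (rule LIMSEQ_I)
    fix r :: real assume r: "0 < r"
    obtain C where C: "0 \<le> C" "\<And>y. y \<in> {0..1} \<Longrightarrow> norm (b y - b u) \<le> r / 2 + C * (norm (wave 1 (y - u) - 1))\<^sup>2"
      using key[of "r / 2"] r by auto
    have "(\<lambda>N. r / 2 + C * (4 / real N)) \<longlonglongrightarrow> r / 2 + C * 0"
      by (rule tendsto_add[OF tendsto_const tendsto_mult[OF tendsto_const lim_const_over_n]])
    then have "\<forall>\<^sub>F N in sequentially. r / 2 + C * (4 / real N) < r"
      by (rule order_tendstoD(2)) (use r in simp)
    then have "\<forall>\<^sub>F N in sequentially. norm ((LINT y|lborel. of_real (fejer N (y - u)) * b y) - b u) < r"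
      using eventually_gt_at_top[of 0]
    proof eventually_elim
      case (elim N)
      have "0 < r / 2" using r by simp
      then have "norm ((LINT y|lborel. of_real (fejer N (y - u)) * b y) - b u) \<le> r / 2 + C * (4 / N)"
        by (intro le[OF elim(2)] C)
      with elim(1) show ?case by linarith
    qed
    then show "\<exists>no. \<forall>n\<ge>no. norm ((LINT y|lborel. of_real (fejer n (y - u)) * b y) - b u) < r"
      by (simp add: eventually_sequentially)
  qed
qed

definition fcoef :: "(real \<Rightarrow> complex) \<Rightarrow> int \<Rightarrow> complex" where
  "fcoef S k = (LINT u|lborel. S u * wave (- of_int k) u)"

text \<open>For N > 0 this is max 0 (1 - |k|/N). The counting form is what appears when the square
  of the Dirichlet sum is grouped by differences of frequencies; afterwards only the bounds 0 and 1
  matter.\<close>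

definition fejer_weight :: "nat \<Rightarrow> int \<Rightarrow> real" where
  "fejer_weight N k = real (card {(i, j). i < N \<and> j < N \<and> int i - int j = k}) / N"

lemma fejer_weight_bounds: "0 \<le> fejer_weight N k" "fejer_weight N k \<le> 1"
proof -
  have "{(i, j). i < N \<and> j < N \<and> int i - int j = k} \<subseteq> (\<lambda>j. (nat (k + int j), j)) ` {..<N}"
    by (auto simp: image_iff)
  then have "card {(i, j). i < N \<and> j < N \<and> int i - int j = k} \<le> N"
    using surj_card_le[of "{..<N}" "{(i, j). i < N \<and> j < N \<and> int i - int j = k}"] by simp
  then show "fejer_weight N k \<le> 1" by (simp add: fejer_weight_def divide_le_eq)
qed (simp add: fejer_weight_def)

lemma fejer_eq_trig_poly:
  "complex_of_real (fejer N t) = trig_poly {- int N..int N} (\<lambda>k. of_real (fejer_weight N k)) t"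
proof -
  let ?D = "trig_poly (int ` {..<N}) (\<lambda>_. 1) t"
  have D: "?D = (\<Sum>i<N. wave (of_int (int i)) t)"
    unfolding trig_poly_def by (subst sum.reindex) auto
  have "complex_of_real ((norm ?D)\<^sup>2) = ?D * cnj ?D" by (rule complex_norm_square)
  also have "\<dots> = (\<Sum>i<N. \<Sum>j<N. wave (of_int (int i - int j)) t)"
    unfolding D cnj_sum sum_product by (simp add: cnj_wave wave_diff_left)
  also have "\<dots> = (\<Sum>z\<in>{..<N} \<times> {..<N}. wave (of_int (int (fst z) - int (snd z))) t)"
    by (simp add: sum.cartesian_product case_prod_beta)
  also have "\<dots> = (\<Sum>k\<in>{- int N..int N}. \<Sum>z\<in>{z \<in> {..<N} \<times> {..<N}. int (fst z) - int (snd z) = k}. wave (of_int (int (fst z) - int (snd z))) t)"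
    by (rule sum.group[symmetric]) auto
  also have "\<dots> = (\<Sum>k\<in>{- int N..int N}. of_nat (card {(i, j). i < N \<and> j < N \<and> int i - int j = k}) * wave (of_int k) t)"
  proof (rule sum.cong[OF refl])
    fix k
    have "{z \<in> {..<N} \<times> {..<N}. int (fst z) - int (snd z) = k} = {(i, j). i < N \<and> j < N \<and> int i - int j = k}" by auto
    moreover have "(\<Sum>z\<in>{z \<in> {..<N} \<times> {..<N}. int (fst z) - int (snd z) = k}. wave (of_int (int (fst z) - int (snd z))) t) =
      (\<Sum>z\<in>{z \<in> {..<N} \<times> {..<N}. int (fst z) - int (snd z) = k}. wave (of_int k) t)"
      by (rule sum.cong) auto
    ultimately show "(\<Sum>z\<in>{z \<in> {..<N} \<times> {..<N}. int (fst z) - int (snd z) = k}. wave (of_int (int (fst z) - int (snd z))) t) =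
      of_nat (card {(i, j). i < N \<and> j < N \<and> int i - int j = k}) * wave (of_int k) t"
      by simp
  qed
  finally show ?thesis
    by (simp add: fejer_def trig_poly_def fejer_weight_def sum_divide_distrib)
qed

lemma isCont_trig_poly: "isCont (trig_poly A a) x"
  using continuous_on_trig_poly[OF continuous_on_id, of UNIV A a]
  by (simp add: continuous_on_eq_continuous_at)

text \<open>An interval of length 1/8 shifted by the kernel support [1/4, 3/4] lands in
  [s + 1/4, s + 7/8]. Both supports lie in [s, s + 1] and all differences x - u in [1/8, 7/8],
  strictly inside one period.\<close>

locale test_pair =
  fixes s B :: real and f g :: "real \<Rightarrow> complex"
  assumes f: "f \<in> borel_measurable borel" "\<And>x. norm (f x) \<le> B" "\<And>x. x \<notin> {s..s+1/8} \<Longrightarrow> f x = 0"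
    and g: "g \<in> borel_measurable borel" "\<And>x. norm (g x) \<le> B" "\<And>x. x \<notin> {s+1/4..s+7/8} \<Longrightarrow> g x = 0"
begin

text \<open>The correlation through which every kernel acts: by Fubini, pairing \<open>g\<close>
  with the convolution of \<open>K\<close> and \<open>f\<close> is integrating \<open>K\<close>
  against \<open>H\<close>.\<close>

definition H :: "real \<Rightarrow> complex" where
  "H y = (LINT x|lborel. f (x - y) * g x)"

lemma integrable_f: "integrable lborel f" and integrable_g: "integrable lborel g"
  by (rule integrable_bounded_support[OF f], assumption, rule integrable_bounded_support[OF g], assumption)

lemma support_diff: "f u \<noteq> 0 \<Longrightarrow> g x \<noteq> 0 \<Longrightarrow> x - u \<in> {1/8..7/8}"
proof -
  assume "f u \<noteq> 0" "g x \<noteq> 0"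
  then have "u \<in> {s..s+1/8}" "x \<in> {s+1/4..s+7/8}" using f(3)[of u] g(3)[of x] by blast+
  then show ?thesis by simp
qed

lemma isCont_H: "isCont H y"
proof -
  have "H = (\<lambda>y. LINT x|lborel. f (x - y) * g x)" by (simp add: H_def[abs_def])
  moreover have "isCont (\<lambda>y. LINT x|lborel. f (x - y) * g x) y"
    by (rule continuous_correlation[OF f g], assumption+)
  ultimately show ?thesis by (simp only:)
qed

lemma H_support: "y \<notin> {1/8..7/8} \<Longrightarrow> H y = 0"
proof -
  assume y: "y \<notin> {1/8..7/8}"
  have "f (x - y) * g x = 0" for x using support_diff[of "x - y" x] y by auto
  then have "H y = (LINT x|(lborel :: real measure). 0)" unfolding H_def by (intro Bochner_Integration.integral_cong refl)
  then show ?thesis by simp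
qed

lemma H_measurable [measurable]: "H \<in> borel_measurable borel"
  by (rule borel_measurable_continuous_onI, rule continuous_at_imp_continuous_on, rule ballI, rule isCont_H)

lemma kernel_measurable [measurable]: "(\<lambda>(x, y). f (x - y)) \<in> borel_measurable (lborel \<Otimes>\<^sub>M lborel)"
  using f(1) by measurable

lemma integral_mult_H:
  assumes K: "integrable lborel K"
  shows "(LINT x|lborel. g x * (LINT y|lborel. K y * f (x - y))) = (LINT y|lborel. K y * H y)"
proof -
  have "(LINT x|lborel. g x * (LINT y|lborel. K y * f (x - y))) = (LINT x|lborel. LINT y|lborel. g x * K y * f (x - y))"
    by (simp add: mult.assoc)
  also have "\<dots> = (LINT y|lborel. LINT x|lborel. g x * K y * f (x - y))"
    by (rule fubini_bounded(2)[OF K integrable_g kernel_measurable f(2)])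
  also have "\<dots> = (LINT y|lborel. LINT x|lborel. K y * (f (x - y) * g x))"
    by (simp only: mult_ac)
  finally show ?thesis by (simp add: H_def)
qed

text \<open>Since \<open>H\<close> lives in [1/8, 7/8], the periodic product kernel may be cut down
  to [0, 1] before Fubini is used and restored afterwards.\<close>

lemma Lam_eq_integral_H:
  assumes fin: "finite A" "finite F"
  shows "Lam A F a \<phi> f g = (LINT y|lborel. trig_poly A a y * (trig_poly F \<phi> y * H y))"
proof -
  define K where "K y = complex_of_real (indicator {0..1} y) * (trig_poly A a y * trig_poly F \<phi> y)" for y
  have K: "integrable lborel K"
  proof -
    have "continuous_on {0..1::real} (\<lambda>y. trig_poly A a y * trig_poly F \<phi> y)" by (intro continuous_intros)
    from borel_integrable_compact[OF compact_Icc this] show ?thesis by (simp add: K_def[abs_def] scaleR_conv_of_real)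
  qed
  have "(LINT u|lborel. trig_poly A a (x - u) * trig_poly F \<phi> (x - u) * (f u * g x)) = g x * (LINT y|lborel. K y * f (x - y))" for x
  proof -
    have "(LINT u|lborel. trig_poly A a (x - u) * trig_poly F \<phi> (x - u) * (f u * g x)) =
      (LINT y|lborel. trig_poly A a y * trig_poly F \<phi> y * (f (x - y) * g x))"
      by (subst lborel_integral_real_affine[of "-1" _ x]) simp_all
    also have "\<dots> = (LINT y|lborel. g x * (K y * f (x - y)))"
    proof (rule Bochner_Integration.integral_cong[OF refl])
      fix y
      show "trig_poly A a y * trig_poly F \<phi> y * (f (x - y) * g x) = g x * (K y * f (x - y))"
        using support_diff[of "x - y" x] by (cases "f (x - y) = 0 \<or> g x = 0") (auto simp: K_def)
    qed
    finally show ?thesis by simp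
  qed
  then have "Lam A F a \<phi> f g = (LINT y|lborel. K y * H y)"
    unfolding Lam_eq_iterated_integral(1)[OF fin integrable_f integrable_g] by (simp add: integral_mult_H[OF K])
  also have "\<dots> = (LINT y|lborel. trig_poly A a y * (trig_poly F \<phi> y * H y))"
  proof (rule Bochner_Integration.integral_cong[OF refl])
    fix y
    show "K y * H y = trig_poly A a y * (trig_poly F \<phi> y * H y)"
      using H_support[of y] by (cases "y \<in> {1/8..7/8}") (auto simp: K_def)
  qed
  finally show ?thesis .
qed

text \<open>The Fejer means are applied to h, the product of the polynomial of \<open>\<phi>\<close>
  with \<open>H\<close>: it is continuous and bounded, so they converge at each point of the support
  of \<open>S\<close> and stay below the bound of h. That gives the majorant M|S| for a merely
  integrable \<open>S\<close>. By symmetry of the kernel the means may be read as means of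
  \<open>S\<close>, to which the hypothesis on \<open>Lam\<close> applies.\<close>

lemma pairing_bound:
  assumes fin: "finite F" and S: "integrable lborel S" "\<And>u. u \<notin> {1/4..3/4} \<Longrightarrow> S u = 0"
    and p: "0 < p" and a: "\<And>A. finite A \<Longrightarrow> (\<Sum>k\<in>A. norm (fcoef S k) powr p) \<le> c"
    and le: "\<And>A a. finite A \<Longrightarrow> (\<Sum>k\<in>A. norm (a k) powr p) \<le> c \<Longrightarrow> norm (Lam A F a \<phi> f g) \<le> b"
  shows "norm (LINT u|lborel. S u * (trig_poly F \<phi> u * H u)) \<le> b"
proof -
  define h where "h u = trig_poly F \<phi> u * H u" for u
  have hm [measurable]: "h \<in> borel_measurable borel" unfolding h_def by measurable
  have hc: "isCont h u" for u
    unfolding h_def by (rule isCont_mult[OF isCont_trig_poly isCont_H])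
  have hs: "u \<notin> {0..1} \<Longrightarrow> h u = 0" for u using H_support[of u] by (auto simp: h_def)
  have "compact (h ` {0..1})" by (intro compact_continuous_image continuous_at_imp_continuous_on ballI hc compact_Icc)
  then obtain M where M': "\<And>u. u \<in> {0..1} \<Longrightarrow> norm (h u) \<le> M"
    by (meson bounded_iff compact_imp_bounded imageI)
  have M0: "0 \<le> M" using order_trans[OF norm_ge_zero M'[of 0]] by simp
  have M: "norm (h u) \<le> M" for u using M'[of u] hs[of u] M0 by (cases "u \<in> {0..1}") auto
  have ih: "integrable lborel h" by (rule integrable_bounded_support[OF hm M hs])
  have [measurable]: "S \<in> borel_measurable borel" using S(1) by (auto dest: borel_measurable_integrable)
  define \<sigma> where "\<sigma> N u = (LINT y|lborel. complex_of_real (fejer N (y - u)) * h y)" for N u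
  define d where "d k = (LINT y|lborel. wave (of_int k) y * h y)" for k :: int
  have ihw: "integrable lborel (\<lambda>y. c * (wave (of_int k) y * h y))" for k c
    using integrable_mult_right[OF integrable_mult_wave[OF ih, of "of_int k"], of c] by (simp only: mult.commute[of "h _"])
  have \<sigma>_eq: "\<sigma> N u = (\<Sum>k\<in>{-int N..int N}. of_real (fejer_weight N k) * wave (- of_int k) u * d k)" for N u
  proof -
    have "complex_of_real (fejer N (y - u)) * h y = (\<Sum>k\<in>{-int N..int N}. of_real (fejer_weight N k) * wave (- of_int k) u * (wave (of_int k) y * h y))" for y
      unfolding fejer_eq_trig_poly trig_poly_def sum_distrib_right
      by (intro sum.cong refl) (simp add: wave_diff_right mult_ac)
    then have "\<sigma> N u = (LINT y|lborel. (\<Sum>k\<in>{-int N..int N}. of_real (fejer_weight N k) * wave (- of_int k) u * (wave (of_int k) y * h y)))"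
      by (simp only: \<sigma>_def)
    also have "\<dots> = (\<Sum>k\<in>{-int N..int N}. LINT y|lborel. of_real (fejer_weight N k) * wave (- of_int k) u * (wave (of_int k) y * h y))"
      by (rule Bochner_Integration.integral_sum) (rule ihw)
    finally show ?thesis by (simp only: d_def Bochner_Integration.integral_mult_right_zero)
  qed
  have \<sigma>_le: "norm (\<sigma> N u) \<le> M" for N u
  proof (cases "N = 0")
    case True
    then show ?thesis using M0 by (simp add: \<sigma>_def fejer_def)
  next
    case False
    have ifj: "integrable lborel (\<lambda>y. M * (indicator {0..1} y * fejer N (y - u)))"
      by (intro integrable_mult_right integrable_unit_interval continuous_intros)
    have "norm (\<sigma> N u) \<le> (LINT y|lborel. norm (complex_of_real (fejer N (y - u)) * h y))"
      unfolding \<sigma>_def by (rule integral_norm_bound)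
    also have "\<dots> \<le> (LINT y|lborel. M * (indicator {0..1} y * fejer N (y - u)))"
    proof (rule integral_mono'[OF ifj])
      fix y
      have "fejer N (y - u) * norm (h y) \<le> fejer N (y - u) * M" by (intro mult_left_mono M fejer_nonneg)
      then show "norm (complex_of_real (fejer N (y - u)) * h y) \<le> M * (indicator {0..1} y * fejer N (y - u))"
        using hs[of y] fejer_nonneg[of N "y - u"] by (cases "y \<in> {0..1}") (auto simp: norm_mult mult.commute)
    qed (use M0 fejer_nonneg in auto)
    also have "\<dots> = M" using fejer_integral[of N u] False by simp
    finally show ?thesis .
  qed
  have [measurable]: "\<sigma> N \<in> borel_measurable borel" for N
    unfolding \<sigma>_eq[abs_def] by measurable
  have s_tend: "(\<lambda>N. LINT u|lborel. S u * \<sigma> N u) \<longlonglongrightarrow> (LINT u|lborel. S u * h u)"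
  proof (rule integral_dominated_convergence[OF _ _ integrable_mult_right[OF integrable_norm[OF S(1)], of M]])
    have "(\<lambda>N. S u * \<sigma> N u) \<longlonglongrightarrow> S u * h u" for u
    proof (cases "u \<in> {1/4..3/4}")
      case True
      then have "(\<lambda>N. \<sigma> N u) \<longlonglongrightarrow> h u"
        unfolding \<sigma>_def by (intro fejer_tendsto[OF _ _ hm hc M hs]) auto
      then show ?thesis by (intro tendsto_mult tendsto_const)
    next
      case False
      then show ?thesis by (simp add: S(2))
    qed
    then show "AE u in lborel. (\<lambda>N. S u * \<sigma> N u) \<longlonglongrightarrow> S u * h u" by simp
    have "norm (S u) * norm (\<sigma> N u) \<le> norm (S u) * M" for u N by (intro mult_left_mono \<sigma>_le) auto
    then show "AE u in lborel. norm (S u * \<sigma> N u) \<le> M * norm (S u)" for N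
      by (simp add: norm_mult mult.commute)
  qed measurable
  have s_le: "norm (LINT u|lborel. S u * \<sigma> N u) \<le> b" for N
  proof -
    let ?A = "{-int N..int N}" and ?w = "\<lambda>k. complex_of_real (fejer_weight N k)"
    have "S u * \<sigma> N u = (\<Sum>k\<in>?A. ?w k * d k * (S u * wave (- of_int k) u))" for u
      by (simp add: \<sigma>_eq sum_distrib_left mult_ac)
    moreover have iSw: "integrable lborel (\<lambda>u. ?w k * d k * (S u * wave (- of_int k) u))" for k
      by (rule integrable_mult_right[OF integrable_mult_wave[OF S(1)]])
    ultimately have "(LINT u|lborel. S u * \<sigma> N u) = (\<Sum>k\<in>?A. LINT u|lborel. ?w k * d k * (S u * wave (- of_int k) u))"
      using iSw by (simp only:) (rule Bochner_Integration.integral_sum, simp only:)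
    also have "\<dots> = (\<Sum>k\<in>?A. ?w k * d k * fcoef S k)"
      by (simp only: Bochner_Integration.integral_mult_right_zero fcoef_def)
    \<comment> \<open>The duality: the weight is regrouped from the coefficients of h to those of
      \<open>S\<close>, and a trigonometric polynomial in place of \<open>S\<close> appears. As the
      weights are in [0, 1], its coefficients obey the same bound.\<close>
    also have "\<dots> = (\<Sum>k\<in>?A. (?w k * fcoef S k) * d k)"
      by (simp only: mult_ac)
    also have "\<dots> = (\<Sum>k\<in>?A. LINT y|lborel. (?w k * fcoef S k) * (wave (of_int k) y * h y))"
      by (simp only: d_def Bochner_Integration.integral_mult_right_zero)
    also have "\<dots> = (LINT y|lborel. (\<Sum>k\<in>?A. (?w k * fcoef S k) * (wave (of_int k) y * h y)))"
      by (rule Bochner_Integration.integral_sum[symmetric]) (rule ihw)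
    also have "\<dots> = (LINT y|lborel. trig_poly ?A (\<lambda>k. ?w k * fcoef S k) y * (trig_poly F \<phi> y * H y))"
      by (simp add: trig_poly_def[of ?A] sum_distrib_right h_def mult.assoc)
    also have "\<dots> = Lam ?A F (\<lambda>k. ?w k * fcoef S k) \<phi> f g"
      by (rule Lam_eq_integral_H[symmetric]) (use fin in auto)
    also have "norm \<dots> \<le> b"
    proof (rule le)
      have "(\<Sum>k\<in>?A. norm (?w k * fcoef S k) powr p) \<le> (\<Sum>k\<in>?A. norm (fcoef S k) powr p)"
      proof (rule sum_mono)
        fix k
        have "norm (?w k * fcoef S k) \<le> 1 * norm (fcoef S k)"
          using fejer_weight_bounds[of N k] unfolding norm_mult norm_of_real by (intro mult_right_mono) auto
        then show "norm (?w k * fcoef S k) powr p \<le> norm (fcoef S k) powr p"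
          using p by (intro powr_mono2) auto
      qed
      then show "(\<Sum>k\<in>?A. norm (?w k * fcoef S k) powr p) \<le> c" using a[of ?A] by simp
    qed simp
    finally show ?thesis .
  qed
  have "norm (LINT u|lborel. S u * h u) \<le> b"
    by (rule tendsto_upperbound[OF tendsto_norm[OF s_tend]]) (use s_le in auto)
  then show ?thesis by (simp add: h_def)
qed

end

subsection \<open>Convolution with the kernel\<close>

definition conv :: "(real \<Rightarrow> complex) \<Rightarrow> (real \<Rightarrow> complex) \<Rightarrow> real \<Rightarrow> complex" where
  "conv K f x = (LINT y|lborel. K y * f (x - y))"

lemma conv_measurable [measurable]:
  assumes [measurable]: "K \<in> borel_measurable borel" "f \<in> borel_measurable borel"
  shows "conv K f \<in> borel_measurable borel"
  unfolding conv_def[abs_def] by measurable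

lemma integrable_conv_bounded:
  fixes K f :: "real \<Rightarrow> complex"
  assumes K: "integrable lborel K" and f [measurable]: "f \<in> borel_measurable borel" and B: "\<And>x. norm (f x) \<le> B"
  shows "integrable lborel (\<lambda>y. K y * f (x - y))"
proof (rule Bochner_Integration.integrable_bound[where f="\<lambda>y. of_real B * K y"])
  show "integrable lborel (\<lambda>y. of_real B * K y)" using K by simp
  have [measurable]: "K \<in> borel_measurable borel" using K by (auto dest: borel_measurable_integrable)
  show "(\<lambda>y. K y * f (x - y)) \<in> borel_measurable lborel" by measurable
  have "0 \<le> B" using order_trans[OF norm_ge_zero B] .
  then show "AE y in lborel. norm (K y * f (x - y)) \<le> norm (of_real B * K y)"
    using mult_right_mono[OF B norm_ge_zero[of "K _"]] by (intro AE_I2) (simp add: norm_mult mult.commute)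
qed

lemma norm_conv_le:
  assumes K: "integrable lborel K" and f: "f \<in> borel_measurable borel" "\<And>x. norm (f x) \<le> B"
  shows "norm (conv K f x) \<le> B * (LINT y|lborel. norm (K y))"
proof -
  have "norm (conv K f x) \<le> (LINT y|lborel. norm (K y * f (x - y)))"
    unfolding conv_def by (rule integral_norm_bound)
  moreover have "(LINT y|lborel. norm (K y * f (x - y))) \<le> (LINT y|lborel. B * norm (K y))"
  proof (rule integral_mono)
    show "integrable lborel (\<lambda>y. norm (K y * f (x - y)))" by (rule integrable_norm[OF integrable_conv_bounded[OF K f]])
    show "norm (K y * f (x - y)) \<le> B * norm (K y)" for y
      using mult_left_mono[OF f(2) norm_ge_zero[of "K y"]] by (simp add: norm_mult mult.commute)
  qed (use K in simp)
  ultimately show ?thesis by simp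
qed

lemma conv_support:
  assumes K: "\<And>y. y \<notin> {1/4..3/4} \<Longrightarrow> K y = 0" and f: "\<And>x. x \<notin> {s..s+1/8} \<Longrightarrow> f x = 0"
    and x: "x \<notin> {s+1/4..s+7/8}"
  shows "conv K f x = 0"
proof -
  have "K y * f (x - y) = 0" for y
  proof (cases "y \<in> {1/4..3/4}")
    case True
    then have "x - y \<notin> {s..s+1/8}" using x by auto
    then show ?thesis by (simp add: f)
  qed (simp add: K)
  then show ?thesis unfolding conv_def by (simp only:) simp
qed

text \<open>Turns a bound for every admissible \<gamma> into one by \<open>J\<close> itself. For z
  above c^q J the choice z^(1/q)/c is positive even when \<open>J = 0\<close>, and it makes the
  hypothesis yield exactly z.\<close>

lemma powr_le_if_scaled_le:
  fixes q I J c :: real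
  assumes q: "0 < q" and c: "0 < c" and J: "0 \<le> J"
    and le: "\<And>\<gamma>. 0 < \<gamma> \<Longrightarrow> J \<le> \<gamma> powr q \<Longrightarrow> I \<le> (c * \<gamma>) powr q"
  shows "I \<le> c powr q * J"
proof (rule dense_ge)
  fix z assume z: "c powr q * J < z"
  define \<gamma> where "\<gamma> = z powr (1 / q) / c"
  have z0: "0 < z" using z J c by (smt (verit) mult_nonneg_nonneg powr_ge_zero)
  then have \<gamma>: "0 < \<gamma>" using c by (simp add: \<gamma>_def)
  have e: "(c * \<gamma>) powr q = z" using c q z0 by (simp add: \<gamma>_def powr_powr)
  then have "c powr q * \<gamma> powr q = z" using c \<gamma> by (simp add: powr_mult)
  then have "c powr q * J < c powr q * \<gamma> powr q" using z by simp
  then have "J < \<gamma> powr q" using c by (simp add: mult_less_cancel_left_pos)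
  then show "I \<le> z" using le[OF \<gamma>] e by simp
qed

lemma trig_poly_kernel:
  assumes S: "integrable lborel S"
  shows "integrable lborel (\<lambda>y. S y * trig_poly F \<phi> y)"
proof (rule Bochner_Integration.integrable_bound[where f="\<lambda>y. of_real (\<Sum>n\<in>F. norm (\<phi> n)) * S y"])
  show "integrable lborel (\<lambda>y. of_real (\<Sum>n\<in>F. norm (\<phi> n)) * S y)" using S by simp
  have [measurable]: "S \<in> borel_measurable borel" using S by (auto dest: borel_measurable_integrable)
  show "(\<lambda>y. S y * trig_poly F \<phi> y) \<in> borel_measurable lborel" by measurable
  have "0 \<le> (\<Sum>n\<in>F. norm (\<phi> n))" by (simp add: sum_nonneg)
  then have "norm (S y * trig_poly F \<phi> y) \<le> norm (of_real (\<Sum>n\<in>F. norm (\<phi> n)) * S y)" for y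
    using mult_right_mono[OF norm_trig_poly_le[of F \<phi> y] norm_ge_zero[of "S y"]]
    unfolding norm_mult norm_of_real by (simp add: mult.commute)
  then show "AE y in lborel. norm (S y * trig_poly F \<phi> y) \<le> norm (of_real (\<Sum>n\<in>F. norm (\<phi> n)) * S y)"
    by simp
qed

text \<open>Test h, the convolution, against its own norming function. With I the integral of |h|^q
  the pairing equals I, while the interpolated estimate bounds it by \<alpha> \<beta> \<gamma>
  I^(1/q'); cancelling that power leaves I^(1/q) <= \<alpha> \<beta> \<gamma>.\<close>

lemma conv_local_bound:
  fixes p p' q :: real
  assumes p: "1 < p" and p': "1 / p + 1 / p' = 1" and adm: "admissible p q"
    and fin: "finite F" and S: "integrable lborel S" "\<And>u. u \<notin> {1/4..3/4} \<Longrightarrow> S u = 0"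
    and pos: "0 < \<alpha>" "0 < \<beta>"
    and a: "\<And>A. finite A \<Longrightarrow> (\<Sum>k\<in>A. norm (fcoef S k) powr p) \<le> \<alpha> powr p"
    and \<phi>: "(\<Sum>n\<in>F. norm (\<phi> n) powr p') \<le> \<beta> powr p'"
    and f: "f \<in> borel_measurable borel" "\<And>x. norm (f x) \<le> B" "\<And>x. x \<notin> {s..s+1/8} \<Longrightarrow> f x = 0"
  defines "K \<equiv> \<lambda>y. S y * trig_poly F \<phi> y"
  shows "integrable lborel (\<lambda>x. norm (conv K f x) powr q)"
    and "(LINT x|lborel. norm (conv K f x) powr q) \<le> (\<alpha> * \<beta>) powr q * (LINT x|lborel. norm (f x) powr q)"
proof -
  have q: "1 \<le> q" by (rule admissible_ge_1[OF p adm])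
  have iK: "integrable lborel K" unfolding K_def by (rule trig_poly_kernel[OF S(1)])
  have [measurable]: "K \<in> borel_measurable borel" using iK by (auto dest: borel_measurable_integrable)
  have K0: "y \<notin> {1/4..3/4} \<Longrightarrow> K y = 0" for y by (simp add: K_def S(2))
  define h where "h = conv K f"
  define B1 where "B1 = B * (LINT y|lborel. norm (K y))"
  have hm [measurable]: "h \<in> borel_measurable borel" unfolding h_def using f(1) by measurable
  have hB: "norm (h x) \<le> B1" for x unfolding h_def B1_def by (rule norm_conv_le[OF iK f(1,2)])
  have h0: "h x = 0" if "x \<notin> {s+1/4..s+7/8}" for x
    unfolding h_def by (rule conv_support[OF K0 f(3) that])
  have B1: "0 \<le> B1" using order_trans[OF norm_ge_zero hB] .
  show ih: "integrable lborel (\<lambda>x. norm (conv K f x) powr q)"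
    by (rule integrable_bounded_support[where B="B1 powr q" and a="s+1/4" and b="s+7/8"])
      (use hB h0 q f(1) in \<open>auto simp: h_def[symmetric] intro!: powr_mono2\<close>)
  \<comment> \<open>The norming function: g h = |h|^q and |g| = |h|^(q - 1). The exponent q - 2 may
    be negative, but the product stays bounded, and g keeps the support of h.\<close>
  define g where "g x = (if h x = 0 then 0 else cnj (h x) * of_real (norm (h x) powr (q - 2)))" for x
  have gm: "g \<in> borel_measurable borel" unfolding g_def[abs_def] by measurable
  have ng: "norm (g x) = (if h x = 0 then 0 else norm (h x) powr (q - 1))" for x
  proof (cases "h x = 0")
    case False
    then have "norm (h x) * norm (h x) powr (q - 2) = norm (h x) powr (1 + (q - 2))"
      unfolding powr_add by simp
    then show ?thesis using False by (simp add: g_def norm_mult)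
  qed (simp add: g_def)
  have gh: "g x * h x = of_real (norm (h x) powr q)" for x
  proof (cases "h x = 0")
    case False
    have "(norm (h x))\<^sup>2 = norm (h x) powr 2" using False by simp
    then have e: "norm (h x) powr (q - 2) * (norm (h x))\<^sup>2 = norm (h x) powr q"
      unfolding powr_add[symmetric] by (simp only: powr_add[symmetric]) simp
    have "g x * h x = of_real (norm (h x) powr (q - 2)) * (h x * cnj (h x))"
      using False by (simp add: g_def mult_ac)
    then show ?thesis unfolding complex_norm_square[symmetric] by (simp only: of_real_mult[symmetric] e)
  qed (simp add: g_def)
  define B2 where "B2 = max B (max 1 (B1 powr (q - 1)))"
  have gB: "norm (g x) \<le> max 1 (B1 powr (q - 1))" for x
    using hB[of x] q by (auto simp: ng le_max_iff_disj intro!: powr_mono2)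
  have g0: "g x = 0" if "x \<notin> {s+1/4..s+7/8}" for x using h0[OF that] by (simp add: g_def)
  interpret test_pair s B2 f g
  proof
    show "norm (f x) \<le> B2" for x using f(2)[of x] by (simp add: B2_def le_max_iff_disj)
    show "norm (g x) \<le> B2" for x using gB[of x] unfolding B2_def by (rule order_trans) simp
  qed (use f gm g0 in auto)
  define I where "I = (LINT x|lborel. norm (h x) powr q)"
  have I0: "0 \<le> I" by (simp add: I_def)
  have IH: "complex_of_real I = (LINT u|lborel. S u * (trig_poly F \<phi> u * H u))"
  proof -
    have hx: "(LINT y|lborel. K y * f (x - y)) = h x" for x by (simp only: h_def conv_def)
    have "complex_of_real I = (LINT x|lborel. complex_of_real (norm (h x) powr q))"
      by (simp only: I_def integral_complex_of_real)
    also have "\<dots> = (LINT x|lborel. g x * (LINT y|lborel. K y * f (x - y)))"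
      by (simp only: hx gh)
    also have "\<dots> = (LINT y|lborel. K y * H y)" by (rule integral_mult_H[OF iK])
    finally show ?thesis by (simp only: K_def mult.assoc)
  qed
  have "I \<le> ((\<alpha> * \<beta>) * \<gamma>) powr q" if \<gamma>: "0 < \<gamma>" "(LINT x|lborel. norm (f x) powr q) \<le> \<gamma> powr q" for \<gamma>
  proof (cases "q = 1")
    case True
    \<comment> \<open>The exponent 1 is admissible only for p = 2. Then g is 0 or of modulus 1, so
      \<open>Lam_bound_1\<close> applies.\<close>
    then have p2: "p = 2" using admissible_ge_1(2)[OF p adm] by auto
    then have p'2: "p' = 2" using p' by (simp add: field_simps)
    have "norm (LINT u|lborel. S u * (trig_poly F \<phi> u * H u)) \<le> \<alpha> * \<beta> * \<gamma>"
    proof (rule pairing_bound[OF fin S])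
      fix A :: "int set" and b :: "int \<Rightarrow> complex" assume A: "finite A" "(\<Sum>k\<in>A. norm (b k) powr 2) \<le> \<alpha> powr 2"
      show "norm (Lam A F b \<phi> f g) \<le> \<alpha> * \<beta> * \<gamma>"
      proof (rule Lam_bound_1[OF A(1) fin integrable_f integrable_g _ _ pos \<gamma>(1) A(2)])
        show "norm (g x) \<le> 1" for x using True hB[of x] by (simp add: ng)
        show "f u \<noteq> 0 \<Longrightarrow> g x \<noteq> 0 \<Longrightarrow> x - u \<in> {0..1}" for u x using support_diff[of u x] by auto
        show "(\<Sum>n\<in>F. norm (\<phi> n) powr 2) \<le> \<beta> powr 2" using \<phi> p'2 by simp
        show "(LINT x|lborel. norm (f x)) \<le> \<gamma>" using \<gamma> True by simp
      qed
    qed (use a p2 in auto)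
    then have "I \<le> \<alpha> * \<beta> * \<gamma>" unfolding IH[symmetric] using I0 by simp
    then show ?thesis using True pos \<gamma> by simp
  next
    case False
    then have q1: "1 < q" using q by simp
    define q' where "q' = q / (q - 1)"
    have qq': "1 / q + 1 / q' = 1" "0 < q'" using q1 by (auto simp: q'_def field_simps)
    show ?thesis
    proof (cases "I = 0")
      case True
      then show ?thesis by simp
    next
      case False
      then have I: "0 < I" using I0 by simp
      \<comment> \<open>The norm of g in the dual space, because (q - 1) q' = q. It is positive
        since I is, and can be cancelled below.\<close>
      define \<delta> where "\<delta> = I powr (1 / q')"
      have \<delta>: "0 < \<delta>" using I by (simp add: \<delta>_def)
      have "(q - 1) * q' = q" using q1 by (simp add: q'_def)
      then have gq: "norm (g x) powr q' = norm (h x) powr q" for x by (simp add: ng powr_powr)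
      have ngq: "(LINT x|lborel. norm (g x) powr q') \<le> \<delta> powr q'"
        using I qq' by (simp add: gq I_def[symmetric] \<delta>_def powr_powr)
      have "norm (LINT u|lborel. S u * (trig_poly F \<phi> u * H u)) \<le> \<alpha> * \<beta> * \<gamma> * \<delta>"
      proof (rule pairing_bound[OF fin S _ a])
        fix A :: "int set" and b :: "int \<Rightarrow> complex" assume A: "finite A" "(\<Sum>k\<in>A. norm (b k) powr p) \<le> \<alpha> powr p"
        show "norm (Lam A F b \<phi> f g) \<le> \<alpha> * \<beta> * \<gamma> * \<delta>"
        proof (rule Lam_bound[OF p p' adm q1 qq'(1) A(1) fin, of f B2 s g])
          show "x \<notin> {s..s+1} \<Longrightarrow> f x = 0" for x using f(3)[of x] by auto
          show "x \<notin> {s..s+1} \<Longrightarrow> g x = 0" for x using g0[of x] by auto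
          show "f u \<noteq> 0 \<Longrightarrow> g x \<noteq> 0 \<Longrightarrow> x - u \<in> {0..1}" for u x using support_diff[of u x] by auto
          show "norm (f x) \<le> B2" "norm (g x) \<le> B2" for x
            using test_pair_axioms unfolding test_pair_def by auto
        qed (use f(1) gm pos \<gamma> \<delta> A(2) \<phi> ngq in auto)
      qed (use p in auto)
      then have "I \<le> \<alpha> * \<beta> * \<gamma> * \<delta>" unfolding IH[symmetric] using I0 by simp
      moreover have "I = I powr (1 / q) * \<delta>"
        using I qq'(1) by (simp add: \<delta>_def flip: powr_add)
      ultimately have "I powr (1 / q) * \<delta> \<le> (\<alpha> * \<beta> * \<gamma>) * \<delta>" by simp
      then have "I powr (1 / q) \<le> \<alpha> * \<beta> * \<gamma>" using \<delta> by simp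
      then have "(I powr (1 / q)) powr q \<le> (\<alpha> * \<beta> * \<gamma>) powr q" using q by (intro powr_mono2) auto
      then show ?thesis using I q by (simp add: powr_powr)
    qed
  qed
  then have "I \<le> (\<alpha> * \<beta>) powr q * (LINT x|lborel. norm (f x) powr q)"
    using q pos by (intro powr_le_if_scaled_le) auto
  then show "(LINT x|lborel. norm (conv K f x) powr q) \<le> (\<alpha> * \<beta>) powr q * (LINT x|lborel. norm (f x) powr q)"
    by (simp only: I_def h_def)
qed

section \<open>Summation of the local estimates\<close>

lemma norm_sum_powr_le:
  fixes z :: "'a \<Rightarrow> complex"
  assumes T: "finite T" and card: "card {i \<in> T. z i \<noteq> 0} \<le> m" and q: "0 \<le> q"
  shows "norm (\<Sum>i\<in>T. z i) powr q \<le> real m powr q * (\<Sum>i\<in>T. norm (z i) powr q)"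
proof (cases "{i \<in> T. z i \<noteq> 0} = {}")
  case True
  then have "(\<Sum>i\<in>T. z i) = 0" by (intro sum.neutral) auto
  then show ?thesis by (simp add: sum_nonneg)
next
  case False
  let ?N = "{i \<in> T. z i \<noteq> 0}"
  have N: "finite ?N" using T by simp
  \<comment> \<open>At most \<open>m\<close> nonzero terms bound the sum by m M, and M^q is itself
    one of the terms on the right.\<close>
  define M where "M = Max ((\<lambda>i. norm (z i)) ` ?N)"
  have "M \<in> (\<lambda>i. norm (z i)) ` ?N" unfolding M_def using False N by (intro Max_in) auto
  then obtain j where j: "j \<in> T" "M = norm (z j)" by blast
  have le: "norm (z i) \<le> M" if "i \<in> ?N" for i unfolding M_def using that N by (intro Max_ge) auto
  have "(\<Sum>i\<in>T. z i) = (\<Sum>i\<in>?N. z i)" by (rule sum.mono_neutral_right) (use T in auto)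
  then have "norm (\<Sum>i\<in>T. z i) \<le> (\<Sum>i\<in>?N. norm (z i))" using norm_sum[of z ?N] by simp
  also have "\<dots> \<le> of_nat (card ?N) * M" by (rule sum_bounded_above[OF le])
  also have "\<dots> \<le> real m * M" using card j by (intro mult_right_mono) auto
  finally have "norm (\<Sum>i\<in>T. z i) powr q \<le> (real m * M) powr q" using q by (intro powr_mono2) auto
  also have "\<dots> = real m powr q * M powr q" using j by (simp add: powr_mult)
  also have "\<dots> \<le> real m powr q * (\<Sum>i\<in>T. norm (z i) powr q)"
    unfolding j(2) using T j(1) by (intro mult_left_mono member_le_sum) auto
  finally show ?thesis .
qed

lemma card_int_interval_le: "card {i::int. i \<in> T \<and> a \<le> real_of_int i \<and> real_of_int i \<le> a + 5} \<le> 6"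
proof -
  have "{i::int. i \<in> T \<and> a \<le> real_of_int i \<and> real_of_int i \<le> a + 5} \<subseteq> {\<lceil>a\<rceil>..\<lceil>a\<rceil> + 5}"
    by (auto simp: ceiling_le_iff) linarith
  then have "card {i::int. i \<in> T \<and> a \<le> real_of_int i \<and> real_of_int i \<le> a + 5} \<le> card {\<lceil>a\<rceil>..\<lceil>a\<rceil> + 5}"
    by (rule card_mono[rotated]) simp
  then show ?thesis by simp
qed

text \<open>A point x lies in the image interval [i/8 + 1/4, i/8 + 7/8] of the i-th slice exactly
  when 8x - 7 <= i <= 8x - 2, which leaves at most six integers. This overlap is the origin of the
  constant 6.\<close>

lemma conv_bounded_support_bound:
  fixes p p' q :: real
  assumes p: "1 < p" and p': "1 / p + 1 / p' = 1" and adm: "admissible p q"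
    and fin: "finite F" and S: "integrable lborel S" "\<And>u. u \<notin> {1/4..3/4} \<Longrightarrow> S u = 0"
    and pos: "0 < \<alpha>" "0 < \<beta>"
    and a: "\<And>A. finite A \<Longrightarrow> (\<Sum>k\<in>A. norm (fcoef S k) powr p) \<le> \<alpha> powr p"
    and \<phi>: "(\<Sum>n\<in>F. norm (\<phi> n) powr p') \<le> \<beta> powr p'"
    and f [measurable]: "f \<in> borel_measurable borel" and B: "\<And>x. norm (f x) \<le> B" and supp: "\<And>x. real j < \<bar>x\<bar> \<Longrightarrow> f x = 0"
  defines "K \<equiv> \<lambda>y. S y * trig_poly F \<phi> y"
  shows "integrable lborel (\<lambda>x. norm (conv K f x) powr q)"
    and "(LINT x|lborel. norm (conv K f x) powr q) \<le> (6 * (\<alpha> * \<beta>)) powr q * (LINT x|lborel. norm (f x) powr q)"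
proof -
  have q: "1 \<le> q" by (rule admissible_ge_1[OF p adm])
  have iK: "integrable lborel K" unfolding K_def by (rule trig_poly_kernel[OF S(1)])
  have [measurable]: "K \<in> borel_measurable borel" using iK by (auto dest: borel_measurable_integrable)
  have K0: "y \<notin> {1/4..3/4} \<Longrightarrow> K y = 0" for y by (simp add: K_def S(2))
  define T where "T = {- 8 * int j - 1..8 * int j + 1}"
  \<comment> \<open>Slicing by the floor makes the pieces disjoint, so that |f|^q is exactly the sum
    of the |fi i|^q and the local bounds add up without loss on the right.\<close>
  define fi where "fi i x = (if \<lfloor>8 * x\<rfloor> = i then f x else 0)" for i :: int and x
  have fim [measurable]: "fi i \<in> borel_measurable borel" for i
    unfolding fi_def[abs_def] by measurable
  have fiB: "norm (fi i x) \<le> B" for i x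
    using B[of x] order_trans[OF norm_ge_zero B[of x]] by (simp add: fi_def)
  have fi0: "fi i x = 0" if "x \<notin> {of_int i / 8..of_int i / 8 + 1/8}" for i x
  proof -
    have "\<lfloor>8 * x\<rfloor> \<noteq> i"
    proof
      assume "\<lfloor>8 * x\<rfloor> = i"
      then have "of_int i \<le> 8 * x" "8 * x < of_int i + 1" by linarith+
      then show False using that by auto
    qed
    then show ?thesis by (simp add: fi_def)
  qed
  have fT: "\<lfloor>8 * x\<rfloor> \<in> T" if "f x \<noteq> 0" for x
  proof -
    have "\<bar>x\<bar> \<le> real j" using supp[of x] that by (meson not_less)
    then have "- 8 * real j \<le> 8 * x" "8 * x \<le> 8 * real j" by auto
    then show ?thesis unfolding T_def by (simp add: le_floor_iff floor_le_iff)
  qed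
  have fsum: "f x = (\<Sum>i\<in>T. fi i x)" for x
    using fT[of x] unfolding fi_def T_def by (cases "f x = 0") auto
  have fsumq: "norm (f x) powr q = (\<Sum>i\<in>T. norm (fi i x) powr q)" for x
  proof -
    have "(\<Sum>i\<in>T. norm (fi i x) powr q) = (\<Sum>i\<in>T. if \<lfloor>8 * x\<rfloor> = i then norm (f x) powr q else 0)"
      by (intro sum.cong refl) (auto simp: fi_def)
    then show ?thesis using fT[of x] unfolding T_def by (cases "f x = 0") auto
  qed
  have loc: "integrable lborel (\<lambda>x. norm (conv K (fi i) x) powr q)"
    "(LINT x|lborel. norm (conv K (fi i) x) powr q) \<le> (\<alpha> * \<beta>) powr q * (LINT x|lborel. norm (fi i x) powr q)" for i
    unfolding K_def
    by (rule conv_local_bound(1)[OF p p' adm fin S pos a \<phi> fim fiB fi0], assumption+)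
      (rule conv_local_bound(2)[OF p p' adm fin S pos a \<phi> fim fiB fi0], assumption+)
  have csum: "conv K f x = (\<Sum>i\<in>T. conv K (fi i) x)" for x
  proof -
    have "conv K f x = (LINT y|lborel. (\<Sum>i\<in>T. K y * fi i (x - y)))"
      unfolding conv_def by (subst fsum) (simp only: sum_distrib_left)
    also have "\<dots> = (\<Sum>i\<in>T. conv K (fi i) x)"
      unfolding conv_def by (rule Bochner_Integration.integral_sum) (rule integrable_conv_bounded[OF iK fim fiB])
    finally show ?thesis .
  qed
  have card: "card {i \<in> T. conv K (fi i) x \<noteq> 0} \<le> 6" for x
  proof -
    have "{i \<in> T. conv K (fi i) x \<noteq> 0} \<subseteq> {i. i \<in> T \<and> 8 * x - 7 \<le> real_of_int i \<and> real_of_int i \<le> 8 * x - 7 + 5}"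
    proof
      fix i assume i: "i \<in> {i \<in> T. conv K (fi i) x \<noteq> 0}"
      then have "x \<in> {of_int i / 8 + 1/4..of_int i / 8 + 7/8}"
        using conv_support[where K=K and f="fi i" and s="of_int i / 8" and x=x, OF K0 fi0] by blast
      then show "i \<in> {i. i \<in> T \<and> 8 * x - 7 \<le> real_of_int i \<and> real_of_int i \<le> 8 * x - 7 + 5}" using i by auto
    qed
    then have "card {i \<in> T. conv K (fi i) x \<noteq> 0} \<le> card {i. i \<in> T \<and> 8 * x - 7 \<le> real_of_int i \<and> real_of_int i \<le> 8 * x - 7 + 5}"
      by (rule card_mono[rotated]) (rule finite_subset[of _ T], auto simp: T_def)
    then show ?thesis using card_int_interval_le[of T "8 * x - 7"] by linarith
  qed
  have pw: "norm (conv K f x) powr q \<le> 6 powr q * (\<Sum>i\<in>T. norm (conv K (fi i) x) powr q)" for x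
    unfolding csum using norm_sum_powr_le[OF _ card, of q x] q by (simp add: T_def)
  have isum: "integrable lborel (\<lambda>x. 6 powr q * (\<Sum>i\<in>T. norm (conv K (fi i) x) powr q))"
    by (rule integrable_mult_right, rule Bochner_Integration.integrable_sum, rule loc(1))
  show 1: "integrable lborel (\<lambda>x. norm (conv K f x) powr q)"
  proof (rule Bochner_Integration.integrable_bound[OF isum])
    show "AE x in lborel. norm (norm (conv K f x) powr q) \<le> norm (6 powr q * (\<Sum>i\<in>T. norm (conv K (fi i) x) powr q))"
      using pw by (intro AE_I2) (simp add: abs_of_nonneg sum_nonneg)
  qed measurable
  have ifi: "integrable lborel (\<lambda>x. norm (fi i x) powr q)" for i
    by (rule integrable_bounded_support[where B="B powr q" and a="of_int i / 8" and b="of_int i / 8 + 1/8"])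
      (use fiB fi0 q in \<open>auto intro!: powr_mono2\<close>)
  have "(LINT x|lborel. norm (conv K f x) powr q) \<le> (LINT x|lborel. 6 powr q * (\<Sum>i\<in>T. norm (conv K (fi i) x) powr q))"
    by (rule integral_mono[OF 1 isum pw])
  moreover have "(LINT x|lborel. 6 powr q * (\<Sum>i\<in>T. norm (conv K (fi i) x) powr q)) = 6 powr q * (\<Sum>i\<in>T. LINT x|lborel. norm (conv K (fi i) x) powr q)"
    by (subst Bochner_Integration.integral_mult_right_zero, subst Bochner_Integration.integral_sum) (rule loc(1), rule refl)
  moreover have "(\<Sum>i\<in>T. LINT x|lborel. norm (conv K (fi i) x) powr q) \<le> (\<Sum>i\<in>T. (\<alpha> * \<beta>) powr q * (LINT x|lborel. norm (fi i x) powr q))"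
    by (rule sum_mono) (rule loc(2))
  moreover have "(\<Sum>i\<in>T. (\<alpha> * \<beta>) powr q * (LINT x|lborel. norm (fi i x) powr q)) = (\<alpha> * \<beta>) powr q * (LINT x|lborel. norm (f x) powr q)"
    unfolding fsumq sum_distrib_left[symmetric] by (subst Bochner_Integration.integral_sum) (rule ifi, rule refl)
  ultimately have "(LINT x|lborel. norm (conv K f x) powr q) \<le> 6 powr q * ((\<alpha> * \<beta>) powr q * (LINT x|lborel. norm (f x) powr q))"
    by (smt (verit) mult_left_mono powr_ge_zero)
  then show "(LINT x|lborel. norm (conv K f x) powr q) \<le> (6 * (\<alpha> * \<beta>)) powr q * (LINT x|lborel. norm (f x) powr q)"
    using pos by (simp add: powr_mult mult.assoc)
qed

text \<open>By t <= 1 + t^q the integral of a translate of |f| over [-n, n] is at most 2n plus the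
  full integral of |f|^q, uniformly in the translate. Tonelli against the integrable |K| makes the
  absolute convolution finite almost everywhere on each [-n, n].\<close>

lemma conv_integrable_AE:
  fixes K f :: "real \<Rightarrow> complex"
  assumes K: "integrable lborel K" and f [measurable]: "f \<in> borel_measurable borel"
    and q: "1 \<le> q" and i: "integrable lborel (\<lambda>x. norm (f x) powr q)"
  shows "AE x in lborel. integrable lborel (\<lambda>y. K y * f (x - y))"
proof -
  have [measurable]: "K \<in> borel_measurable borel" using K by (auto dest: borel_measurable_integrable)
  define G where "G x = (\<integral>\<^sup>+y. ennreal (norm (K y)) * ennreal (norm (f (x - y))) \<partial>lborel)" for x
  have [measurable]: "G \<in> borel_measurable borel" unfolding G_def[abs_def] by measurable
  define J where "J = (\<integral>\<^sup>+x. ennreal (norm (f x) powr q) \<partial>lborel)"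
  have J: "J < \<infinity>" using i unfolding J_def by (simp add: nn_integral_eq_integral)
  have le1: "t \<le> 1 + t powr q" if "0 \<le> t" for t :: real
  proof (cases "t \<le> 1")
    case True
    then show ?thesis by (simp add: add_increasing2)
  next
    case False
    then have "t powr 1 \<le> t powr q" using q by (intro powr_mono) auto
    then show ?thesis using False by simp
  qed
  have fin: "(\<integral>\<^sup>+x. indicator {- real n..real n} x * G x \<partial>lborel) < \<infinity>" for n
  proof -
    have inner: "(\<integral>\<^sup>+x. indicator {- real n..real n} x * ennreal (norm (f (x - y))) \<partial>lborel) \<le> ennreal (2 * real n) + J" for y
    proof -
      have "(\<integral>\<^sup>+x. indicator {- real n..real n} x * ennreal (norm (f (x - y))) \<partial>lborel) \<le> (\<integral>\<^sup>+x. indicator {- real n..real n} x + ennreal (norm (f (x - y)) powr q) \<partial>lborel)"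
      proof (rule nn_integral_mono)
        fix x :: real
        have "ennreal (norm (f (x - y))) \<le> 1 + ennreal (norm (f (x - y)) powr q)"
          using le1[of "norm (f (x - y))"] by (simp add: ennreal_1[symmetric] ennreal_plus[symmetric] del: ennreal_1 ennreal_plus)
        then show "indicator {- real n..real n} x * ennreal (norm (f (x - y))) \<le> indicator {- real n..real n} x + ennreal (norm (f (x - y)) powr q)"
          by (simp add: indicator_def)
      qed
      moreover have "(\<integral>\<^sup>+x. indicator {- real n..real n} x + ennreal (norm (f (x - y)) powr q) \<partial>lborel) = ennreal (2 * real n) + (\<integral>\<^sup>+x. ennreal (norm (f (x - y)) powr q) \<partial>lborel)"
        by (subst nn_integral_add) (auto simp: emeasure_lborel_Icc_eq)
      moreover have "(\<integral>\<^sup>+x. ennreal (norm (f (x - y)) powr q) \<partial>lborel) = J"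
        unfolding J_def by (subst nn_integral_real_affine[of _ 1 "-y"]) simp_all
      ultimately show ?thesis by simp
    qed
    have "(\<integral>\<^sup>+x. indicator {- real n..real n} x * G x \<partial>lborel) =
      (\<integral>\<^sup>+x. (\<integral>\<^sup>+y. ennreal (norm (K y)) * (indicator {- real n..real n} x * ennreal (norm (f (x - y)))) \<partial>lborel) \<partial>lborel)"
      unfolding G_def by (intro nn_integral_cong) (simp add: nn_integral_cmult[symmetric] mult_ac)
    moreover have "\<dots> = (\<integral>\<^sup>+y. (\<integral>\<^sup>+x. ennreal (norm (K y)) * (indicator {- real n..real n} x * ennreal (norm (f (x - y)))) \<partial>lborel) \<partial>lborel)"
      by (rule lborel_pair.Fubini') measurable
    moreover have "\<dots> \<le> (\<integral>\<^sup>+y. ennreal (norm (K y)) * (ennreal (2 * real n) + J) \<partial>lborel)"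
      by (intro nn_integral_mono) (simp add: nn_integral_cmult mult_left_mono inner)
    moreover have "\<dots> = (\<integral>\<^sup>+y. ennreal (norm (K y)) \<partial>lborel) * (ennreal (2 * real n) + J)"
      by (rule nn_integral_multc) measurable
    moreover have "\<dots> < \<infinity>"
      using J K unfolding integrable_iff_bounded by (auto simp: ennreal_mult_less_top)
    ultimately show ?thesis by (simp only: le_less_trans)
  qed
  have "AE x in lborel. indicator {- real n..real n} x * G x \<noteq> \<infinity>" for n
    by (rule nn_integral_PInf_AE) (use fin[of n] in auto)
  then have "AE x in lborel. \<forall>n. indicator {- real n..real n} x * G x \<noteq> \<infinity>"
    by (simp only: AE_all_countable) blast
  then show ?thesis
  proof eventually_elim
    case (elim x)
    obtain n where "\<bar>x\<bar> \<le> real n" using real_arch_simple by blast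
    then have "x \<in> {- real n..real n}" by auto
    then have "G x \<noteq> \<infinity>" using elim[rule_format, of n] by simp
    then show ?case
      unfolding integrable_iff_bounded G_def
      by (auto simp: norm_mult ennreal_mult less_top)
  qed
qed

text \<open>Truncations satisfy the previous bound uniformly and their convolutions converge almost
  everywhere by \<open>conv_integrable_AE\<close>; Fatou's lemma finishes. The nonnegative integral
  states finiteness and size at once.\<close>

lemma conv_bound:
  fixes p p' q :: real
  assumes p: "1 < p" and p': "1 / p + 1 / p' = 1" and adm: "admissible p q"
    and fin: "finite F" and S: "integrable lborel S" "\<And>u. u \<notin> {1/4..3/4} \<Longrightarrow> S u = 0"
    and pos: "0 < \<alpha>" "0 < \<beta>"
    and a: "\<And>A. finite A \<Longrightarrow> (\<Sum>k\<in>A. norm (fcoef S k) powr p) \<le> \<alpha> powr p"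
    and \<phi>: "(\<Sum>n\<in>F. norm (\<phi> n) powr p') \<le> \<beta> powr p'"
    and f [measurable]: "f \<in> borel_measurable borel" and i: "integrable lborel (\<lambda>x. norm (f x) powr q)"
  defines "K \<equiv> \<lambda>y. S y * trig_poly F \<phi> y"
  shows "(\<integral>\<^sup>+x. ennreal (norm (conv K f x) powr q) \<partial>lborel) \<le> ennreal ((6 * (\<alpha> * \<beta>)) powr q * (LINT x|lborel. norm (f x) powr q))"
proof -
  have q: "1 \<le> q" by (rule admissible_ge_1[OF p adm])
  have iK: "integrable lborel K" unfolding K_def by (rule trig_poly_kernel[OF S(1)])
  have [measurable]: "K \<in> borel_measurable borel" using iK by (auto dest: borel_measurable_integrable)
  let ?c = "(6 * (\<alpha> * \<beta>)) powr q"
  have lim: "AE x in lborel. (\<lambda>j. conv K (truncate j f) x) \<longlonglongrightarrow> conv K f x"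
    using conv_integrable_AE[OF iK f q i]
  proof eventually_elim
    case (elim x)
    show ?case unfolding conv_def
    proof (rule integral_dominated_convergence[OF _ _ integrable_norm[OF elim]])
      show "AE y in lborel. (\<lambda>j. K y * truncate j f (x - y)) \<longlonglongrightarrow> K y * f (x - y)"
        by (intro AE_I2 tendsto_mult tendsto_const truncate_tendsto)
      show "AE y in lborel. norm (K y * truncate j f (x - y)) \<le> norm (K y * f (x - y))" for j
        using truncate_bounds(2) by (intro AE_I2) (simp add: norm_mult mult_left_mono)
    qed measurable
  qed
  have tb: "(\<integral>\<^sup>+x. ennreal (norm (conv K (truncate j f) x) powr q) \<partial>lborel) \<le> ennreal (?c * (LINT x|lborel. norm (f x) powr q))" for j
  proof -
    have b: "integrable lborel (\<lambda>x. norm (conv K (truncate j f) x) powr q)"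
      "(LINT x|lborel. norm (conv K (truncate j f) x) powr q) \<le> ?c * (LINT x|lborel. norm (truncate j f x) powr q)"
      unfolding K_def
      by (rule conv_bounded_support_bound(1)[OF p p' adm fin S pos a \<phi> truncate_measurable[OF f] truncate_bounds(1) truncate_bounds(3)], assumption+)
        (rule conv_bounded_support_bound(2)[OF p p' adm fin S pos a \<phi> truncate_measurable[OF f] truncate_bounds(1) truncate_bounds(3)], assumption+)
    have "(LINT x|lborel. norm (truncate j f x) powr q) \<le> (LINT x|lborel. norm (f x) powr q)"
      using truncate_bounds(2) q by (intro integral_mono' i powr_mono2) auto
    then have "?c * (LINT x|lborel. norm (truncate j f x) powr q) \<le> ?c * (LINT x|lborel. norm (f x) powr q)"
      by (intro mult_left_mono) auto
    then have "(LINT x|lborel. norm (conv K (truncate j f) x) powr q) \<le> ?c * (LINT x|lborel. norm (f x) powr q)"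
      using b(2) by linarith
    then show ?thesis using b(1) by (simp add: nn_integral_eq_integral ennreal_leI)
  qed
  have "(\<integral>\<^sup>+x. ennreal (norm (conv K f x) powr q) \<partial>lborel) = (\<integral>\<^sup>+x. liminf (\<lambda>j. ennreal (norm (conv K (truncate j f) x) powr q)) \<partial>lborel)"
  proof (rule nn_integral_cong_AE)
    show "AE x in lborel. ennreal (norm (conv K f x) powr q) = liminf (\<lambda>j. ennreal (norm (conv K (truncate j f) x) powr q))"
      using lim
    proof eventually_elim
      case (elim x)
      have "(\<lambda>j. ennreal (norm (conv K (truncate j f) x) powr q)) \<longlonglongrightarrow> ennreal (norm (conv K f x) powr q)"
        using q elim by (intro tendsto_ennrealI tendsto_powr' tendsto_norm tendsto_const) auto
      then show ?case by (rule lim_imp_Liminf[OF trivial_limit_sequentially, symmetric])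
    qed
  qed
  moreover have "(\<integral>\<^sup>+x. liminf (\<lambda>j. ennreal (norm (conv K (truncate j f) x) powr q)) \<partial>lborel) \<le> liminf (\<lambda>j. \<integral>\<^sup>+x. ennreal (norm (conv K (truncate j f) x) powr q) \<partial>lborel)"
    by (rule nn_integral_liminf) measurable
  moreover have "liminf (\<lambda>j. \<integral>\<^sup>+x. ennreal (norm (conv K (truncate j f) x) powr q) \<partial>lborel) \<le> ennreal (?c * (LINT x|lborel. norm (f x) powr q))"
    by (rule Liminf_le) (use tb in auto)
  ultimately show ?thesis by (simp only: order_trans)
qed

subsection \<open>Fourier inversion for Schwartz functions\<close>

lemma integrable_inverse_square: "integrable lborel (\<lambda>x::real. C / (1 + x\<^sup>2))"
proof -
  have "integrable lborel (\<lambda>x::real. inverse (1 + x\<^sup>2))"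
    using integrable_inverse_1_plus_square by (simp add: set_integrable_def einterval_def)
  then have "integrable lborel (\<lambda>x::real. C * inverse (1 + x\<^sup>2))" by simp
  then show ?thesis by (simp add: divide_inverse)
qed

lemma integrable_decay:
  fixes f :: "real \<Rightarrow> complex"
  assumes "f \<in> borel_measurable borel" "\<And>x. norm (f x) \<le> C / (1 + x\<^sup>2)"
  shows "integrable lborel f"
proof (rule Bochner_Integration.integrable_bound[OF integrable_inverse_square[of C]])
  show "AE x in lborel. norm (f x) \<le> norm (C / (1 + x\<^sup>2))"
    by (intro AE_I2 order_trans[OF assms(2)]) (simp only: real_norm_def abs_ge_self)
qed (use assms(1) in simp)

text \<open>The weights of order 0 and 2 alone give decay like 1/(1 + x^2), enough for integrability
  and for the vanishing boundary terms of integration by parts.\<close>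

lemma schwartzE:
  assumes "f \<in> schwartz"
  obtains D C where "D 0 = f" "\<And>k x. (D k has_vector_derivative D (Suc k) x) (at x)"
    "\<And>k. D k \<in> borel_measurable borel" "\<And>k. integrable lborel (D k)" "\<And>k x. norm (D k x) \<le> C k / (1 + x\<^sup>2)"
    "\<And>k x. isCont (D k) x"
proof -
  obtain D where D: "D 0 = f" "\<And>k x. (D k has_vector_derivative D (Suc k) x) (at x)"
    "\<And>j k. bounded (range (\<lambda>x. x ^ j *\<^sub>R D k x))"
    using assms unfolding schwartz_def by auto
  have "\<exists>B. \<forall>x. norm (x ^ j *\<^sub>R D k x) \<le> B" for j k
    using D(3)[of j k] unfolding bounded_iff by auto
  then obtain B where B: "\<And>j k x. norm (x ^ j *\<^sub>R D k x) \<le> B j k" by metis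
  have le: "norm (D k x) \<le> (B 0 k + B 2 k) / (1 + x\<^sup>2)" for k x
  proof -
    have "0 < 1 + x\<^sup>2" using zero_le_power2[of x] by linarith
    moreover have "norm (D k x) * (1 + x\<^sup>2) \<le> B 0 k + B 2 k"
      using B[of x 0 k] B[of x 2 k] by (simp add: algebra_simps)
    ultimately show ?thesis by (simp add: le_divide_eq)
  qed
  have c: "isCont (D k) x" for k x by (rule has_vector_derivative_continuous[OF D(2)])
  have m: "D k \<in> borel_measurable borel" for k
    by (rule borel_measurable_continuous_onI, rule continuous_at_imp_continuous_on, rule ballI, rule c)
  show thesis by (rule that[OF D(1,2) m integrable_decay[OF m le] le c])
qed

definition ftr :: "(real \<Rightarrow> complex) \<Rightarrow> real \<Rightarrow> complex" where
  "ftr f \<xi> = (LINT x|lborel. f x * wave (- \<xi>) x)"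

lemma norm_ftr_le: "norm (ftr f \<xi>) \<le> (LINT x|lborel. norm (f x))"
proof -
  have "norm (ftr f \<xi>) \<le> (LINT x|lborel. norm (f x * wave (- \<xi>) x))"
    unfolding ftr_def by (rule integral_norm_bound)
  then show ?thesis by (simp add: norm_mult)
qed

lemma ftr_measurable:
  assumes f: "integrable lborel f"
  shows "ftr f \<in> borel_measurable borel"
proof -
  have [measurable]: "f \<in> borel_measurable borel" using f by (auto dest: borel_measurable_integrable)
  have "(\<lambda>(\<xi>, x). f x * wave (- \<xi>) x) \<in> borel_measurable (borel \<Otimes>\<^sub>M lborel)"
    unfolding wave_def cis_conv_exp by measurable
  then show ?thesis
    unfolding ftr_def[abs_def] by (intro lborel.borel_measurable_lebesgue_integral) simp
qed

text \<open>Integration by parts in the form that the derivative of f times a character integrates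
  to 0 over the line, since f tends to 0 at both ends.\<close>

lemma ftr_deriv:
  assumes f: "integrable lborel f" "integrable lborel f'" "\<And>x. (f has_vector_derivative f' x) (at x)"
    and cont: "\<And>x. isCont f' x" and decay: "\<And>x. norm (f x) \<le> C / (1 + x\<^sup>2)"
  shows "ftr f' \<xi> = (2 * pi * \<xi> * \<i>) * ftr f \<xi>"
proof -
  let ?F = "\<lambda>x. f x * wave (- \<xi>) x"
  let ?F' = "\<lambda>x. f x * ((2 * pi * (- \<xi>) * \<i>) * wave (- \<xi>) x) + f' x * wave (- \<xi>) x"
  have dF: "(?F has_vector_derivative ?F' x) (at x)" for x
    using has_vector_derivative_mult[OF f(3) has_vector_derivative_wave[of "- \<xi>" x]] by simp
  have cf: "isCont f x" for x by (rule has_vector_derivative_continuous[OF f(3)])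
  have cw: "isCont (wave t) x" for t x by (rule has_vector_derivative_continuous[OF has_vector_derivative_wave])
  have iw: "integrable lborel (\<lambda>x. f x * wave (- \<xi>) x)" "integrable lborel (\<lambda>x. f' x * wave (- \<xi>) x)"
    by (rule integrable_mult_wave[OF f(1)], rule integrable_mult_wave[OF f(2)])
  have i1: "integrable lborel (\<lambda>x. (2 * pi * (- \<xi>) * \<i>) * (f x * wave (- \<xi>) x))"
    using iw(1) by simp
  then have i1': "integrable lborel (\<lambda>x. f x * ((2 * pi * (- \<xi>) * \<i>) * wave (- \<xi>) x))"
    by (simp only: mult.left_commute[of "f _"])
  then have iF': "integrable lborel ?F'" using iw(2) by (rule Bochner_Integration.integrable_add)
  have lim: "(?F \<longlongrightarrow> 0) at_top" "(?F \<longlongrightarrow> 0) at_bot"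
  proof -
    have "((\<lambda>x::real. C / (1 + x\<^sup>2)) \<longlongrightarrow> 0) at_top" "((\<lambda>x::real. C / (1 + x\<^sup>2)) \<longlongrightarrow> 0) at_bot"
      by real_asymp+
    then show "(?F \<longlongrightarrow> 0) at_top" "(?F \<longlongrightarrow> 0) at_bot"
      using decay by (auto intro!: Lim_null_comparison[of ?F "\<lambda>x. C / (1 + x\<^sup>2)"] simp: norm_mult)
  qed
  have "(LBINT x=-\<infinity>..\<infinity>. ?F' x) = 0 - 0"
  proof (rule interval_integral_FTC_integrable)
    show "isCont ?F' x" for x
      by (intro isCont_add isCont_mult continuous_const cf cw cont)
    show "set_integrable lborel (einterval (-\<infinity>) \<infinity>) ?F'"
      using iF' by (simp add: set_integrable_def einterval_def)
    show "((?F \<circ> real_of_ereal) \<longlongrightarrow> 0) (at_right (-\<infinity>))" "((?F \<circ> real_of_ereal) \<longlongrightarrow> 0) (at_left \<infinity>)"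
      unfolding ereal_tendsto_simps1 by (rule lim)+
  qed (use dF in auto)
  moreover have "(LBINT x=-\<infinity>..\<infinity>. ?F' x) = (LINT x|lborel. ?F' x)"
    by (simp add: interval_lebesgue_integral_def set_lebesgue_integral_def einterval_def)
  moreover have "(LINT x|lborel. ?F' x) = (LINT x|lborel. f x * ((2 * pi * (- \<xi>) * \<i>) * wave (- \<xi>) x)) + ftr f' \<xi>"
    unfolding ftr_def by (rule Bochner_Integration.integral_add[OF i1' iw(2)])
  moreover have "(LINT x|lborel. f x * ((2 * pi * (- \<xi>) * \<i>) * wave (- \<xi>) x)) = (2 * pi * (- \<xi>) * \<i>) * ftr f \<xi>"
    unfolding ftr_def mult.left_commute[of "f _"] by (rule Bochner_Integration.integral_mult_right_zero)
  ultimately have "(2 * pi * (- \<xi>) * \<i>) * ftr f \<xi> + ftr f' \<xi> = 0" by (simp only:) simp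
  then show ?thesis by (simp add: add_eq_0_iff2)
qed

text \<open>Two derivatives multiply the transform by a constant times \<xi>^2, so it decays like
  1/(1 + \<xi>^2).\<close>

lemma ftr_schwartz_integrable:
  assumes f: "f \<in> schwartz"
  shows "integrable lborel (ftr f)"
proof -
  obtain D C where D: "D 0 = f" "\<And>k x. (D k has_vector_derivative D (Suc k) x) (at x)"
    "\<And>k. D k \<in> borel_measurable borel" "\<And>k. integrable lborel (D k)" "\<And>k x. norm (D k x) \<le> C k / (1 + x\<^sup>2)"
    "\<And>k x. isCont (D k) x"
    using schwartzE[OF f] by blast
  have rel: "ftr (D (Suc k)) \<xi> = (2 * pi * \<xi> * \<i>) * ftr (D k) \<xi>" for k \<xi>
    by (rule ftr_deriv[OF D(4) D(4) D(2) D(6) D(5)])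
  define M where "M k = (LINT x|lborel. norm (D k x))" for k
  have M: "norm (ftr (D k) \<xi>) \<le> M k" for k \<xi> unfolding M_def by (rule norm_ftr_le)
  have "norm (ftr f \<xi>) \<le> (M 0 + M 2) / (1 + \<xi>\<^sup>2)" for \<xi>
  proof -
    have "ftr (D 2) \<xi> = (2 * pi * \<xi> * \<i>) * ((2 * pi * \<xi> * \<i>) * ftr f \<xi>)"
      using rel[of 1 \<xi>] rel[of 0 \<xi>] D(1) by (simp add: numeral_2_eq_2)
    then have "norm (ftr (D 2) \<xi>) = (2 * pi * \<bar>\<xi>\<bar>) * ((2 * pi * \<bar>\<xi>\<bar>) * norm (ftr f \<xi>))"
      by (simp add: norm_mult abs_mult)
    also have "\<dots> = (2 * pi)\<^sup>2 * (\<xi>\<^sup>2 * norm (ftr f \<xi>))"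
      by (simp add: power2_eq_square)
    finally have "(2 * pi)\<^sup>2 * (\<xi>\<^sup>2 * norm (ftr f \<xi>)) \<le> M 2" using M[of 2 \<xi>] by simp
    moreover have "1 * (\<xi>\<^sup>2 * norm (ftr f \<xi>)) \<le> (2 * pi)\<^sup>2 * (\<xi>\<^sup>2 * norm (ftr f \<xi>))"
      using one_le_power[of "2 * pi" 2] pi_ge_two by (intro mult_right_mono) auto
    ultimately have "norm (ftr f \<xi>) * (1 + \<xi>\<^sup>2) \<le> M 0 + M 2"
      using M[of 0 \<xi>] D(1) by (simp add: algebra_simps)
    moreover have "0 < 1 + \<xi>\<^sup>2" using zero_le_power2[of \<xi>] by linarith
    ultimately show ?thesis by (simp add: le_divide_eq)
  qed
  then show ?thesis using ftr_measurable D(1,4) by (intro integrable_decay) auto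
qed

lemma gaussian_transform:
  "(LINT s|lborel. complex_of_real (std_normal_density s) * cis (t * s)) = complex_of_real (sqrt (2 * pi) * std_normal_density t)"
proof -
  have "(LINT s|std_normal_distribution. cis (t * s)) = (LINT s|lborel. std_normal_density s *\<^sub>R cis (t * s))"
    unfolding cis_conv_exp by (rule integral_density) auto
  moreover have "(LINT s|std_normal_distribution. cis (t * s)) = complex_of_real (exp (- (t\<^sup>2) / 2))"
    using fun_cong[OF char_std_normal_distribution, of t] by (simp add: char_def cis_conv_exp)
  ultimately show ?thesis by (simp add: scaleR_conv_of_real std_normal_density_def)
qed

lemma std_normal_density_le: "sqrt (2 * pi) * std_normal_density s \<le> 1" "0 \<le> sqrt (2 * pi) * std_normal_density s"
  by (simp_all add: std_normal_density_def)

text \<open>Gaussian summation. A Gaussian factor on the frequency side makes Fubini legitimate and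
  turns the integral into an average of f over a normal law of scale e around x. Letting e tend to 0
  gives the inversion integral on one side and, by continuity, f x on the other.\<close>

lemma fourier_inversion:
  assumes f: "f \<in> schwartz"
  shows "(LINT \<xi>|lborel. ftr f \<xi> * wave \<xi> x) = f x"
proof -
  obtain D C where D: "D 0 = f" "\<And>k x. (D k has_vector_derivative D (Suc k) x) (at x)"
    "\<And>k. D k \<in> borel_measurable borel" "\<And>k. integrable lborel (D k)" "\<And>k x. norm (D k x) \<le> C k / (1 + x\<^sup>2)"
    "\<And>k x. isCont (D k) x"
    using schwartzE[OF f] by blast
  have fi: "integrable lborel f" and fc: "isCont f y" for y using D(1) D(4)[of 0] D(6)[of y 0] by auto
  have [measurable]: "f \<in> borel_measurable borel" using D(1) D(3)[of 0] by simp
  have C0: "0 \<le> C 0" using D(5)[of 0 0] by (auto intro: order_trans[OF norm_ge_zero])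
  have fB: "norm (f y) \<le> C 0" for y
  proof -
    have "C 0 / (1 + y\<^sup>2) \<le> C 0 / 1" using C0 by (intro divide_left_mono) (auto intro: add_pos_nonneg)
    then show ?thesis using D(1) D(5)[of 0 y] by simp
  qed
  let ?n = "std_normal_density" and ?r = "sqrt (2 * pi)"
  have if': "integrable lborel (ftr f)" by (rule ftr_schwartz_integrable[OF f])
  have [measurable]: "ftr f \<in> borel_measurable borel" using if' by (auto dest: borel_measurable_integrable)
  \<comment> \<open>The factor is exp(-(2 pi e \<xi>)^2 / 2): it is at most 1, tends to 1 as e tends
    to 0, and transforms to the normal density of standard deviation e.\<close>
  define A where "A e = (LINT \<xi>|lborel. ftr f \<xi> * wave \<xi> x * of_real (?r * ?n (2 * pi * e * \<xi>)))" for e :: real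
  have A_eq: "A e = (LINT s|lborel. of_real (?n s) * f (x - e * s))" if e: "0 < e" for e
  proof -
    define G where "G \<xi> = complex_of_real (?r * ?n (2 * pi * e * \<xi>))" for \<xi>
    have iG: "integrable lborel G"
    proof -
      have "integrable lborel (\<lambda>\<xi>. ?n (0 + (2 * pi * e) * \<xi>))"
        by (rule lborel_integrable_real_affine) (use e in auto)
      then have "integrable lborel (\<lambda>\<xi>. ?r * ?n (2 * pi * e * \<xi>))" by simp
      then show ?thesis unfolding G_def by (rule integrable_of_real)
    qed
    have "A e = (LINT \<xi>|lborel. LINT y|lborel. G \<xi> * f y * wave \<xi> (x - y))"
    proof -
      have "ftr f \<xi> * wave \<xi> x * of_real (?r * ?n (2 * pi * e * \<xi>)) = (LINT y|lborel. G \<xi> * f y * wave \<xi> (x - y))" for \<xi>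
      proof -
        have "(LINT y|lborel. G \<xi> * f y * wave \<xi> (x - y)) = (LINT y|lborel. (G \<xi> * wave \<xi> x) * (f y * wave (- \<xi>) y))"
          by (simp only: wave_diff_right mult_ac)
        also have "\<dots> = (G \<xi> * wave \<xi> x) * ftr f \<xi>"
          unfolding ftr_def by (rule Bochner_Integration.integral_mult_right_zero)
        finally show ?thesis by (simp only: G_def mult_ac)
      qed
      then show ?thesis by (simp only: A_def)
    qed
    also have "\<dots> = (LINT y|lborel. LINT \<xi>|lborel. G \<xi> * f y * wave \<xi> (x - y))"
    proof (rule fubini_bounded(2)[OF fi iG, where C=1])
      show "(\<lambda>(\<xi>, y). wave \<xi> (x - y)) \<in> borel_measurable (lborel \<Otimes>\<^sub>M lborel)"
        unfolding wave_def cis_conv_exp by measurable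
    qed simp
    also have "\<dots> = (LINT y|lborel. f y * of_real (?n ((x - y) / e) / e))"
    proof (rule Bochner_Integration.integral_cong[OF refl])
      fix y
      have "(LINT \<xi>|lborel. G \<xi> * wave \<xi> (x - y)) = of_real (?n ((x - y) / e) / e)"
      proof -
        have c: "1 / (2 * pi * e) \<noteq> 0" using e by simp
        have "(LINT \<xi>|lborel. G \<xi> * wave \<xi> (x - y)) =
          \<bar>1 / (2 * pi * e)\<bar> *\<^sub>R (LINT s|lborel. G (0 + 1 / (2 * pi * e) * s) * wave (0 + 1 / (2 * pi * e) * s) (x - y))"
          by (rule lborel_integral_real_affine[OF c])
        moreover have "G (0 + 1 / (2 * pi * e) * s) * wave (0 + 1 / (2 * pi * e) * s) (x - y) = of_real ?r * (of_real (?n s) * cis ((x - y) / e * s))" for s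
          using e by (simp add: G_def wave_def mult.commute)
        moreover have "(LINT s|lborel. of_real ?r * (complex_of_real (?n s) * cis ((x - y) / e * s))) = of_real ?r * of_real (?r * ?n ((x - y) / e))"
          by (subst Bochner_Integration.integral_mult_right_zero) (simp only: gaussian_transform)
        ultimately have "(LINT \<xi>|lborel. G \<xi> * wave \<xi> (x - y)) = \<bar>1 / (2 * pi * e)\<bar> *\<^sub>R (of_real ?r * of_real (?r * ?n ((x - y) / e)))"
          by (simp only:)
        also have "\<dots> = of_real (1 / (2 * pi * e) * ((?r * ?r) * ?n ((x - y) / e)))"
          using e by (simp add: scaleR_conv_of_real del: real_sqrt_mult_self)
        also have "?r * ?r = 2 * pi" by simp
        finally show ?thesis using e by simp
      qed
      moreover have "(LINT \<xi>|lborel. G \<xi> * f y * wave \<xi> (x - y)) = f y * (LINT \<xi>|lborel. G \<xi> * wave \<xi> (x - y))"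
        by (simp add: mult.assoc mult.left_commute[of _ "f y"])
      ultimately show "(LINT \<xi>|lborel. G \<xi> * f y * wave \<xi> (x - y)) = f y * of_real (?n ((x - y) / e) / e)" by simp
    qed
    also have "\<dots> = \<bar>- e\<bar> *\<^sub>R (LINT s|lborel. f (x + - e * s) * of_real (?n ((x - (x + - e * s)) / e) / e))"
      by (rule lborel_integral_real_affine) (use e in auto)
    also have "\<dots> = (LINT s|lborel. \<bar>- e\<bar> *\<^sub>R (f (x + - e * s) * of_real (?n ((x - (x + - e * s)) / e) / e)))"
      by (rule Bochner_Integration.integral_scaleR_right[symmetric])
    also have "\<dots> = (LINT s|lborel. of_real (?n s) * f (x - e * s))"
      using e by (intro Bochner_Integration.integral_cong refl) (simp add: scaleR_conv_of_real)
    finally show ?thesis .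
  qed
  have lim1: "(\<lambda>n. A (1 / Suc n)) \<longlonglongrightarrow> (LINT \<xi>|lborel. ftr f \<xi> * wave \<xi> x)"
    unfolding A_def
  proof (rule integral_dominated_convergence[OF _ _ integrable_norm[OF if']])
    have "(\<lambda>n. ftr f \<xi> * wave \<xi> x * of_real (?r * ?n (2 * pi * (1 / real (Suc n)) * \<xi>))) \<longlonglongrightarrow> ftr f \<xi> * wave \<xi> x * of_real 1" for \<xi>
    proof -
      have "(\<lambda>n. exp (- (2 * pi * (1 / real (Suc n)) * \<xi>)\<^sup>2 / 2)) \<longlonglongrightarrow> exp (- (2 * pi * 0 * \<xi>)\<^sup>2 / 2)"
        by (intro tendsto_intros LIMSEQ_inverse_real_of_nat[unfolded inverse_eq_divide]) auto
      then have "(\<lambda>n. ?r * ?n (2 * pi * (1 / real (Suc n)) * \<xi>)) \<longlonglongrightarrow> 1"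
        by (simp add: std_normal_density_def)
      then show ?thesis by (intro tendsto_mult tendsto_const tendsto_of_real)
    qed
    then show "AE \<xi> in lborel. (\<lambda>n. ftr f \<xi> * wave \<xi> x * of_real (?r * ?n (2 * pi * (1 / real (Suc n)) * \<xi>))) \<longlonglongrightarrow> ftr f \<xi> * wave \<xi> x"
      by simp
    have "norm (ftr f \<xi> * wave \<xi> x * of_real (?r * ?n t)) \<le> norm (ftr f \<xi>)" for \<xi> t
    proof -
      have "\<bar>?r * ?n t\<bar> \<le> 1" using std_normal_density_le[of t] by linarith
      then have "norm (ftr f \<xi>) * \<bar>?r * ?n t\<bar> \<le> norm (ftr f \<xi>) * 1" by (intro mult_left_mono) auto
      then show ?thesis unfolding norm_mult norm_of_real by simp
    qed
    then show "AE \<xi> in lborel. norm (ftr f \<xi> * wave \<xi> x * of_real (?r * ?n (2 * pi * (1 / real (Suc n)) * \<xi>))) \<le> norm (ftr f \<xi>)" for n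
      by simp
    show "(\<lambda>\<xi>. ftr f \<xi> * wave \<xi> x) \<in> borel_measurable lborel" "(\<lambda>\<xi>. ftr f \<xi> * wave \<xi> x * of_real (?r * ?n (2 * pi * (1 / real (Suc n)) * \<xi>))) \<in> borel_measurable lborel" for n
      unfolding wave_def cis_conv_exp by measurable
  qed
  have lim2: "(\<lambda>n. LINT s|lborel. of_real (?n s) * f (x - 1 / Suc n * s)) \<longlonglongrightarrow> (LINT s|lborel. of_real (?n s) * f x)"
  proof (rule integral_dominated_convergence[where w="\<lambda>s. C 0 * ?n s"])
    have "(\<lambda>n. of_real (?n s) * f (x - 1 / Suc n * s)) \<longlonglongrightarrow> of_real (?n s) * f x" for s
    proof -
      have "(\<lambda>n. x - 1 / real (Suc n) * s) \<longlonglongrightarrow> x - 0 * s"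
        by (intro tendsto_intros LIMSEQ_inverse_real_of_nat[unfolded inverse_eq_divide])
      then have "(\<lambda>n. x - 1 / real (Suc n) * s) \<longlonglongrightarrow> x" by simp
      then have "(\<lambda>n. f (x - 1 / real (Suc n) * s)) \<longlonglongrightarrow> f x" by (rule isCont_tendsto_compose[OF fc])
      then show ?thesis by (intro tendsto_mult tendsto_const)
    qed
    then show "AE s in lborel. (\<lambda>n. of_real (?n s) * f (x - 1 / Suc n * s)) \<longlonglongrightarrow> of_real (?n s) * f x" by simp
    show "AE s in lborel. norm (of_real (?n s) * f (x - 1 / Suc n * s)) \<le> C 0 * ?n s" for n
    proof (rule AE_I2)
      fix s
      have "?n s * norm (f (x - 1 / Suc n * s)) \<le> ?n s * C 0" by (intro mult_left_mono fB) simp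
      then show "norm (of_real (?n s) * f (x - 1 / Suc n * s)) \<le> C 0 * ?n s"
        unfolding norm_mult norm_of_real by (simp add: mult.commute)
    qed
  qed simp_all
  have "(LINT s|lborel. of_real (?n s) * f x) = f x"
    by simp
  with lim2 have "(\<lambda>n. A (1 / Suc n)) \<longlonglongrightarrow> f x" by (simp add: A_eq)
  with lim1 show ?thesis by (rule LIMSEQ_unique)
qed

subsection \<open>Multiplier extensions\<close>

lemma borel_representative:
  fixes f :: "real \<Rightarrow> complex"
  assumes "f \<in> borel_measurable lebesgue"
  obtains g where "g \<in> borel_measurable borel" "AE x in lborel. f x = g x"
proof -
  have "(\<lambda>x. Re (f x)) \<in> borel_measurable lebesgue" "(\<lambda>x. Im (f x)) \<in> borel_measurable lebesgue"
    using assms by (auto simp: borel_measurable_complex_iff)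
  note reim = this
  obtain u where u: "u \<in> borel_measurable lborel" "AE x in lborel. Re (f x) = u x"
    using completion_ex_borel_measurable_real[OF reim(1)] by blast
  obtain v where v: "v \<in> borel_measurable lborel" "AE x in lborel. Im (f x) = v x"
    using completion_ex_borel_measurable_real[OF reim(2)] by blast
  show thesis
  proof (rule that[of "\<lambda>x. Complex (u x) (v x)"])
    show "(\<lambda>x. Complex (u x) (v x)) \<in> borel_measurable borel"
      using u(1) v(1) by (simp add: borel_measurable_complex_iff)
    show "AE x in lborel. f x = Complex (u x) (v x)"
      using u(2) v(2) by eventually_elim (simp add: complex_eq_iff)
  qed
qed

text \<open>The bridge between the two measures: the notions of the theorem live on
  \<open>lebesgue\<close>, while Fubini and affine substitution are carried out with Borel functions
  on \<open>lborel\<close>.\<close>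

lemma lebesgue_lborel_AE:
  fixes f g :: "real \<Rightarrow> 'b::euclidean_space"
  assumes g: "g \<in> borel_measurable borel" and ae: "AE x in lborel. f x = g x"
  shows "f \<in> borel_measurable lebesgue" "integrable lebesgue f \<longleftrightarrow> integrable lborel g"
    "(LINT x|lebesgue. f x) = (LINT x|lborel. g x)"
proof -
  have gl: "g \<in> borel_measurable lborel" using g by simp
  have g': "g \<in> borel_measurable lebesgue" by (rule measurable_completion[OF gl])
  have ae': "AE x in lebesgue. f x = g x" using ae by (rule AE_completion)
  then have ae'': "AE x in lebesgue. g x = f x" by (auto elim: eventually_mono)
  show f: "f \<in> borel_measurable lebesgue" by (rule borel_measurable_AE[OF g' ae''])
  show "integrable lebesgue f \<longleftrightarrow> integrable lborel g"
    using integrable_cong_AE[OF f g' ae'] integrable_completion[OF gl] by simp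
  show "(LINT x|lebesgue. f x) = (LINT x|lborel. g x)"
    using integral_cong_AE[OF f g' ae'] integral_completion[OF gl] by simp
qed

lemma Lspace_representative:
  assumes f: "f \<in> Lspace q"
  obtains g where "g \<in> borel_measurable borel" "AE x in lborel. f x = g x"
    "integrable lborel (\<lambda>x. norm (g x) powr q)" "(LINT x|lebesgue. norm (f x) powr q) = (LINT x|lborel. norm (g x) powr q)"
proof -
  have f': "f \<in> borel_measurable lebesgue" "integrable lebesgue (\<lambda>x. norm (f x) powr q)" using f by (auto simp: Lspace_def)
  obtain g where g: "g \<in> borel_measurable borel" "AE x in lborel. f x = g x"
    by (rule borel_representative[OF f'(1)])
  have gm: "(\<lambda>x. norm (g x) powr q) \<in> borel_measurable borel" using g(1) by simp
  have ae: "AE x in lborel. norm (f x) powr q = norm (g x) powr q" using g(2) by eventually_elim simp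
  show thesis
    by (rule that[OF g]) (use lebesgue_lborel_AE[OF gm ae] f'(2) in auto)
qed

lemma Lspace_borelI:
  assumes g: "g \<in> borel_measurable borel" and ae: "AE x in lborel. f x = g x" and i: "integrable lborel (\<lambda>x. norm (g x) powr q)"
  shows "f \<in> Lspace q" "(LINT x|lebesgue. norm (f x) powr q) = (LINT x|lborel. norm (g x) powr q)"
proof -
  have gm: "(\<lambda>x. norm (g x) powr q) \<in> borel_measurable borel" using g by simp
  have ae': "AE x in lborel. norm (f x) powr q = norm (g x) powr q" using ae by eventually_elim simp
  show "f \<in> Lspace q" "(LINT x|lebesgue. norm (f x) powr q) = (LINT x|lborel. norm (g x) powr q)"
    using lebesgue_lborel_AE[OF gm ae'] lebesgue_lborel_AE(1)[OF g ae] i by (auto simp: Lspace_def)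
qed

lemma Lnorm_powr:
  assumes "1 \<le> q"
  shows "Lnorm q f powr q = (LINT x|lebesgue. norm (f x) powr q)"
proof -
  have "0 \<le> (LINT x|lebesgue. norm (f x) powr q)" by simp
  then show ?thesis using assms by (simp add: Lnorm_def powr_powr)
qed

lemma Lnorm_nonneg: "0 \<le> Lnorm q f"
  by (simp add: Lnorm_def)

lemma Lnorm_le_powr:
  assumes q: "1 \<le> q" and le: "Lnorm q g \<le> K * Lnorm q f"
  shows "(LINT x|lebesgue. norm (g x) powr q) \<le> \<bar>K\<bar> powr q * (LINT x|lebesgue. norm (f x) powr q)"
proof -
  have "Lnorm q g \<le> \<bar>K\<bar> * Lnorm q f"
    using le mult_right_mono[OF abs_ge_self Lnorm_nonneg, of K q f] by linarith
  then have "Lnorm q g powr q \<le> (\<bar>K\<bar> * Lnorm q f) powr q"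
    using q by (intro powr_mono2) (auto simp: Lnorm_nonneg)
  then show ?thesis by (simp only: powr_mult Lnorm_powr[OF q])
qed

lemma bump_Lspace:
  assumes R: "0 < R" and q: "0 < q"
  shows "bump R p 0 \<in> Lspace q"
proof -
  obtain C where C: "0 \<le> C" "\<And>x. norm (bump R p 0 x) \<le> C" using bump_bounded[OF R] by blast
  have m: "bump R p 0 \<in> borel_measurable borel" using R by simp
  have "integrable lborel (\<lambda>x. norm (bump R p 0 x) powr q)"
  proof (rule integrable_bounded_support[where B="C powr q" and a="-R" and b=R])
    show "norm (norm (bump R p 0 x) powr q) \<le> C powr q" for x using C(2)[of x] q by (auto intro: powr_mono2)
    show "norm (bump R p 0 x) powr q = 0" if "x \<notin> {-R..R}" for x
    proof -
      have "\<not> \<bar>x\<bar> < R" using that by auto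
      then show ?thesis by (simp add: bump_def)
    qed
  qed (use m in simp)
  then show ?thesis by (rule Lspace_borelI(1)[OF m AE_I2[OF refl]])
qed

text \<open>Approximate f by a bump, on which both extensions are prescribed. Only the small
  remainder contributes to the difference, and boundedness of both operators makes that contribution
  at most c e for every e > 0.\<close>

lemma multiplier_extension_unique:
  assumes q: "1 \<le> q" and T1: "multiplier_extension q m T1" and T2: "multiplier_extension q m T2" and f: "f \<in> Lspace q"
  shows "AE x in lebesgue. T1 f x = T2 f x"
proof -
  have b1: "bounded_operator_L q T1" and b2: "bounded_operator_L q T2"
    using T1 T2 by (auto simp: multiplier_extension_def)
  obtain K1 where K1: "\<And>f. f \<in> Lspace q \<Longrightarrow> Lnorm q (T1 f) \<le> K1 * Lnorm q f"
    using b1 unfolding bounded_operator_L_def by blast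
  obtain K2 where K2: "\<And>f. f \<in> Lspace q \<Longrightarrow> Lnorm q (T2 f) \<le> K2 * Lnorm q f"
    using b2 unfolding bounded_operator_L_def by blast
  have L1: "\<And>f. f \<in> Lspace q \<Longrightarrow> T1 f \<in> Lspace q" and L2: "\<And>f. f \<in> Lspace q \<Longrightarrow> T2 f \<in> Lspace q"
    using b1 b2 by (auto simp: bounded_operator_L_def)
  have A1: "\<And>f g. f \<in> Lspace q \<Longrightarrow> g \<in> Lspace q \<Longrightarrow> AE x in lebesgue. T1 (\<lambda>y. f y + g y) x = T1 f x + T1 g x"
    and A2: "\<And>f g. f \<in> Lspace q \<Longrightarrow> g \<in> Lspace q \<Longrightarrow> AE x in lebesgue. T2 (\<lambda>y. f y + g y) x = T2 f x + T2 g x"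
    using b1 b2 unfolding bounded_operator_L_def by blast+
  obtain g where g: "g \<in> borel_measurable borel" "AE x in lborel. f x = g x" "integrable lborel (\<lambda>x. norm (g x) powr q)"
    using Lspace_representative[OF f] by metis
  define c where "c = 2 powr q * (\<bar>K1\<bar> powr q + \<bar>K2\<bar> powr q)"
  have c0: "0 \<le> c" by (simp add: c_def)
  have meas: "T1 f \<in> borel_measurable lebesgue" "T2 f \<in> borel_measurable lebesgue"
    "integrable lebesgue (\<lambda>x. norm (T1 f x) powr q)" "integrable lebesgue (\<lambda>x. norm (T2 f x) powr q)"
    using L1[OF f] L2[OF f] by (auto simp: Lspace_def)
  have idiff: "integrable lebesgue (\<lambda>x. norm (T1 f x - T2 f x) powr q)"
    using Lq_add(1)[of q "T1 f" lebesgue "\<lambda>x. - T2 f x"] meas q by simp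
  have small: "(LINT x|lebesgue. norm (T1 f x - T2 f x) powr q) \<le> c * e" if e: "0 < e" for e
  proof -
    obtain R p where R: "0 < R" and ib: "integrable lborel (\<lambda>x. norm (bump R p 0 x) powr q)"
      and less: "(LINT x|lborel. norm (g x - bump R p 0 x) powr q) < e"
      using schwartz_dense[OF _ g(1,3) e] q by auto
    let ?b = "bump R p 0"
    have bm: "?b \<in> borel_measurable borel" using R by simp
    have bL: "?b \<in> Lspace q" by (rule bump_Lspace[OF R]) (use q in simp)
    define r where "r x = f x - ?b x" for x
    have rm: "(\<lambda>x. g x - ?b x) \<in> borel_measurable borel" using g(1) bm by simp
    have rae: "AE x in lborel. r x = g x - ?b x" using g(2) unfolding r_def by eventually_elim simp
    have ri: "integrable lborel (\<lambda>x. norm (g x - ?b x) powr q)"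
      using Lq_add(1)[of q g lborel "\<lambda>x. - ?b x"] g ib bm q by simp
    have rL: "r \<in> Lspace q" and rn: "(LINT x|lebesgue. norm (r x) powr q) = (LINT x|lborel. norm (g x - ?b x) powr q)"
      by (rule Lspace_borelI[OF rm rae ri])+
    have fr: "f = (\<lambda>y. r y + ?b y)" by (simp add: r_def)
    have s: "?b \<in> schwartz" by (rule bump_schwartz[OF R])
    have "AE x in lebesgue. T1 ?b x = inv_fourier (\<lambda>\<xi>. m \<xi> * fourier ?b \<xi>) x" "AE x in lebesgue. T2 ?b x = inv_fourier (\<lambda>\<xi>. m \<xi> * fourier ?b \<xi>) x"
      using T1 T2 s unfolding multiplier_extension_def by blast+
    moreover have "AE x in lebesgue. T1 f x = T1 r x + T1 ?b x" unfolding fr by (rule A1[OF rL bL])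
    moreover have "AE x in lebesgue. T2 f x = T2 r x + T2 ?b x" unfolding fr by (rule A2[OF rL bL])
    ultimately have ae: "AE x in lebesgue. norm (T1 f x - T2 f x) powr q = norm (T1 r x + - T2 r x) powr q"
      by eventually_elim simp
    have mr: "T1 r \<in> borel_measurable lebesgue" "(\<lambda>x. - T2 r x) \<in> borel_measurable lebesgue"
      "integrable lebesgue (\<lambda>x. norm (T1 r x) powr q)" "integrable lebesgue (\<lambda>x. norm (- T2 r x) powr q)"
      using L1[OF rL] L2[OF rL] by (auto simp: Lspace_def)
    have q0: "0 \<le> q" using q by simp
    have e1: "(LINT x|lebesgue. norm (T1 f x - T2 f x) powr q) = (LINT x|lebesgue. norm (T1 r x + - T2 r x) powr q)"
      by (rule integral_cong_AE[OF _ _ ae]) (use meas mr in auto)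
    have e2: "(LINT x|lebesgue. norm (T1 r x + - T2 r x) powr q) \<le> 2 powr q * ((LINT x|lebesgue. norm (T1 r x) powr q) + (LINT x|lebesgue. norm (- T2 r x) powr q))"
      by (rule Lq_add(2)[OF q0 mr])
    have e3: "(LINT x|lebesgue. norm (T1 r x) powr q) \<le> \<bar>K1\<bar> powr q * (LINT x|lebesgue. norm (r x) powr q)"
      by (rule Lnorm_le_powr[OF q K1[OF rL]])
    have e4: "(LINT x|lebesgue. norm (- T2 r x) powr q) \<le> \<bar>K2\<bar> powr q * (LINT x|lebesgue. norm (r x) powr q)"
      using Lnorm_le_powr[OF q K2[OF rL]] by simp
    have e5: "2 powr q * (X + Y) \<le> c * Z" if "X \<le> \<bar>K1\<bar> powr q * Z" "Y \<le> \<bar>K2\<bar> powr q * Z" for X Y Z :: real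
    proof -
      have "2 powr q * (X + Y) \<le> 2 powr q * (\<bar>K1\<bar> powr q * Z + \<bar>K2\<bar> powr q * Z)"
        using that by (intro mult_left_mono add_mono) auto
      then show ?thesis by (simp add: c_def algebra_simps)
    qed
    have "(LINT x|lebesgue. norm (T1 f x - T2 f x) powr q) \<le> c * (LINT x|lebesgue. norm (r x) powr q)"
      unfolding e1 by (rule order_trans[OF e2 e5[OF e3 e4]])
    moreover have "c * (LINT x|lebesgue. norm (r x) powr q) \<le> c * e"
      using less c0 unfolding rn by (intro mult_left_mono) auto
    ultimately show ?thesis by linarith
  qed
  have "((\<lambda>e. c * e) \<longlongrightarrow> c * 0) (at_right 0)" by (intro tendsto_intros)
  then have "(LINT x|lebesgue. norm (T1 f x - T2 f x) powr q) \<le> c * 0"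
    by (rule tendsto_lowerbound) (auto intro: eventually_mono[OF eventually_at_right_less] small)
  moreover have "0 \<le> (LINT x|lebesgue. norm (T1 f x - T2 f x) powr q)" by simp
  ultimately have "(LINT x|lebesgue. norm (T1 f x - T2 f x) powr q) = 0" by simp
  then have "AE x in lebesgue. norm (T1 f x - T2 f x) powr q = 0"
    using integral_nonneg_eq_0_iff_AE[OF idiff] by simp
  then show ?thesis by eventually_elim simp
qed

lemma Lspace_0: "(\<lambda>x. 0) \<in> Lspace q"
  by (simp add: Lspace_def)

text \<open>The norm is defined through a chosen extension, about which nothing but the defining
  property is known. Uniqueness transfers to it any bound proved for one concrete extension.\<close>

lemma multiplier_norm_le:
  assumes q: "1 \<le> q" and T: "multiplier_extension q m T" and c: "0 \<le> c"
    and le: "\<And>f. f \<in> Lspace q \<Longrightarrow> Lnorm q (T f) \<le> c * Lnorm q f"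
  shows "multiplier_norm q m \<le> c"
proof -
  define T' where "T' = (SOME T. multiplier_extension q m T)"
  have T': "multiplier_extension q m T'" unfolding T'_def by (rule someI[of _ T]) (rule T)
  have "Lnorm q (T' f) / Lnorm q f \<le> c" if f: "f \<in> Lspace q" for f
  proof -
    have "T f \<in> borel_measurable lebesgue" "T' f \<in> borel_measurable lebesgue"
      using T T' f unfolding multiplier_extension_def bounded_operator_L_def by (auto simp: Lspace_def)
    moreover have "AE x in lebesgue. norm (T' f x) powr q = norm (T f x) powr q"
      using multiplier_extension_unique[OF q T' T f] by eventually_elim simp
    ultimately have "(LINT x|lebesgue. norm (T' f x) powr q) = (LINT x|lebesgue. norm (T f x) powr q)"
      by (intro integral_cong_AE) auto
    then have "Lnorm q (T' f) \<le> c * Lnorm q f" using le[OF f] by (simp add: Lnorm_def)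
    \<comment> \<open>When f has norm zero the quotient is 0 by division by zero, which is below c
      as well.\<close>
    then show ?thesis using c Lnorm_nonneg[of q f] by (cases "Lnorm q f = 0") (auto simp: divide_le_eq)
  qed
  then show ?thesis
    unfolding multiplier_norm_def onorm_L_def T'_def[symmetric]
    using Lspace_0 by (intro cSUP_least) auto
qed

text \<open>The differences have norms of order 4^(-j); even after multiplication by 2^j their q-th
  powers have summable integrals. So 2^j |u (Suc j) x - u j x| tends to 0 for almost every x, and
  the telescoping series is dominated by a geometric one.\<close>

lemma convergent_AE_if_summable_differences:
  fixes u :: "nat \<Rightarrow> real \<Rightarrow> complex"
  assumes q: "1 \<le> q" and u [measurable]: "\<And>j. u j \<in> borel_measurable borel" and c: "0 \<le> c"
    and le: "\<And>j. (\<integral>\<^sup>+x. ennreal (norm (u (Suc j) x - u j x) powr q) \<partial>lborel) \<le> ennreal (c * ((1/4) ^ j) powr q)"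
  shows "AE x in lborel. convergent (\<lambda>j. u j x)"
proof -
  let ?g = "\<lambda>j x. ennreal ((2 ^ j * norm (u (Suc j) x - u j x)) powr q)"
  have int: "(\<integral>\<^sup>+x. ?g j x \<partial>lborel) \<le> ennreal (c * (1/2) ^ j)" for j
  proof -
    have "(\<integral>\<^sup>+x. ?g j x \<partial>lborel) = (\<integral>\<^sup>+x. ennreal ((2 ^ j) powr q) * ennreal (norm (u (Suc j) x - u j x) powr q) \<partial>lborel)"
      by (intro nn_integral_cong) (simp add: powr_mult ennreal_mult)
    also have "\<dots> = ennreal ((2 ^ j) powr q) * (\<integral>\<^sup>+x. ennreal (norm (u (Suc j) x - u j x) powr q) \<partial>lborel)"
      by (rule nn_integral_cmult) measurable
    finally have 1: "(\<integral>\<^sup>+x. ?g j x \<partial>lborel) = ennreal ((2 ^ j) powr q) * (\<integral>\<^sup>+x. ennreal (norm (u (Suc j) x - u j x) powr q) \<partial>lborel)" .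
    have "ennreal ((2 ^ j) powr q) * (\<integral>\<^sup>+x. ennreal (norm (u (Suc j) x - u j x) powr q) \<partial>lborel) \<le> ennreal ((2 ^ j) powr q) * ennreal (c * ((1/4) ^ j) powr q)"
      by (intro mult_left_mono le) simp
    moreover have "ennreal ((2 ^ j) powr q) * ennreal (c * ((1/4) ^ j) powr q) = ennreal (c * ((1/2) ^ j) powr q)"
    proof -
      have "(2 ^ j :: real) powr q * ((1/4) ^ j) powr q = ((1/2) ^ j) powr q"
        by (simp add: powr_mult[symmetric] power_mult_distrib[symmetric])
      then have "(2 ^ j :: real) powr q * (c * ((1/4) ^ j) powr q) = c * ((1/2) ^ j) powr q"
        by (simp only: mult.left_commute[of _ c])
      then show ?thesis using c by (simp add: ennreal_mult[symmetric])
    qed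
    moreover have "ennreal (c * ((1/2) ^ j) powr q) \<le> ennreal (c * (1/2) ^ j)"
    proof (intro ennreal_leI mult_left_mono c)
      have "((1/2 :: real) ^ j) powr q \<le> ((1/2) ^ j) powr 1"
        using q by (intro powr_mono') (auto simp: power_le_one)
      then show "((1/2 :: real) ^ j) powr q \<le> (1/2) ^ j" by simp
    qed
    ultimately show ?thesis unfolding 1 by (simp only: order_trans)
  qed
  have "(\<integral>\<^sup>+x. (\<Sum>j. ?g j x) \<partial>lborel) = (\<Sum>j. \<integral>\<^sup>+x. ?g j x \<partial>lborel)"
    by (rule nn_integral_suminf) measurable
  moreover have "(\<Sum>j. \<integral>\<^sup>+x. ?g j x \<partial>lborel) \<le> (\<Sum>j. ennreal (c * (1/2) ^ j))"
    by (intro suminf_le int) auto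
  moreover have "(\<Sum>j. ennreal (c * (1/2) ^ j)) = ennreal (\<Sum>j. c * (1/2) ^ j)"
    by (rule suminf_ennreal2) (use c in \<open>auto intro!: summable_mult summable_geometric\<close>)
  ultimately have "(\<integral>\<^sup>+x. (\<Sum>j. ?g j x) \<partial>lborel) \<noteq> \<infinity>"
    by (simp only: infinity_ennreal_def) (auto simp: top_unique)
  then have "AE x in lborel. (\<Sum>j. ?g j x) \<noteq> \<infinity>"
    by (intro nn_integral_PInf_AE) auto
  then show ?thesis
  proof eventually_elim
    case (elim x)
    have "summable (\<lambda>j. (2 ^ j * norm (u (Suc j) x - u j x)) powr q)"
      by (rule summable_suminf_not_top) (use elim in auto)
    then have "(\<lambda>j. (2 ^ j * norm (u (Suc j) x - u j x)) powr q) \<longlonglongrightarrow> 0" by (rule summable_LIMSEQ_zero)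
    then have "\<forall>\<^sub>F j in sequentially. (2 ^ j * norm (u (Suc j) x - u j x)) powr q < 1"
      by (rule order_tendstoD(2)) simp
    then have ev: "\<forall>\<^sub>F j in sequentially. norm (u (Suc j) x - u j x) \<le> (1/2) ^ j"
    proof eventually_elim
      case (elim j)
      have "2 ^ j * norm (u (Suc j) x - u j x) \<le> 1"
      proof (rule ccontr)
        assume "\<not> ?thesis"
        then have "1 \<le> (2 ^ j * norm (u (Suc j) x - u j x)) powr q" using q by (intro ge_one_powr_ge_zero) auto
        then show False using elim by simp
      qed
      then show ?case by (simp add: power_one_over field_simps)
    qed
    have "summable (\<lambda>j. u (Suc j) x - u j x)"
      by (rule summable_comparison_test_ev[OF ev]) (simp add: summable_geometric)
    then have "convergent (\<lambda>n. \<Sum>j<n. (u (Suc j) x - u j x))" by (simp add: summable_iff_convergent)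
    then have "convergent (\<lambda>n. u n x - u 0 x)" using sum_lessThan_telescope[of "\<lambda>j. u j x"] by simp
    then have "convergent (\<lambda>n. (u n x - u 0 x) + u 0 x)" by (rule convergent_add) (rule convergent_const)
    then show ?case by simp
  qed
qed

text \<open>Equality holds at every x, not merely almost every one, since reflection and translation
  preserve null sets. Passing to another Borel representative therefore leaves the convolution
  unchanged.\<close>

lemma conv_cong_AE:
  fixes K f g :: "real \<Rightarrow> complex"
  assumes [measurable]: "f \<in> borel_measurable borel" "g \<in> borel_measurable borel" "K \<in> borel_measurable borel"
    and ae: "AE x in lborel. f x = g x"
  shows "conv K f x = conv K g x"
proof -
  have "AE y in lborel. f (x + (-1) * y) = g (x + (-1) * y)"
    by (rule AE_borel_affine[OF _ _ ae]) measurable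
  then have "AE y in lborel. K y * f (x - y) = K y * g (x - y)" by eventually_elim simp
  then show ?thesis unfolding conv_def by (intro integral_cong_AE) auto
qed

subsection \<open>Passage to infinite sequences\<close>

lemma fourier_eq_ftr:
  assumes g: "g \<in> borel_measurable borel" and ae: "AE x in lborel. f x = g x"
  shows "fourier f \<xi> = ftr g \<xi>"
proof -
  have "(\<lambda>x. g x * wave (- \<xi>) x) \<in> borel_measurable borel" using g by simp
  moreover have "AE x in lborel. f x * cis (- 2 * pi * \<xi> * x) = g x * wave (- \<xi>) x"
    using ae by eventually_elim (simp add: wave_def)
  ultimately show ?thesis unfolding fourier_def ftr_def by (rule lebesgue_lborel_AE(3))
qed

text \<open>One Borel representative per Lebesgue measurable function, so that an operator on
  functions can be defined by Borel convolutions.\<close>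

definition rep :: "(real \<Rightarrow> complex) \<Rightarrow> real \<Rightarrow> complex" where
  "rep f = (SOME g. g \<in> borel_measurable borel \<and> (AE x in lborel. f x = g x))"

lemma rep:
  assumes "f \<in> borel_measurable lebesgue"
  shows "rep f \<in> borel_measurable borel" "AE x in lborel. f x = rep f x"
proof -
  obtain g where "g \<in> borel_measurable borel" "AE x in lborel. f x = g x" by (rule borel_representative[OF assms])
  then have "rep f \<in> borel_measurable borel \<and> (AE x in lborel. f x = rep f x)"
    unfolding rep_def by (rule someI[where x=g, OF conjI])
  then show "rep f \<in> borel_measurable borel" "AE x in lborel. f x = rep f x" by blast+
qed

lemma rep_Lspace:
  assumes "f \<in> Lspace q"
  shows "rep f \<in> borel_measurable borel" "AE x in lborel. f x = rep f x"
    "integrable lborel (\<lambda>x. norm (rep f x) powr q)" "(LINT x|lborel. norm (rep f x) powr q) = (LINT x|lebesgue. norm (f x) powr q)"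
proof -
  have f: "f \<in> borel_measurable lebesgue" "integrable lebesgue (\<lambda>x. norm (f x) powr q)" using assms by (auto simp: Lspace_def)
  show r: "rep f \<in> borel_measurable borel" "AE x in lborel. f x = rep f x" by (rule rep[OF f(1)])+
  have m: "(\<lambda>x. norm (rep f x) powr q) \<in> borel_measurable borel" using r(1) by simp
  have "AE x in lborel. norm (f x) powr q = norm (rep f x) powr q" using r(2) by eventually_elim simp
  note * = lebesgue_lborel_AE[OF m this]
  show "integrable lborel (\<lambda>x. norm (rep f x) powr q)" using *(2) f(2) by simp
  show "(LINT x|lborel. norm (rep f x) powr q) = (LINT x|lebesgue. norm (f x) powr q)" using *(3) by simp
qed

text \<open>Here \<alpha> and \<beta> are strictly positive upper bounds for the two sequence norms
  rather than the norms themselves; the theorem takes them slightly larger than the norms and passes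
  to the limit.\<close>

locale multiplier_data =
  fixes p p' \<alpha> \<beta> :: real and S :: "real \<Rightarrow> complex" and \<phi> :: "int \<Rightarrow> complex"
  assumes p: "1 < p" and p': "1 / p + 1 / p' = 1"
    and S: "integrable lborel S" "\<And>u. u \<notin> {1/4..3/4} \<Longrightarrow> S u = 0"
    and \<alpha>: "0 < \<alpha>" and \<beta>: "0 < \<beta>"
    and a: "\<And>A. finite A \<Longrightarrow> (\<Sum>k\<in>A. norm (fcoef S k) powr p) \<le> \<alpha> powr p"
    and \<phi>: "\<And>F. finite F \<Longrightarrow> (\<Sum>n\<in>F. norm (\<phi> n) powr p') \<le> \<beta> powr p'"
begin

definition K :: "int set \<Rightarrow> real \<Rightarrow> complex" where
  "K F y = S y * trig_poly F \<phi> y"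

definition W :: "real \<Rightarrow> complex" where
  "W \<xi> = (\<Sum>\<^sub>\<infinity>n. \<phi> n * ftr S (\<xi> - of_int n))"

lemma K_integrable: "integrable lborel (K F)"
  unfolding K_def[abs_def] by (rule trig_poly_kernel[OF S(1)])

lemma K_measurable [measurable]: "K F \<in> borel_measurable borel"
  using borel_measurable_integrable[OF K_integrable] by simp

lemma ftr_trig_poly_kernel:
  "ftr (\<lambda>y. S y * trig_poly F \<psi> y) \<xi> = (\<Sum>n\<in>F. \<psi> n * ftr S (\<xi> - of_int n))"
proof -
  have eq: "S y * trig_poly F \<psi> y * wave (- \<xi>) y = (\<Sum>n\<in>F. \<psi> n * (S y * wave (- (\<xi> - of_int n)) y))" for y
    unfolding trig_poly_def sum_distrib_left sum_distrib_right
  proof (rule sum.cong[OF refl])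
    fix n
    have "wave (- (\<xi> - of_int n)) y = wave (of_int n + - \<xi>) y" by (simp add: algebra_simps)
    then show "S y * (\<psi> n * wave (of_int n) y) * wave (- \<xi>) y = \<psi> n * (S y * wave (- (\<xi> - of_int n)) y)"
      by (simp only: wave_add_left mult_ac)
  qed
  have i: "integrable lborel (\<lambda>y. \<psi> n * (S y * wave (- (\<xi> - of_int n)) y))" for n
    using integrable_mult_wave[OF S(1)] by simp
  have 1: "ftr (\<lambda>y. S y * trig_poly F \<psi> y) \<xi> = (LINT y|lborel. (\<Sum>n\<in>F. \<psi> n * (S y * wave (- (\<xi> - of_int n)) y)))"
    unfolding ftr_def by (rule Bochner_Integration.integral_cong[OF refl]) (rule eq)
  have 2: "(LINT y|lborel. (\<Sum>n\<in>F. \<psi> n * (S y * wave (- (\<xi> - of_int n)) y))) = (\<Sum>n\<in>F. LINT y|lborel. \<psi> n * (S y * wave (- (\<xi> - of_int n)) y))"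
    by (rule Bochner_Integration.integral_sum) (rule i)
  have 3: "(LINT y|lborel. \<psi> n * (S y * wave (- (\<xi> - of_int n)) y)) = \<psi> n * ftr S (\<xi> - of_int n)" for n
    unfolding ftr_def by (rule Bochner_Integration.integral_mult_right_zero)
  show ?thesis using 1 unfolding 2 3 .
qed

text \<open>A pointwise bound on the multiplier from the convolution bound at exponent 2. Convolving
  a character cut to [-1, 1] with a kernel supported in [1/4, 3/4] reproduces it on [0, 1],
  multiplied by the value of the transform. The cut character has squared norm 2, and 6 sqrt 2 is
  rounded up to 12.\<close>

lemma partial_sum_bound:
  assumes fin: "finite F" and b: "0 < b" and \<psi>: "(\<Sum>n\<in>F. norm (\<psi> n) powr p') \<le> b powr p'"
  shows "norm (\<Sum>n\<in>F. \<psi> n * ftr S (\<xi> - of_int n)) \<le> 12 * (\<alpha> * b)"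
proof -
  define k where "k y = S y * trig_poly F \<psi> y" for y
  define f where "f x = indicator {-1..1} x * wave \<xi> x" for x :: real
  have f [measurable]: "f \<in> borel_measurable borel" unfolding f_def[abs_def] by measurable
  have nf: "norm (f x) powr 2 = indicator {-1..1} x" for x by (simp add: f_def norm_mult indicator_def)
  have "integrable lborel (indicator {-1..1::real} :: real \<Rightarrow> real)"
    by (rule integrable_real_indicator) (auto simp: emeasure_lborel_Icc_eq)
  then have i: "integrable lborel (\<lambda>x. norm (f x) powr 2)" by (simp only: nf)
  have If: "(LINT x|lborel. norm (f x) powr 2) = 2" by (simp only: nf) simp
  have cf: "conv k f x = wave \<xi> x * ftr k \<xi>" if x: "x \<in> {0..1}" for x
  proof -
    have "k y * f (x - y) = wave \<xi> x * (k y * wave (- \<xi>) y)" for y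
    proof (cases "y \<in> {1/4..3/4}")
      case True
      then have "x - y \<in> {-1..1}" using x by auto
      then have "f (x - y) = wave \<xi> x * wave (- \<xi>) y" by (simp add: f_def wave_diff_right)
      then show ?thesis by (simp only: mult_ac)
    qed (simp add: k_def S(2))
    then show ?thesis unfolding conv_def ftr_def by (simp only: Bochner_Integration.integral_mult_right_zero)
  qed
  have 1: "(\<integral>\<^sup>+x. ennreal (norm (ftr k \<xi>) powr 2) * indicator {0..1::real} x \<partial>lborel) = ennreal (norm (ftr k \<xi>) powr 2)"
    by (subst nn_integral_cmult_indicator) (auto simp: emeasure_lborel_Icc_eq)
  have 2: "(\<integral>\<^sup>+x. ennreal (norm (ftr k \<xi>) powr 2) * indicator {0..1::real} x \<partial>lborel) \<le> (\<integral>\<^sup>+x. ennreal (norm (conv k f x) powr 2) \<partial>lborel)"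
  proof (rule nn_integral_mono)
    fix x :: real
    show "ennreal (norm (ftr k \<xi>) powr 2) * indicator {0..1::real} x \<le> ennreal (norm (conv k f x) powr 2)"
    proof (cases "x \<in> {0..1}")
      case True
      then have "norm (conv k f x) = norm (ftr k \<xi>)" by (simp only: cf norm_mult norm_wave mult_1_left)
      then show ?thesis using True by simp
    qed simp
  qed
  have 3: "(\<integral>\<^sup>+x. ennreal (norm (conv k f x) powr 2) \<partial>lborel) \<le> ennreal ((6 * (\<alpha> * b)) powr 2 * (LINT x|lborel. norm (f x) powr 2))"
    unfolding k_def[abs_def]
    by (rule conv_bound[OF p p' admissible_2[OF p] fin S \<alpha> b a \<psi> f i], assumption+)
  have "ennreal (norm (ftr k \<xi>) powr 2) \<le> ennreal ((6 * (\<alpha> * b)) powr 2 * 2)"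
    using order_trans[OF 2 3] unfolding 1 If .
  then have "norm (ftr k \<xi>) powr 2 \<le> (6 * (\<alpha> * b)) powr 2 * 2"
    by (subst (asm) ennreal_le_iff) auto
  moreover have "(6 * (\<alpha> * b)) powr 2 * 2 \<le> (12 * (\<alpha> * b)) powr 2"
    using \<alpha> b by (simp add: power_mult_distrib)
  ultimately have "norm (ftr k \<xi>) powr 2 \<le> (12 * (\<alpha> * b)) powr 2" by linarith
  then have "(norm (ftr k \<xi>))\<^sup>2 \<le> (12 * (\<alpha> * b))\<^sup>2" using \<alpha> b by simp
  then have "norm (ftr k \<xi>) \<le> 12 * (\<alpha> * b)" by (rule power2_le_imp_le) (use \<alpha> b in simp)
  then show ?thesis unfolding k_def[abs_def] ftr_trig_poly_kernel .
qed

text \<open>Rotating the phases of \<open>\<phi>\<close> makes every term nonnegative without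
  changing |\<phi> n|, so \<open>partial_sum_bound\<close> bounds all finite sums of absolute
  values.\<close>

lemma W_abs_summable: "(\<lambda>n. norm (\<phi> n * ftr S (\<xi> - of_int n))) summable_on UNIV"
proof (rule nonneg_bdd_above_summable_on)
  let ?z = "\<lambda>n. \<phi> n * ftr S (\<xi> - of_int n)"
  define \<psi> where "\<psi> n = \<phi> n * (if ?z n = 0 then 1 else cnj (sgn (?z n)))" for n
  have n\<psi>: "norm (\<psi> n) = norm (\<phi> n)" for n by (simp add: \<psi>_def norm_mult norm_sgn)
  have z\<psi>: "\<psi> n * ftr S (\<xi> - of_int n) = of_real (norm (?z n))" for n
  proof (cases "?z n = 0")
    case True
    have "\<psi> n * ftr S (\<xi> - of_int n) = ?z n * (if ?z n = 0 then 1 else cnj (sgn (?z n)))"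
      unfolding \<psi>_def by (simp only: mult_ac)
    then show ?thesis unfolding True by simp
  next
    case False
    have "\<psi> n * ftr S (\<xi> - of_int n) = ?z n * cnj (sgn (?z n))" using False by (simp add: \<psi>_def mult_ac)
    also have "\<dots> = ?z n * cnj (?z n) / of_real (norm (?z n))" by (simp add: sgn_eq)
    also have "\<dots> = of_real (norm (?z n))"
      unfolding complex_norm_square[symmetric] using False by (simp add: power2_eq_square)
    finally show ?thesis .
  qed
  have "(\<Sum>n\<in>F. norm (?z n)) \<le> 12 * (\<alpha> * \<beta>)" if F: "finite F" for F
  proof -
    have "norm (\<Sum>n\<in>F. \<psi> n * ftr S (\<xi> - of_int n)) \<le> 12 * (\<alpha> * \<beta>)"
      by (rule partial_sum_bound[OF F \<beta>]) (simp add: n\<psi> \<phi>[OF F])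
    moreover have "norm (\<Sum>n\<in>F. \<psi> n * ftr S (\<xi> - of_int n)) = (\<Sum>n\<in>F. norm (?z n))"
      unfolding z\<psi> of_real_sum[symmetric] norm_of_real by (simp add: sum_nonneg)
    ultimately show ?thesis by simp
  qed
  then show "bdd_above (sum (\<lambda>n. norm (?z n)) ` {F. F \<subseteq> UNIV \<and> finite F})"
    by (intro bdd_aboveI2) auto
qed simp

lemma W_summable: "(\<lambda>n. \<phi> n * ftr S (\<xi> - of_int n)) summable_on UNIV"
  by (rule abs_summable_summable[OF W_abs_summable])

lemma tail_bound:
  assumes e: "0 < e"
  shows "\<exists>N::nat. \<forall>G. finite G \<longrightarrow> G \<inter> {- int N..int N} = {} \<longrightarrow> (\<Sum>n\<in>G. norm (\<phi> n) powr p') \<le> e"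
proof -
  let ?h = "\<lambda>n. norm (\<phi> n) powr p'"
  have sm: "?h summable_on UNIV"
    by (rule nonneg_bdd_above_summable_on) (use \<phi> in \<open>auto intro!: bdd_aboveI2\<close>)
  obtain X where X: "finite X" "dist (sum ?h X) (infsum ?h UNIV) \<le> e"
    using infsum_finite_approximation[OF sm e] by auto
  define N where "N = nat (\<Sum>x\<in>X. \<bar>x\<bar>)"
  have XN: "X \<subseteq> {- int N..int N}"
  proof
    fix x assume "x \<in> X"
    then have "\<bar>x\<bar> \<le> (\<Sum>x\<in>X. \<bar>x\<bar>)" by (rule member_le_sum) (use X in auto)
    then show "x \<in> {- int N..int N}" unfolding N_def by auto
  qed
  have "sum ?h G \<le> e" if G: "finite G" "G \<inter> {- int N..int N} = {}" for G
  proof -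
    have "sum ?h X + sum ?h G = sum ?h (X \<union> G)"
      using X G XN by (intro sum.union_disjoint[symmetric]) auto
    moreover have "sum ?h (X \<union> G) \<le> infsum ?h UNIV"
      by (rule finite_sum_le_infsum[OF sm]) (use X G in auto)
    ultimately show ?thesis using X(2) unfolding dist_real_def by linarith
  qed
  then show ?thesis by blast
qed

definition cutoff :: "nat \<Rightarrow> nat" where
  "cutoff j = (SOME N::nat. \<forall>G. finite G \<longrightarrow> G \<inter> {- int N..int N} = {} \<longrightarrow> (\<Sum>n\<in>G. norm (\<phi> n) powr p') \<le> ((1/4) ^ j) powr p')"

lemma cutoff:
  "finite G \<Longrightarrow> G \<inter> {- int (cutoff j)..int (cutoff j)} = {} \<Longrightarrow> (\<Sum>n\<in>G. norm (\<phi> n) powr p') \<le> ((1/4) ^ j) powr p'"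
proof -
  have "\<forall>G. finite G \<longrightarrow> G \<inter> {- int (cutoff j)..int (cutoff j)} = {} \<longrightarrow> (\<Sum>n\<in>G. norm (\<phi> n) powr p') \<le> ((1/4) ^ j) powr p'"
    unfolding cutoff_def by (rule someI_ex) (rule tail_bound, simp)
  then show "finite G \<Longrightarrow> G \<inter> {- int (cutoff j)..int (cutoff j)} = {} \<Longrightarrow> (\<Sum>n\<in>G. norm (\<phi> n) powr p') \<le> ((1/4) ^ j) powr p'"
    by blast
qed

text \<open>The increasing exhaustion \<open>F\<close> of the integers leaves \<open>\<ell>\<^sub>p\<^sub>'\<close>-tails of size \<open>4\<^sup>-\<^sup>j\<close>, fast enough
  for the truncated operators to converge almost everywhere, simultaneously for all \<open>f\<close>.\<close>

definition radius :: "nat \<Rightarrow> nat" where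
  "radius j = (\<Sum>i\<le>j. cutoff i) + j"

definition F :: "nat \<Rightarrow> int set" where
  "F j = {- int (radius j)..int (radius j)}"

lemma radius: "j \<le> radius j" "cutoff j \<le> radius j" "radius j \<le> radius (Suc j)"
  using member_le_sum[of j "{..j}" cutoff] by (simp_all add: radius_def)

lemma finite_F [simp]: "finite (F j)"
  by (simp add: F_def)

lemma F_mono: "F j \<subseteq> F (Suc j)"
  using radius(3)[of j] by (auto simp: F_def)

lemma F_tail: "finite G \<Longrightarrow> G \<inter> F j = {} \<Longrightarrow> (\<Sum>n\<in>G. norm (\<phi> n) powr p') \<le> ((1/4) ^ j) powr p'"
proof (rule cutoff)
  assume "G \<inter> F j = {}"
  moreover have "{- int (cutoff j)..int (cutoff j)} \<subseteq> F j" using radius(2)[of j] unfolding F_def by auto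
  ultimately show "G \<inter> {- int (cutoff j)..int (cutoff j)} = {}" by blast
qed

lemma F_exhausts: "filterlim F (finite_subsets_at_top UNIV) sequentially"
  unfolding filterlim_finite_subsets_at_top
proof (intro allI impI)
  fix X :: "int set" assume X: "finite X \<and> X \<subseteq> UNIV"
  define N where "N = nat (\<Sum>x\<in>X. \<bar>x\<bar>)"
  have "X \<subseteq> F j" if j: "N \<le> j" for j
  proof
    fix x assume "x \<in> X"
    then have "\<bar>x\<bar> \<le> (\<Sum>x\<in>X. \<bar>x\<bar>)" by (rule member_le_sum) (use X in auto)
    then have "\<bar>x\<bar> \<le> int (radius j)" using j radius(1)[of j] unfolding N_def by linarith
    then show "x \<in> F j" unfolding F_def by auto
  qed
  then show "\<forall>\<^sub>F y in sequentially. finite (F y) \<and> X \<subseteq> F y \<and> F y \<subseteq> UNIV"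
    unfolding eventually_sequentially by auto
qed

lemma ftr_K_tendsto: "(\<lambda>j. ftr (K (F j)) \<xi>) \<longlonglongrightarrow> W \<xi>"
proof -
  have "((\<lambda>n. \<phi> n * ftr S (\<xi> - of_int n)) has_sum W \<xi>) UNIV"
    unfolding W_def by (rule has_sum_infsum[OF W_summable])
  then have "(sum (\<lambda>n. \<phi> n * ftr S (\<xi> - of_int n)) \<longlongrightarrow> W \<xi>) (finite_subsets_at_top UNIV)"
    by (simp only: has_sum_def)
  from filterlim_compose[OF this F_exhausts] show ?thesis
    unfolding K_def[abs_def] ftr_trig_poly_kernel .
qed

lemma norm_ftr_K: "norm (ftr (K (F j)) \<xi>) \<le> 12 * (\<alpha> * \<beta>)"
  unfolding K_def[abs_def] ftr_trig_poly_kernel by (rule partial_sum_bound[OF finite_F \<beta> \<phi>[OF finite_F]])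

lemma norm_W: "norm (W \<xi>) \<le> 12 * (\<alpha> * \<beta>)"
  by (rule tendsto_upperbound[OF tendsto_norm[OF ftr_K_tendsto]]) (auto simp: norm_ftr_K)

lemma ftr_K_measurable [measurable]: "ftr (K G) \<in> borel_measurable borel"
  by (rule ftr_measurable[OF K_integrable])

lemma W_measurable [measurable]: "W \<in> borel_measurable borel"
  by (rule borel_measurable_LIMSEQ_metric[OF ftr_K_measurable ftr_K_tendsto])

lemma W_Linfty: "W \<in> Linfty"
  unfolding Linfty_def using norm_W measurable_completion[of W lborel borel] W_measurable by auto

text \<open>Insert the inversion formula for f and exchange the integrals: on Schwartz functions
  convolution is multiplication on the Fourier side, now as a pointwise identity.\<close>

lemma conv_K_schwartz:
  assumes f: "f \<in> schwartz"
  shows "conv (K G) f x = (LINT \<xi>|lborel. ftr f \<xi> * (ftr (K G) \<xi> * wave \<xi> x))"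
proof -
  have if': "integrable lborel (ftr f)" by (rule ftr_schwartz_integrable[OF f])
  have "conv (K G) f x = (LINT y|lborel. LINT \<xi>|lborel. ftr f \<xi> * K G y * wave \<xi> (x - y))"
  proof -
    have "(LINT \<xi>|lborel. ftr f \<xi> * K G y * wave \<xi> (x - y)) = K G y * f (x - y)" for y
    proof -
      have "(LINT \<xi>|lborel. ftr f \<xi> * K G y * wave \<xi> (x - y)) = (LINT \<xi>|lborel. K G y * (ftr f \<xi> * wave \<xi> (x - y)))"
        by (simp only: mult_ac)
      then show ?thesis by (simp only: Bochner_Integration.integral_mult_right_zero fourier_inversion[OF f])
    qed
    then show ?thesis unfolding conv_def by (simp only:)
  qed
  moreover have "\<dots> = (LINT \<xi>|lborel. LINT y|lborel. ftr f \<xi> * K G y * wave \<xi> (x - y))"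
  proof (rule fubini_bounded(2)[OF K_integrable if', where C=1, symmetric])
    show "(\<lambda>(\<xi>, y). wave \<xi> (x - y)) \<in> borel_measurable (lborel \<Otimes>\<^sub>M lborel)"
      unfolding wave_def cis_conv_exp by measurable
  qed simp
  moreover have "(LINT y|lborel. ftr f \<xi> * K G y * wave \<xi> (x - y)) = ftr f \<xi> * (ftr (K G) \<xi> * wave \<xi> x)" for \<xi>
  proof -
    have "(LINT y|lborel. ftr f \<xi> * K G y * wave \<xi> (x - y)) = (LINT y|lborel. (ftr f \<xi> * wave \<xi> x) * (K G y * wave (- \<xi>) y))"
      by (simp only: wave_diff_right mult_ac)
    then show ?thesis unfolding Bochner_Integration.integral_mult_right_zero ftr_def[symmetric] by (simp only: mult_ac)
  qed
  ultimately show ?thesis by (simp only:)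
qed

lemma conv_K_schwartz_tendsto:
  assumes f: "f \<in> schwartz"
  shows "(\<lambda>j. conv (K (F j)) f x) \<longlonglongrightarrow> (LINT \<xi>|lborel. ftr f \<xi> * (W \<xi> * wave \<xi> x))"
proof -
  have if': "integrable lborel (ftr f)" by (rule ftr_schwartz_integrable[OF f])
  have [measurable]: "ftr f \<in> borel_measurable borel" using if' by (auto dest: borel_measurable_integrable)
  have [measurable]: "(\<lambda>\<xi>. wave \<xi> x) \<in> borel_measurable borel" unfolding wave_def cis_conv_exp by measurable
  have dom: "integrable lborel (\<lambda>\<xi>. 12 * (\<alpha> * \<beta>) * norm (ftr f \<xi>))" using if' by simp
  show ?thesis unfolding conv_K_schwartz[OF f]
  proof (rule integral_dominated_convergence[OF _ _ dom])
    show "AE \<xi> in lborel. (\<lambda>j. ftr f \<xi> * (ftr (K (F j)) \<xi> * wave \<xi> x)) \<longlonglongrightarrow> ftr f \<xi> * (W \<xi> * wave \<xi> x)"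
      by (intro AE_I2 tendsto_mult tendsto_const ftr_K_tendsto)
    show "AE \<xi> in lborel. norm (ftr f \<xi> * (ftr (K (F j)) \<xi> * wave \<xi> x)) \<le> 12 * (\<alpha> * \<beta>) * norm (ftr f \<xi>)" for j
      using mult_left_mono[OF norm_ftr_K norm_ge_zero] by (intro AE_I2) (simp add: norm_mult mult.commute)
  qed measurable
qed

text \<open>A pointwise limit along a sequence that is the same for all f, which is what makes
  \<open>T\<close> linear almost everywhere. Where the limit fails to exist, a null set for f in the
  spaces considered, the value is arbitrary.\<close>

definition T :: "(real \<Rightarrow> complex) \<Rightarrow> real \<Rightarrow> complex" where
  "T f x = lim (\<lambda>j. conv (K (F j)) (rep f) x)"

lemma conv_difference:
  assumes x: "\<And>G. finite G \<Longrightarrow> integrable lborel (\<lambda>y. K G y * g (x - y))"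
  shows "conv (K (F (Suc j))) g x - conv (K (F j)) g x = conv (K (F (Suc j) - F j)) g x"
proof -
  have "K (F (Suc j)) y = K (F j) y + K (F (Suc j) - F j) y" for y
    using sum.subset_diff[OF F_mono[of j] finite_F[of "Suc j"], of "\<lambda>k. \<phi> k * wave (of_int k) y"]
    by (simp add: K_def trig_poly_def algebra_simps)
  then have "conv (K (F (Suc j))) g x = (LINT y|lborel. K (F j) y * g (x - y) + K (F (Suc j) - F j) y * g (x - y))"
    unfolding conv_def by (simp only: distrib_right)
  also have "\<dots> = conv (K (F j)) g x + conv (K (F (Suc j) - F j)) g x"
    unfolding conv_def by (rule Bochner_Integration.integral_add) (rule x, simp)+
  finally show ?thesis by simp
qed

lemma conv_K_bound:
  assumes adm: "admissible p q" and G: "finite G" and b: "0 < b" "(\<Sum>n\<in>G. norm (\<phi> n) powr p') \<le> b powr p'"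
    and g: "g \<in> borel_measurable borel" "integrable lborel (\<lambda>x. norm (g x) powr q)"
  shows "(\<integral>\<^sup>+x. ennreal (norm (conv (K G) g x) powr q) \<partial>lborel) \<le> ennreal ((6 * (\<alpha> * b)) powr q * (LINT x|lborel. norm (g x) powr q))"
  unfolding K_def[abs_def]
  by (rule conv_bound[OF p p' adm G S \<alpha> b(1) a b(2) g], assumption+)

lemma conv_K_integrable_AE:
  assumes adm: "admissible p q" and g: "g \<in> borel_measurable borel" "integrable lborel (\<lambda>x. norm (g x) powr q)"
  shows "AE x in lborel. \<forall>G. integrable lborel (\<lambda>y. K G y * g (x - y))"
  using conv_integrable_AE[OF S(1) g(1) admissible_ge_1(1)[OF p adm] g(2)]
proof eventually_elim
  case (elim x)
  have "K G y * g (x - y) = S y * g (x - y) * trig_poly G \<phi> y" for G y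
    by (simp add: K_def mult_ac)
  then show ?case using trig_poly_kernel[OF elim] by (simp only: simp_thms)
qed

text \<open>Consecutive kernels differ by the kernel of a finite set disjoint from
  \<open>F j\<close>. The choice of \<open>F\<close> bounds its coefficients by (1/4)^j in norm, and
  \<open>conv_K_bound\<close> turns this into the decay required of the differences.\<close>

lemma conv_K_convergent_AE:
  assumes adm: "admissible p q" and g: "g \<in> borel_measurable borel" "integrable lborel (\<lambda>x. norm (g x) powr q)"
  shows "AE x in lborel. convergent (\<lambda>j. conv (K (F j)) g x)"
proof (rule convergent_AE_if_summable_differences[where c="(6 * \<alpha>) powr q * (LINT x|lborel. norm (g x) powr q)"])
  show "1 \<le> q" by (rule admissible_ge_1(1)[OF p adm])
  show "conv (K (F j)) g \<in> borel_measurable borel" for j using g(1) by measurable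
  show "0 \<le> (6 * \<alpha>) powr q * (LINT x|lborel. norm (g x) powr q)" by simp
  fix j
  have ae: "AE x in lborel. ennreal (norm (conv (K (F (Suc j))) g x - conv (K (F j)) g x) powr q) = ennreal (norm (conv (K (F (Suc j) - F j)) g x) powr q)"
    using conv_K_integrable_AE[OF adm g]
  proof eventually_elim
    case (elim x)
    then have "conv (K (F (Suc j))) g x - conv (K (F j)) g x = conv (K (F (Suc j) - F j)) g x"
      by (intro conv_difference) blast
    then show ?case by (simp only:)
  qed
  have "(\<integral>\<^sup>+x. ennreal (norm (conv (K (F (Suc j) - F j)) g x) powr q) \<partial>lborel) \<le> ennreal ((6 * (\<alpha> * (1/4) ^ j)) powr q * (LINT x|lborel. norm (g x) powr q))"
    by (rule conv_K_bound[OF adm _ _ F_tail g]) auto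
  moreover have "(6 * (\<alpha> * (1/4) ^ j)) powr q = (6 * \<alpha>) powr q * ((1/4) ^ j) powr q"
    unfolding powr_mult[symmetric] by (simp only: mult.assoc)
  ultimately show "(\<integral>\<^sup>+x. ennreal (norm (conv (K (F (Suc j))) g x - conv (K (F j)) g x) powr q) \<partial>lborel)
      \<le> ennreal ((6 * \<alpha>) powr q * (LINT x|lborel. norm (g x) powr q) * ((1/4) ^ j) powr q)"
    unfolding nn_integral_cong_AE[OF ae] by (simp add: mult_ac)
qed

lemma T_LIMSEQ_AE:
  assumes adm: "admissible p q" and f: "f \<in> Lspace q"
  shows "AE x in lborel. (\<lambda>j. conv (K (F j)) (rep f) x) \<longlonglongrightarrow> T f x"
  using conv_K_convergent_AE[OF adm rep_Lspace(1,3)[OF f]]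
  by eventually_elim (simp add: T_def convergent_LIMSEQ_iff)

lemma T_measurable:
  assumes "f \<in> borel_measurable lebesgue"
  shows "T f \<in> borel_measurable borel"
proof -
  have [measurable]: "rep f \<in> borel_measurable borel" by (rule rep(1)[OF assms])
  show ?thesis unfolding T_def[abs_def] by measurable
qed

text \<open>Fatou's lemma along the almost everywhere convergence; the bound for the finite kernels
  is uniform because \<beta> bounds every finite part of \<open>\<phi>\<close>.\<close>

lemma T_bounds:
  assumes adm: "admissible p q" and f: "f \<in> Lspace q"
  shows "T f \<in> Lspace q" "Lnorm q (T f) \<le> 6 * (\<alpha> * \<beta>) * Lnorm q f"
proof -
  have q: "1 \<le> q" by (rule admissible_ge_1(1)[OF p adm])
  note g = rep_Lspace[OF f]
  have [measurable]: "rep f \<in> borel_measurable borel" by (rule g(1))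
  have Tm [measurable]: "T f \<in> borel_measurable borel" using f by (intro T_measurable) (simp add: Lspace_def)
  define J where "J = (LINT x|lborel. norm (rep f x) powr q)"
  have J0: "0 \<le> J" by (simp add: J_def)
  let ?c = "(6 * (\<alpha> * \<beta>)) powr q * J"
  have 1: "(\<integral>\<^sup>+x. ennreal (norm (T f x) powr q) \<partial>lborel) = (\<integral>\<^sup>+x. liminf (\<lambda>j. ennreal (norm (conv (K (F j)) (rep f) x) powr q)) \<partial>lborel)"
  proof (rule nn_integral_cong_AE)
    show "AE x in lborel. ennreal (norm (T f x) powr q) = liminf (\<lambda>j. ennreal (norm (conv (K (F j)) (rep f) x) powr q))"
      using T_LIMSEQ_AE[OF adm f]
    proof eventually_elim
      case (elim x)
      have "(\<lambda>j. ennreal (norm (conv (K (F j)) (rep f) x) powr q)) \<longlonglongrightarrow> ennreal (norm (T f x) powr q)"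
        using q elim by (intro tendsto_ennrealI tendsto_powr' tendsto_norm tendsto_const) auto
      then show ?case by (rule lim_imp_Liminf[OF trivial_limit_sequentially, symmetric])
    qed
  qed
  have 2: "(\<integral>\<^sup>+x. liminf (\<lambda>j. ennreal (norm (conv (K (F j)) (rep f) x) powr q)) \<partial>lborel) \<le> liminf (\<lambda>j. \<integral>\<^sup>+x. ennreal (norm (conv (K (F j)) (rep f) x) powr q) \<partial>lborel)"
    by (rule nn_integral_liminf) measurable
  have 3: "liminf (\<lambda>j. \<integral>\<^sup>+x. ennreal (norm (conv (K (F j)) (rep f) x) powr q) \<partial>lborel) \<le> ennreal ?c"
    by (rule Liminf_le) (auto simp: J_def intro!: always_eventually conv_K_bound[OF adm finite_F \<beta> \<phi>[OF finite_F] g(1,3)])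
  have nn: "(\<integral>\<^sup>+x. ennreal (norm (T f x) powr q) \<partial>lborel) \<le> ennreal ?c"
    unfolding 1 by (rule order_trans[OF 2 3])
  have i: "integrable lborel (\<lambda>x. norm (T f x) powr q)"
  proof (rule integrableI_bounded)
    have "(\<integral>\<^sup>+x. ennreal (norm (norm (T f x) powr q)) \<partial>lborel) \<le> ennreal ?c" using nn by simp
    then show "(\<integral>\<^sup>+x. ennreal (norm (norm (T f x) powr q)) \<partial>lborel) < \<infinity>"
      by (rule le_less_trans) simp
  qed measurable
  have "ennreal (LINT x|lborel. norm (T f x) powr q) \<le> ennreal ?c"
    using nn nn_integral_eq_integral[OF i] by simp
  then have le: "(LINT x|lborel. norm (T f x) powr q) \<le> ?c"
    using J0 by (subst (asm) ennreal_le_iff) auto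
  show "T f \<in> Lspace q" by (rule Lspace_borelI(1)[OF Tm AE_I2[OF refl] i])
  have eq: "(LINT x|lebesgue. norm (T f x) powr q) = (LINT x|lborel. norm (T f x) powr q)"
    by (rule Lspace_borelI(2)[OF Tm AE_I2[OF refl] i])
  have "Lnorm q (T f) \<le> ?c powr (1 / q)"
    unfolding Lnorm_def eq using le q by (intro powr_mono2) auto
  also have "?c powr (1 / q) = 6 * (\<alpha> * \<beta>) * J powr (1 / q)"
    using q \<alpha> \<beta> by (simp add: powr_mult powr_powr)
  finally show "Lnorm q (T f) \<le> 6 * (\<alpha> * \<beta>) * Lnorm q f"
    unfolding Lnorm_def g(4)[symmetric] J_def .
qed

text \<open>The truncated multipliers converge pointwise under the common bound 12 \<alpha> \<beta>,
  and the transform of f is integrable. So the convolutions converge at every point to the inverse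
  transform with multiplier \<open>W\<close>, and this limit is \<open>T f x\<close>.\<close>

lemma T_schwartz:
  assumes f: "f \<in> schwartz"
  shows "T f x = inv_fourier (\<lambda>\<xi>. W \<xi> * fourier f \<xi>) x"
proof -
  have fm: "f \<in> borel_measurable borel" using schwartzE[OF f] by metis
  then have fl: "f \<in> borel_measurable lebesgue" by (intro measurable_completion) simp
  have "AE x in lborel. rep f x = f x" using rep(2)[OF fl] by (auto elim: eventually_mono)
  then have "conv (K (F j)) (rep f) x = conv (K (F j)) f x" for j
    by (rule conv_cong_AE[OF rep(1)[OF fl] fm K_measurable])
  then have 1: "T f x = (LINT \<xi>|lborel. ftr f \<xi> * (W \<xi> * wave \<xi> x))"
    unfolding T_def using conv_K_schwartz_tendsto[OF f, of x] by (simp add: limI)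
  have [measurable]: "ftr f \<in> borel_measurable borel"
    using borel_measurable_integrable[OF ftr_schwartz_integrable[OF f]] by simp
  have [measurable]: "(\<lambda>\<xi>. wave \<xi> x) \<in> borel_measurable borel" unfolding wave_def cis_conv_exp by measurable
  have "inv_fourier (\<lambda>\<xi>. W \<xi> * fourier f \<xi>) x = (LINT \<xi>|lborel. ftr f \<xi> * (W \<xi> * wave \<xi> x))"
    unfolding inv_fourier_def
  proof (rule lebesgue_lborel_AE(3))
    show "(\<lambda>\<xi>. ftr f \<xi> * (W \<xi> * wave \<xi> x)) \<in> borel_measurable borel" by measurable
    show "AE \<xi> in lborel. W \<xi> * fourier f \<xi> * cis (2 * pi * \<xi> * x) = ftr f \<xi> * (W \<xi> * wave \<xi> x)"
      by (intro AE_I2) (simp add: fourier_eq_ftr[OF fm AE_I2[OF refl]] wave_def)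
  qed
  with 1 show ?thesis by simp
qed

text \<open>At a point where both limits exist and all convolutions are absolutely integrable, the
  sequence for the sum is the sum of the two sequences, so its limit exists and splits.\<close>

lemma T_add:
  assumes adm: "admissible p q" and f: "f \<in> Lspace q" and h: "h \<in> Lspace q"
  shows "AE x in lebesgue. T (\<lambda>y. f y + h y) x = T f x + T h x"
proof -
  have fl: "f \<in> borel_measurable lebesgue" and hl: "h \<in> borel_measurable lebesgue" using f h by (auto simp: Lspace_def)
  have sl: "(\<lambda>y. f y + h y) \<in> borel_measurable lebesgue" using fl hl by simp
  have m: "(\<lambda>y. rep f y + rep h y) \<in> borel_measurable borel" using rep(1)[OF fl] rep(1)[OF hl] by simp
  have "AE x in lborel. rep (\<lambda>y. f y + h y) x = rep f x + rep h x"
    using rep(2)[OF fl] rep(2)[OF hl] rep(2)[OF sl] by eventually_elim simp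
  then have c: "conv (K (F j)) (rep (\<lambda>y. f y + h y)) x = conv (K (F j)) (\<lambda>y. rep f y + rep h y) x" for j x
    by (rule conv_cong_AE[OF rep(1)[OF sl] m K_measurable])
  have "AE x in lborel. T (\<lambda>y. f y + h y) x = T f x + T h x"
    using T_LIMSEQ_AE[OF adm f] T_LIMSEQ_AE[OF adm h] conv_K_integrable_AE[OF adm rep_Lspace(1,3)[OF f]]
      conv_K_integrable_AE[OF adm rep_Lspace(1,3)[OF h]]
  proof eventually_elim
    case (elim x)
    have "conv (K (F j)) (\<lambda>y. rep f y + rep h y) x = conv (K (F j)) (rep f) x + conv (K (F j)) (rep h) x" for j
      unfolding conv_def distrib_left using elim(3,4) by (intro Bochner_Integration.integral_add) blast+
    then show ?case
      unfolding T_def[of "\<lambda>y. f y + h y"] c using tendsto_add[OF elim(1,2)] by (simp only: limI)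
  qed
  then show ?thesis by (rule AE_completion)
qed

lemma T_scale:
  assumes adm: "admissible p q" and f: "f \<in> Lspace q"
  shows "AE x in lebesgue. T (\<lambda>y. c * f y) x = c * T f x"
proof -
  have fl: "f \<in> borel_measurable lebesgue" using f by (auto simp: Lspace_def)
  have sl: "(\<lambda>y. c * f y) \<in> borel_measurable lebesgue" using fl by simp
  have m: "(\<lambda>y. c * rep f y) \<in> borel_measurable borel" using rep(1)[OF fl] by simp
  have "AE x in lborel. rep (\<lambda>y. c * f y) x = c * rep f x"
    using rep(2)[OF fl] rep(2)[OF sl] by eventually_elim simp
  then have e: "conv (K (F j)) (rep (\<lambda>y. c * f y)) x = conv (K (F j)) (\<lambda>y. c * rep f y) x" for j x
    by (rule conv_cong_AE[OF rep(1)[OF sl] m K_measurable])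
  have "conv (K (F j)) (\<lambda>y. c * rep f y) x = c * conv (K (F j)) (rep f) x" for j x
    unfolding conv_def mult.left_commute[of _ c] by (rule Bochner_Integration.integral_mult_right_zero)
  note e' = trans[OF e this]
  have "AE x in lborel. T (\<lambda>y. c * f y) x = c * T f x"
    using T_LIMSEQ_AE[OF adm f]
  proof eventually_elim
    case (elim x)
    show ?case
      unfolding T_def[of "\<lambda>y. c * f y"] e' by (rule limI) (rule tendsto_mult[OF tendsto_const elim])
  qed
  then show ?thesis by (rule AE_completion)
qed

lemma W_multiplier:
  assumes adm: "admissible p q"
  shows "W \<in> multipliers q" "multiplier_norm q W \<le> 6 * (\<alpha> * \<beta>)"
proof -
  have q: "1 \<le> q" by (rule admissible_ge_1(1)[OF p adm])
  have ext: "multiplier_extension q W T"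
    unfolding multiplier_extension_def bounded_operator_L_def
    using T_bounds[OF adm] T_add[OF adm] T_scale[OF adm] T_schwartz by (auto intro!: exI[of _ "6 * (\<alpha> * \<beta>)"])
  then show "W \<in> multipliers q" using W_Linfty unfolding multipliers_def by blast
  show "multiplier_norm q W \<le> 6 * (\<alpha> * \<beta>)"
    by (rule multiplier_norm_le[OF q ext]) (use \<alpha> \<beta> T_bounds(2)[OF adm] in auto)
qed

end

section \<open>Reduction of the original data to Borel data with positive bounds\<close>

lemma finite_sum_le_lnorm:
  assumes r: "1 < r" and b: "b \<in> lspace r" and A: "finite A" and e: "0 < e"
  shows "(\<Sum>n\<in>A. norm (b n) powr r) \<le> (lnorm r b + e) powr r"
proof -
  have sm: "(\<lambda>n. norm (b n) powr r) summable_on UNIV" using b by (simp add: lspace_def)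
  have "(\<Sum>n\<in>A. norm (b n) powr r) \<le> (\<Sum>\<^sub>\<infinity>n. norm (b n) powr r)"
    by (rule finite_sum_le_infsum[OF sm A]) auto
  moreover have "0 \<le> (\<Sum>\<^sub>\<infinity>n. norm (b n) powr r)" by (rule infsum_nonneg) simp
  then have "(\<Sum>\<^sub>\<infinity>n. norm (b n) powr r) = lnorm r b powr r" using r by (simp add: lnorm_def powr_powr)
  moreover have "lnorm r b powr r \<le> (lnorm r b + e) powr r"
    using r e by (intro powr_mono2) (auto simp: lnorm_def)
  ultimately show ?thesis by linarith
qed

text \<open>The essential support condition allows a Borel representative that vanishes everywhere
  outside [1/4, 3/4]. For it the coefficients of the periodic extension over one period become
  integrals over the line.\<close>

lemma kernel_representative:
  assumes S: "integrable lebesgue S" "ess_support S \<subseteq> {1/4..3/4}"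
  obtains S' where "integrable lborel S'" "\<And>u. u \<notin> {1/4..3/4} \<Longrightarrow> S' u = 0" "fourier S = ftr S'"
    "fcoef S' = fourier_coeff (per_ext S)"
proof -
  obtain g where g: "g \<in> borel_measurable borel" "AE x in lborel. S x = g x"
    by (rule borel_representative[OF borel_measurable_integrable[OF S(1)]])
  define S' where "S' x = (if x \<in> {1/4..3/4} then g x else 0)" for x
  have m: "S' \<in> borel_measurable borel" unfolding S'_def[abs_def] using g(1) by measurable
  have "AE x in lebesgue. x \<notin> {1/4..3/4} \<longrightarrow> S x = 0"
    using S(2) ess_support_subset_iff[of "{1/4..3/4}" S] by simp
  moreover have "AE x in lebesgue. S x = g x" using g(2) by (rule AE_completion)
  ultimately have ae': "AE x in lebesgue. S x = S' x"
    by eventually_elim (auto simp: S'_def)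
  then have ae: "AE x in lborel. S x = S' x" by (simp only: AE_completion_iff)
  have "fourier_coeff (per_ext S) n = fcoef S' n" for n
    unfolding fourier_coeff_def set_lebesgue_integral_def fcoef_def
  proof (rule lebesgue_lborel_AE(3))
    show "(\<lambda>u. S' u * wave (- of_int n) u) \<in> borel_measurable borel" using m by simp
    \<comment> \<open>The closed period contains 1, where the periodic extension takes the value at
      0; everywhere else on it \<open>frac x = x\<close>.\<close>
    have "AE x in lborel. x \<noteq> (1::real)" by (rule AE_lborel_singleton)
    then show "AE x in lborel. indicat_real {0..1} x *\<^sub>R (per_ext S x * cis (- 2 * pi * of_int n * x)) = S' x * wave (- of_int n) x"
      using ae
    proof eventually_elim
      case (elim x)
      show ?case
      proof (cases "x \<in> {0..1}")
        case True
        then have "frac x = x" using elim(1) by (simp add: frac_eq)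
        then show ?thesis using True elim(2) by (simp add: per_ext_def wave_def)
      next
        case False
        then have "x \<notin> {1/4..3/4}" by auto
        then have "S' x = 0" by (simp only: S'_def if_False)
        then show ?thesis using False by simp
      qed
    qed
  qed
  then have fc: "fcoef S' = fourier_coeff (per_ext S)" by auto
  show thesis
  proof (rule that)
    show "integrable lborel S'" using lebesgue_lborel_AE(2)[OF m ae] S(1) by simp
    show "fourier S = ftr S'" using fourier_eq_ftr[OF m ae] by auto
  qed (auto simp: S'_def fc)
qed

theorem theorem4p2:
  fixes p p' :: real
  assumes "1 < p" and "1 / p + 1 / p' = 1"
  shows "\<exists>C::real. \<forall>S :: real \<Rightarrow> complex. \<forall>\<phi> :: int \<Rightarrow> complex.
    integrable lebesgue S \<longrightarrow> ess_support S \<subseteq> {1/4..3/4} \<longrightarrow>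
    fourier_coeff (per_ext S) \<in> lspace p \<longrightarrow> \<phi> \<in> lspace p' \<longrightarrow>
      (\<forall>\<xi>. (\<lambda>n. \<phi> n * fourier S (\<xi> - of_int n)) summable_on UNIV) \<and>
      (\<forall>q. (p < 2 \<and> q \<in> {2 * p / (3 * p - 2)..2 * p / (2 - p)}) \<or>
           (2 < p \<and> q \<in> {2 * p / (p + 2)..2 * p / (p - 2)}) \<or>
           (p = 2 \<and> 1 \<le> q) \<longrightarrow>
         W_fun \<phi> (fourier S) \<in> multipliers q \<and>
         multiplier_norm q (W_fun \<phi> (fourier S))
           \<le> C * lnorm p (fourier_coeff (per_ext S)) * lnorm p' \<phi>)"
\<comment> \<open>The interpolated form bound has constant 1, so only the overlap count 6 remains,
  whatever p is.\<close>
proof (intro exI[of _ 6] allI impI)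
  fix S :: "real \<Rightarrow> complex" and \<phi> :: "int \<Rightarrow> complex"
  assume S: "integrable lebesgue S" "ess_support S \<subseteq> {1/4..3/4}"
    and a: "fourier_coeff (per_ext S) \<in> lspace p" and \<phi>: "\<phi> \<in> lspace p'"
  obtain S' where S': "integrable lborel S'" "\<And>u. u \<notin> {1/4..3/4} \<Longrightarrow> S' u = 0" "fourier S = ftr S'"
    "fcoef S' = fourier_coeff (per_ext S)"
    using kernel_representative[OF S] by blast
  let ?A = "lnorm p (fourier_coeff (per_ext S))" and ?B = "lnorm p' \<phi>"
  have p': "1 < p'" by (rule conjugate_exponent[OF assms])
  have nonneg: "0 \<le> ?A" "0 \<le> ?B" by (simp_all add: lnorm_def)
  have data: "multiplier_data p p' (?A + e) (?B + e) S' \<phi>" if e: "0 < e" for e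
  proof
    show "0 < ?A + e" "0 < ?B + e" using nonneg e by simp_all
    show "(\<Sum>k\<in>A. norm (fcoef S' k) powr p) \<le> (?A + e) powr p" if "finite A" for A
      unfolding S'(4) by (rule finite_sum_le_lnorm[OF assms(1) a that e])
    show "(\<Sum>n\<in>F. norm (\<phi> n) powr p') \<le> (?B + e) powr p'" if "finite F" for F
      by (rule finite_sum_le_lnorm[OF p' \<phi> that e])
  qed (use assms S' in auto)
  \<comment> \<open>\<open>multiplier_data.W\<close> depends on \<open>S'\<close> and
    \<open>\<phi>\<close> alone, so the multiplier stays fixed while the slack e in the bounds
    varies.\<close>
  have W: "W_fun \<phi> (fourier S) = multiplier_data.W S' \<phi>"
    unfolding W_fun_def[abs_def] multiplier_data.W_def[OF data[OF zero_less_one], abs_def] S'(3) ..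
  show "(\<forall>\<xi>. (\<lambda>n. \<phi> n * fourier S (\<xi> - of_int n)) summable_on UNIV) \<and>
      (\<forall>q. (p < 2 \<and> q \<in> {2 * p / (3 * p - 2)..2 * p / (2 - p)}) \<or>
           (2 < p \<and> q \<in> {2 * p / (p + 2)..2 * p / (p - 2)}) \<or>
           (p = 2 \<and> 1 \<le> q) \<longrightarrow>
         W_fun \<phi> (fourier S) \<in> multipliers q \<and>
         multiplier_norm q (W_fun \<phi> (fourier S)) \<le> 6 * ?A * ?B)"
  proof (intro conjI allI impI)
    show "(\<lambda>n. \<phi> n * fourier S (\<xi> - of_int n)) summable_on UNIV" for \<xi>
      unfolding S'(3) by (rule multiplier_data.W_summable[OF data[OF zero_less_one]])
    fix q
    assume "(p < 2 \<and> q \<in> {2 * p / (3 * p - 2)..2 * p / (2 - p)}) \<or>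
      (2 < p \<and> q \<in> {2 * p / (p + 2)..2 * p / (p - 2)}) \<or> (p = 2 \<and> 1 \<le> q)"
    then have adm: "admissible p q" by (simp only: admissible_def)
    show "W_fun \<phi> (fourier S) \<in> multipliers q"
      unfolding W by (rule multiplier_data.W_multiplier(1)[OF data[OF zero_less_one] adm])
    have le: "multiplier_norm q (W_fun \<phi> (fourier S)) \<le> 6 * ((?A + e) * (?B + e))" if "0 < e" for e
      unfolding W by (rule multiplier_data.W_multiplier(2)[OF data[OF that] adm])
    \<comment> \<open>Removing the slack recovers the exact norms, including the cases where one of
      them is zero.\<close>
    have "((\<lambda>e. 6 * ((?A + e) * (?B + e))) \<longlongrightarrow> 6 * ((?A + 0) * (?B + 0))) (at_right 0)"
      by (intro tendsto_intros)
    then have "multiplier_norm q (W_fun \<phi> (fourier S)) \<le> 6 * ((?A + 0) * (?B + 0))"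
      by (rule tendsto_lowerbound) (auto intro: eventually_mono[OF eventually_at_right_less] le)
    then show "multiplier_norm q (W_fun \<phi> (fourier S)) \<le> 6 * ?A * ?B" by simp
  qed
qed

end
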